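(* Let $0<\sigma\leq 1$ and $T\geq 200$, and put $$Q(\sigma,T)=\frac{1}{2\pi}\left(\int_{-\infty}^{-T}+\int_{T}^{\infty}\right)\left|\frac{\zeta(\sigma+it)}{\sigma+it}\right|^{2}dt .$$ Define the constants $\kappa=27.8821$, $\kappa_{111}=0.15659$, $\kappa_{112}=0.15655$, $\kappa_{113}=0.00979$, $\kappa_{114}=0.07407$, $\kappa_{12*}=0.30016$, $\kappa_{314}=0.11361$, $c_{21*}=2.4476$, $c_{22*}=1.58493$, $c_{30*}=0.39113$, and put $c_{11i}=\kappa^{\sigma}\kappa_{11i}$ for $i=1,2,3,4$, $c_{12*}=\kappa^{\sigma}\kappa_{12*}$, $c_{31i}=c_{11i}$ for $i=1,2,3$, $c_{314}=\kappa^{\sigma}\kappa_{314}$, $c_{32*}=c_{12*}$. Then: if $\frac{1}{2}<\sigma\leq 1$, $$Q(\sigma,T)<\frac{3\zeta(2\sigma)}{5}\cdot\frac{1}{T}+\left(\frac{c_{111}}{\sigma}+\frac{c_{112}}{2\sigma+1}+\frac{c_{113}}{\sigma+1}-\frac{c_{114}}{2\sigma-1}\right)\cdot\frac{1}{T^{2\sigma}}+c_{12*}\cdot\frac{1}{T^{2\sigma+1}};$$ if $\sigma=\frac{1}{2}$, $$Q(\sigma,T)<\frac{3}{5}\cdot\frac{\log(T)}{T}+c_{21*}\cdot\frac{1}{T}+c_{22*}\cdot\frac{1}{T^{2}};$$ if $0<\sigma<\frac{1}{2}$, $$Q(\sigma,T)<\left(\frac{c_{311}}{\sigma}+\frac{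c_{312}}{2\sigma+1}+\frac{c_{313}}{\sigma+1}+\frac{c_{314}}{1-2\sigma}\right)\cdot\frac{1}{T^{2\sigma}}+c_{30*}\zeta(2\sigma)\cdot\frac{1}{T}+c_{32*}\cdot\frac{1}{T^{2\sigma+1}}.$$
   Context: $\zeta$ is the Riemann zeta function; $Q(\sigma,T)$ equals $\frac{1}{2\pi i}\left(\int_{\sigma-i\infty}^{\sigma-iT}+\int_{\sigma+iT}^{\sigma+i\infty}\right)\left|\frac{\zeta(s)}{s}\right|^{2}ds$. *)

theory Defs
  imports "HOL-Complex_Analysis.Complex_Analysis" "HOL-Real_Asymp.Real_Asymp"
begin

section \<open>The Riemann zeta function\<close>

text \<open>
  The zeta function is the unique holomorphic function on the punctured plane that agrees with the
  Dirichlet series for \<open>Re s > 1\<close>. At the pole \<open>s = 1\<close> it takes the dummy value 0.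
  Existence and uniqueness are proved below (\<open>ex1_zeta\<close>).
\<close>

definition is_zeta :: "(complex \<Rightarrow> complex) \<Rightarrow> bool" where
  "is_zeta f \<longleftrightarrow> f holomorphic_on (- {1}) \<and>
     (\<forall>s. Re s > 1 \<longrightarrow> f s = (\<Sum>n. 1 / of_nat (Suc n) powr s)) \<and> f 1 = 0"

definition zeta :: "complex \<Rightarrow> complex" where
  "zeta = (THE f. is_zeta f)"

lemma is_zeta_unique:
  assumes "is_zeta f" "is_zeta g"
  shows "f = g"
proof
  fix s :: complex
  show "f s = g s"
  proof (cases "s = 1")
    case False
    show ?thesis
    proof (rule analytic_continuation_open[where s = "{s. Re s > 1}" and s' = "- {1}" and f = f and g = g])
      show "open {s. Re s > 1}" by (rule open_halfspace_Re_gt)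
      show "{s. Re s > 1} \<noteq> {}"
        by (rule ex_in_conv[THEN iffD1], rule exI[of _ 2]) simp
      show "connected (- {1 :: complex})"
        by (rule connected_punctured_universe) simp
      show "f z = g z" if "z \<in> {s. Re s > 1}" for z
        using that assms by (simp add: is_zeta_def)
    qed (use assms False in \<open>auto simp: is_zeta_def\<close>)
  qed (use assms in \<open>auto simp: is_zeta_def\<close>)
qed

text \<open>
  For the existence proof, \<open>W s = (s - 1) * (zeta s - 1)\<close> is continued one unit to the left at
  a time, using the binomial expansion of \<open>(N - 1) powr (1 - s)\<close> in powers of \<open>N\<close>.
\<close>

context
begin

private lemma holomorphic_suminf:
  fixes f :: "nat \<Rightarrow> complex \<Rightarrow> complex"
  assumes S: "open S" and hol: "\<And>n. f n holomorphic_on S"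
    and bd: "\<And>x. x \<in> S \<Longrightarrow> \<exists>d M. d > 0 \<and> cball x d \<subseteq> S \<and> summable M \<and>
               (\<forall>n. \<forall>y\<in>cball x d. norm (f n y) \<le> M n)"
  shows "(\<lambda>s. \<Sum>n. f n s) holomorphic_on S"
proof (rule holomorphic_uniform_sequence[OF S, where f = "\<lambda>n s. \<Sum>i<n. f i s"])
  show "(\<lambda>s. \<Sum>i<n. f i s) holomorphic_on S" for n
    by (intro holomorphic_intros hol)
  fix x assume "x \<in> S"
  from bd[OF this] obtain d M where dM: "d > 0" "cball x d \<subseteq> S" "summable M"
    "\<And>n y. y \<in> cball x d \<Longrightarrow> norm (f n y) \<le> M n"
    by metis
  have "uniform_limit (cball x d) (\<lambda>n s. \<Sum>i<n. f i s) (\<lambda>s. \<Sum>n. f n s) sequentially"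
    by (rule Weierstrass_m_test[OF dM(4) dM(3)])
  with dM show "\<exists>d>0. cball x d \<subseteq> S \<and>
      uniform_limit (cball x d) (\<lambda>n s. \<Sum>i<n. f i s) (\<lambda>s. \<Sum>n. f n s) sequentially"
    by blast
qed

private lemma norm_gbinomial_le:
  fixes a :: complex
  assumes "norm a \<le> b"
  shows "norm (a gchoose k) \<le> pochhammer b k / fact k"
proof -
  have "norm (pochhammer (-a) k) \<le> pochhammer b k"
    unfolding pochhammer_prod prod_norm[symmetric]
  proof (rule prod_mono, safe)
    fix i
    have "norm (- a + of_nat i) \<le> norm (- a) + norm (of_nat i :: complex)"
      by (rule norm_triangle_ineq)
    then show "norm (- a + of_nat i) \<le> b + of_nat i"
      using assms by simp
  qed simp
  then show ?thesis
    by (simp add: gbinomial_pochhammer norm_mult norm_divide norm_power divide_right_mono)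
qed

private lemma binomial_tail:
  fixes b :: real
  obtains C where "\<And>a z :: complex. norm a \<le> b \<Longrightarrow> norm z \<le> 1/2 \<Longrightarrow>
    norm ((1 + z) powr a - (\<Sum>k<K. (a gchoose k) * z ^ k)) \<le> C * norm z ^ K"
proof -
  define c where "c k = pochhammer b k / fact k" for k
  have "(\<lambda>n. ((-b) gchoose n) * (-1/2) ^ n) sums ((1 + (-1/2)) powr (-b))"
    by (rule gen_binomial_real) simp
  then have "summable (\<lambda>n. ((-b) gchoose n) * (-1/2) ^ n)"
    by (rule sums_summable)
  also have "(\<lambda>n. ((-b) gchoose n) * (-1/2) ^ n) = (\<lambda>n. c n * (1/2) ^ n)"
  proof
    fix n
    have "(-1) ^ n * (-1/2) ^ n = (1/2 :: real) ^ n"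
      by (simp flip: power_mult_distrib)
    then show "((-b) gchoose n) * (-1/2) ^ n = c n * (1/2) ^ n"
      by (simp add: gbinomial_pochhammer c_def mult_ac)
  qed
  finally have sm: "summable (\<lambda>n. c n * (1/2) ^ n)" .
  then have "summable (\<lambda>n. c (n + K) * (1/2) ^ (n + K))"
    by (rule summable_ignore_initial_segment)
  then have "summable (\<lambda>n. 2 ^ K * (c (n + K) * (1/2) ^ (n + K)))"
    by (rule summable_mult)
  also have "(\<lambda>n. 2 ^ K * (c (n + K) * (1/2) ^ (n + K))) = (\<lambda>n. c (n + K) * (1/2) ^ n)"
    by (simp add: power_add power_divide)
  finally have sm': "summable (\<lambda>n. c (n + K) * (1/2) ^ n)" .
  show ?thesis
  proof (rule that[of "\<Sum>n. c (n + K) * (1/2) ^ n"])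
    fix a z :: complex
    assume a: "norm a \<le> b" and z: "norm z \<le> 1/2"
    have s: "(\<lambda>n. (a gchoose n) * z ^ n) sums (1 + z) powr a"
      by (rule gen_binomial_complex) (use z in linarith)
    have "(\<lambda>n. (a gchoose (n + K)) * z ^ (n + K)) sums
            ((1 + z) powr a - (\<Sum>k<K. (a gchoose k) * z ^ k))"
      using s by (subst sums_iff_shift) simp
    then have eq: "(1 + z) powr a - (\<Sum>k<K. (a gchoose k) * z ^ k) =
                 (\<Sum>n. (a gchoose (n + K)) * z ^ (n + K))"
      by (simp add: sums_iff)
    have "norm (\<Sum>n. (a gchoose (n + K)) * z ^ (n + K)) \<le>
            (\<Sum>n. norm z ^ K * (c (n + K) * (1/2) ^ n))"
    proof (rule norm_suminf_le)
      show "summable (\<lambda>n. norm z ^ K * (c (n + K) * (1/2) ^ n))"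
        using sm' by (rule summable_mult)
      fix n
      have "norm ((a gchoose (n + K)) * z ^ (n + K)) =
              norm z ^ K * (norm (a gchoose (n + K)) * norm z ^ n)"
        by (simp add: norm_mult norm_power power_add)
      also have "\<dots> \<le> norm z ^ K * (c (n + K) * (1/2) ^ n)"
      proof (rule mult_left_mono[OF mult_mono])
        show "norm (a gchoose (n + K)) \<le> c (n + K)"
          unfolding c_def by (rule norm_gbinomial_le[OF a])
        show "norm z ^ n \<le> (1/2) ^ n"
          using z by (rule power_mono) simp
        show "0 \<le> c (n + K)"
          using norm_gbinomial_le[OF a, of "n + K"] norm_ge_zero order_trans unfolding c_def by blast
      qed simp_all
      finally show "norm ((a gchoose (n + K)) * z ^ (n + K)) \<le>
                      norm z ^ K * (c (n + K) * (1/2) ^ n)" .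
    qed
    also have "\<dots> = (\<Sum>n. c (n + K) * (1/2) ^ n) * norm z ^ K"
      using sm' by (simp add: suminf_mult mult.commute)
    finally show "norm ((1 + z) powr a - (\<Sum>k<K. (a gchoose k) * z ^ k)) \<le>
                    (\<Sum>n. c (n + K) * (1/2) ^ n) * norm z ^ K"
      by (simp only: eq)
  qed
qed

private definition D :: "complex \<Rightarrow> complex" where
  "D s = (\<Sum>n. of_nat (n + 2) powr (-s))"

private lemma norm_nat_powr:
  "norm (of_nat (n + 2) powr (s :: complex)) = real (n + 2) powr (Re s)"
  by (subst norm_powr_real_powr) auto

private lemma summable_shift_powr:
  assumes "e < -1"
  shows "summable (\<lambda>n. real (n + 2) powr e)"
  using summable_real_powr_iff[of e] assms
  by (intro summable_ignore_initial_segment[of "\<lambda>n. real n powr e"]) simp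

private lemma D_summable:
  assumes "Re s > 1"
  shows "summable (\<lambda>n. (of_nat (n + 2) :: complex) powr (-s))"
proof (rule summable_norm_cancel)
  show "summable (\<lambda>n. norm ((of_nat (n + 2) :: complex) powr (-s)))"
    unfolding norm_nat_powr by (rule summable_shift_powr) (use assms in simp)
qed

private lemma D_holomorphic: "D holomorphic_on {s. Re s > 1}"
  unfolding D_def
proof (rule holomorphic_suminf)
  show "open {s. Re s > 1}" by (rule open_halfspace_Re_gt)
  show "(\<lambda>s. of_nat (n + 2) powr (-s)) holomorphic_on {s. Re s > 1}" for n
    by (intro holomorphic_intros)
  fix x assume "x \<in> {s. Re s > 1}"
  then have x: "Re x > 1" by simp
  define d where "d = (Re x - 1) / 2"
  have d: "d > 0" using x by (simp add: d_def)
  have Re_ge: "Re y \<ge> 1 + d" if "y \<in> cball x d" for y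
  proof -
    have "\<bar>Re (x - y)\<bar> \<le> d"
      using abs_Re_le_cmod[of "x - y"] that by (simp add: dist_norm)
    moreover have "Re x = 1 + 2 * d" by (simp add: d_def field_simps)
    ultimately show ?thesis by simp
  qed
  have sub: "cball x d \<subseteq> {s. Re s > 1}"
    using Re_ge d by (metis (no_types, lifting) add_strict_increasing2 less_add_same_cancel1
        mem_Collect_eq order_less_le_trans subsetI)
  have "norm (of_nat (n + 2) powr (-y)) \<le> real (n + 2) powr (- (1 + d))"
    if "y \<in> cball x d" for n y
    unfolding norm_nat_powr by (rule powr_mono) (use Re_ge[OF that] in auto)
  moreover have "summable (\<lambda>n. real (n + 2) powr (- (1 + d)))"
    by (rule summable_shift_powr) (use d in simp)
  ultimately show "\<exists>d M. d > 0 \<and> cball x d \<subseteq> {s. Re s > 1} \<and> summable M \<and>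
      (\<forall>n. \<forall>y\<in>cball x d. norm (of_nat (n + 2) powr (-y)) \<le> M n)"
    using d sub by blast
qed

private definition W :: "complex \<Rightarrow> complex" where
  "W s = (s - 1) * D s"

private definition R :: "nat \<Rightarrow> nat \<Rightarrow> complex \<Rightarrow> complex" where
  "R K n s = of_nat (n + 1) powr (1 - s) -
     (\<Sum>k<K. (-1) ^ k * ((1 - s) gchoose k) * of_nat (n + 2) powr (1 - s - of_nat k))"

private lemma R_eq:
  "R K n s = of_nat (n + 2) powr (1 - s) *
     ((1 + (- 1 / of_nat (n + 2))) powr (1 - s) -
      (\<Sum>k<K. ((1 - s) gchoose k) * (- 1 / of_nat (n + 2)) ^ k))"
proof -
  let ?N = "of_nat (n + 2) :: complex"
  have N0: "?N \<noteq> 0" by (metis of_nat_eq_0_iff add_2_eq_Suc' nat.distinct(1))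
  have "?N powr (1 - s) * (1 + (- 1 / ?N)) powr (1 - s) =
        (of_real (real (n + 2)) * of_real (1 - 1 / real (n + 2))) powr (1 - s)"
  proof (subst powr_times_real)
    show "?N powr (1 - s) * (1 + (- 1 / ?N)) powr (1 - s) =
        of_real (real (n + 2)) powr (1 - s) * of_real (1 - 1 / real (n + 2)) powr (1 - s)"
      by simp
  qed (simp_all add: field_simps)
  also have "of_real (real (n + 2)) * of_real (1 - 1 / real (n + 2)) =
             complex_of_real (real (n + 2) * (1 - 1 / real (n + 2)))"
    by (simp only: of_real_mult)
  also have "real (n + 2) * (1 - 1 / real (n + 2)) = real (n + 1)"
    by (simp add: field_simps)
  finally have 1: "?N powr (1 - s) * (1 + (- 1 / ?N)) powr (1 - s) = of_nat (n + 1) powr (1 - s)"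
    by simp
  have 2: "?N powr (1 - s) * (((1 - s) gchoose k) * (- 1 / ?N) ^ k) =
        (-1) ^ k * ((1 - s) gchoose k) * ?N powr (1 - s - of_nat k)" for k
    using N0 by (simp add: powr_diff powr_nat' power_divide power_minus' mult_ac)
  show ?thesis
    by (simp only: R_def right_diff_distrib sum_distrib_left 1 2)
qed

private lemma gchoose_holomorphic:
  "(\<lambda>s::complex. (1 - s) gchoose k) holomorphic_on A"
  unfolding gbinomial_prod_rev by (intro holomorphic_intros) auto

private lemma R_holomorphic:
  "(\<lambda>s. \<Sum>n. R (m + 3) n s) holomorphic_on {s. Re s > - real m}"
proof (rule holomorphic_suminf)
  show op: "open {s. Re s > - real m}" by (rule open_halfspace_Re_gt)
  show "R (m + 3) n holomorphic_on {s. Re s > - real m}" for n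
    unfolding R_def by (intro holomorphic_intros gchoose_holomorphic)
  fix x assume x: "x \<in> {s. Re s > - real m}"
  obtain d where d: "d > 0" "cball x d \<subseteq> {s. Re s > - real m}"
    using op x open_contains_cball by blast
  obtain C where C: "\<And>a z :: complex. norm a \<le> 1 + norm x + d \<Longrightarrow> norm z \<le> 1/2 \<Longrightarrow>
    norm ((1 + z) powr a - (\<Sum>k<m+3. (a gchoose k) * z ^ k)) \<le> C * norm z ^ (m + 3)"
    using binomial_tail by blast
  have "C * norm (1/2 :: complex) ^ (m+3) \<ge> 0"
    by (rule order_trans[OF norm_ge_zero C[of 0 "1/2"]]) (use d in \<open>auto simp: add_nonneg_nonneg\<close>)
  then have C0: "C \<ge> 0"
    unfolding zero_le_mult_iff
    by (metis norm_divide norm_numeral norm_one not_less zero_less_divide_1_iff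
        zero_less_numeral zero_less_power)
  have bd: "norm (R (m + 3) n y) \<le> C * real (n + 2) powr (-2)" if y: "y \<in> cball x d" for n y
  proof -
    let ?z = "- 1 / of_nat (n + 2) :: complex"
    have nz: "norm ?z = real (n + 2) powr (-1)"
      unfolding norm_divide norm_of_nat by (simp add: powr_minus_divide)
    have "norm (1 - y) \<le> 1 + norm x + d"
    proof -
      have "norm (1 - y) \<le> norm (1 - x) + norm (x - y)"
        using norm_triangle_ineq[of "1 - x" "x - y"] by simp
      moreover have "norm (1 - x) \<le> 1 + norm x"
        using norm_triangle_ineq4[of 1 x] by simp
      moreover have "norm (x - y) \<le> d" using y by (simp add: dist_norm)
      ultimately show ?thesis by linarith
    qed
    moreover have "norm ?z \<le> 1/2"
      unfolding norm_divide norm_of_nat by (simp add: field_simps)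
    ultimately have "norm ((1 + ?z) powr (1 - y) - (\<Sum>k<m+3. ((1 - y) gchoose k) * ?z ^ k))
                       \<le> C * norm ?z ^ (m + 3)"
      by (rule C)
    then have "norm (R (m + 3) n y) \<le> real (n + 2) powr (1 - Re y) * (C * norm ?z ^ (m + 3))"
      unfolding R_eq norm_mult norm_nat_powr by (intro mult_mono) auto
    also have "norm ?z ^ (m + 3) = real (n + 2) powr (- real (m + 3))"
      unfolding nz by (subst powr_power) auto
    also have "real (n + 2) powr (1 - Re y) * (C * real (n + 2) powr (- real (m + 3))) =
               C * real (n + 2) powr (1 - Re y - real (m + 3))"
      by (simp only: diff_conv_add_uminus powr_add mult_ac)
    also have "\<dots> \<le> C * real (n + 2) powr (-2)"
    proof (intro mult_left_mono powr_mono C0)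
      show "1 - Re y - real (m + 3) \<le> - 2"
        using d(2) y by auto
    qed auto
    finally show ?thesis .
  qed
  have "summable (\<lambda>n. C * real (n + 2) powr (-2))"
    by (intro summable_mult summable_shift_powr) simp
  with d bd show "\<exists>d M. d > 0 \<and> cball x d \<subseteq> {s. Re s > - real m} \<and> summable M \<and>
      (\<forall>n. \<forall>y\<in>cball x d. norm (R (m + 3) n y) \<le> M n)"
    by blast
qed

private lemma R_suminf:
  assumes s: "Re s > 1"
  shows "(\<Sum>n. R (Suc K) n s) =
           1 - (\<Sum>j<K. (-1) ^ j * ((1 - s) gchoose j) / of_nat (Suc j) * W (s + of_nat j))"
proof -
  have lim: "(\<lambda>n. complex_of_nat (n + 1) powr (1 - s)) \<longlonglongrightarrow> 0"
  proof (rule tendsto_norm_zero_cancel)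
    have "(\<lambda>n. real (n + 1) powr (1 - Re s)) \<longlonglongrightarrow> 0"
    proof (rule tendsto_neg_powr)
      show "filterlim (\<lambda>n. real (n + 1)) at_top sequentially"
        by real_asymp
    qed (use s in simp)
    also have "(\<lambda>n. real (n + 1) powr (1 - Re s)) = (\<lambda>n. norm (complex_of_nat (n + 1) powr (1 - s)))"
      by (subst norm_powr_real_powr) auto
    finally show "(\<lambda>n. norm (complex_of_nat (n + 1) powr (1 - s))) \<longlonglongrightarrow> 0" .
  qed
  have 1: "(\<lambda>n. complex_of_nat (n + 1) powr (1 - s) - of_nat (n + 2) powr (1 - s)) sums 1"
    using telescope_sums'[OF lim] by simp
  have 2: "(\<lambda>n. \<Sum>j<K. (-1) ^ Suc j * ((1 - s) gchoose Suc j) * of_nat (n + 2) powr (- (s + of_nat j)))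
             sums (\<Sum>j<K. (-1) ^ Suc j * ((1 - s) gchoose Suc j) * D (s + of_nat j))"
    unfolding D_def
    by (intro sums_sum sums_mult summable_sums D_summable) (use s in simp)
  have R: "R (Suc K) n s = (of_nat (n + 1) powr (1 - s) - of_nat (n + 2) powr (1 - s)) -
         (\<Sum>j<K. (-1) ^ Suc j * ((1 - s) gchoose Suc j) * of_nat (n + 2) powr (- (s + of_nat j)))" for n
    unfolding R_def sum.lessThan_Suc_shift by (simp add: algebra_simps)
  have 3: "(-1) ^ Suc j * ((1 - s) gchoose Suc j) * D (s + of_nat j) =
           (-1) ^ j * ((1 - s) gchoose j) / of_nat (Suc j) * W (s + of_nat j)" for j
  proof -
    have "of_nat (Suc j) * ((1 - s) gchoose Suc j) = ((1 - s) gchoose j) * (1 - s - of_nat j)"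
      by (metis gbinomial_absorb_comp gbinomial_absorption mult.commute)
    then have "((1 - s) gchoose Suc j) = ((1 - s) gchoose j) * (1 - s - of_nat j) / of_nat (Suc j)"
      by (metis nonzero_mult_div_cancel_left of_nat_eq_0_iff nat.distinct(1))
    from arg_cong[OF this, of "\<lambda>x. (-1) ^ Suc j * x * D (s + of_nat j)"] show ?thesis
      by (simp add: W_def algebra_simps diff_divide_distrib add_divide_distrib del: of_nat_Suc)
  qed
  show ?thesis
    using sums_diff[OF 1 2] unfolding R[symmetric] 3 by (simp add: sums_iff)
qed

private lemma W_continuation:
  "\<exists>f. f holomorphic_on {s. Re s > 1 - real m} \<and> (\<forall>s. Re s > 1 \<longrightarrow> f s = W s)"
proof (induction m)
  case 0
  show ?case
    by (rule exI[of _ W]) (auto simp: W_def[abs_def] intro!: holomorphic_intros D_holomorphic)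
next
  case (Suc m)
  then obtain f where f: "f holomorphic_on {s. Re s > 1 - real m}"
    and fW: "\<And>s. Re s > 1 \<Longrightarrow> f s = W s" by blast
  let ?g = "\<lambda>s. 1 - (\<Sum>n. R (m + 3) n s) -
    (\<Sum>j<m + 1. (-1) ^ Suc j * ((1 - s) gchoose Suc j) / of_nat (Suc (Suc j)) * f (s + of_nat (Suc j)))"
  have "(f \<circ> (\<lambda>s. s + of_nat (Suc j))) holomorphic_on {s. Re s > - real m}" for j
    by (rule holomorphic_on_compose_gen[OF _ f]) (auto intro!: holomorphic_intros)
  then have "?g holomorphic_on {s. Re s > - real m}"
    by (intro holomorphic_intros R_holomorphic gchoose_holomorphic) (auto simp: o_def)
  moreover have "?g s = W s" if s: "Re s > 1" for s
  proof -
    have "(\<Sum>n. R (m + 3) n s) = 1 - (\<Sum>j<Suc (m + 1). (-1) ^ j * ((1 - s) gchoose j) / of_nat (Suc j) * W (s + of_nat j))"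
      using R_suminf[OF s, of "Suc (m + 1)"] by (simp add: eval_nat_numeral)
    also have "\<dots> = 1 - W s - (\<Sum>j<m + 1. (-1) ^ Suc j * ((1 - s) gchoose Suc j) / of_nat (Suc (Suc j)) * W (s + of_nat (Suc j)))"
      unfolding sum.lessThan_Suc_shift by simp
    finally show ?thesis
      using s by (simp add: fW)
  qed
  ultimately show ?case
    by (intro exI[of _ ?g]) simp
qed

private lemma W_entire:
  obtains g where "g holomorphic_on UNIV" "\<And>s. Re s > 1 \<Longrightarrow> g s = W s"
proof -
  let ?H = "\<lambda>m. {s. Re s > 1 - real m}"
  obtain F where F: "\<And>m. F m holomorphic_on ?H m" and FW: "\<And>m s. Re s > 1 \<Longrightarrow> F m s = W s"
    using W_continuation by metis
  have agree: "F m s = F m' s" if "m \<le> m'" "s \<in> ?H m" for m m' s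
  proof (rule analytic_continuation_open[where s = "?H 0" and s' = "?H m" and f = "F m" and g = "F m'"])
    show "open (?H 0)" "open (?H m)" by (rule open_halfspace_Re_gt)+
    show "?H 0 \<noteq> {}"
      by (rule ex_in_conv[THEN iffD1], rule exI[of _ 2]) simp
    show "connected (?H m)"
      by (intro convex_connected convex_halfspace_Re_gt)
    show "F m holomorphic_on ?H m" by (rule F)
    show "F m' holomorphic_on ?H m"
      by (rule holomorphic_on_subset[OF F]) (use that in auto)
    show "F m z = F m' z" if "z \<in> ?H 0" for z
      using that by (simp add: FW)
  qed (use that in auto)
  define g where "g s = F (LEAST m. s \<in> ?H m) s" for s
  have g: "g s = F m s" if "s \<in> ?H m" for m s
    unfolding g_def
    by (rule agree) (rule Least_le[of "\<lambda>m. s \<in> ?H m", OF that],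
                     rule LeastI[of "\<lambda>m. s \<in> ?H m", OF that])
  have "g holomorphic_on (\<Union>m. ?H m)"
  proof (rule holomorphic_on_UN_open)
    show "g holomorphic_on ?H m" for m
      using F[of m] by (rule holomorphic_transform) (simp add: g)
    show "open (?H m)" for m by (rule open_halfspace_Re_gt)
  qed
  also have "(\<Union>m. ?H m) = UNIV"
  proof (safe, simp_all)
    show "\<exists>m. 1 - real m < Re s" for s
      using reals_Archimedean2[of "1 - Re s"] by (auto simp: algebra_simps)
  qed
  finally have "g holomorphic_on UNIV" .
  moreover have "g s = W s" if "Re s > 1" for s
    using g[of s 0] FW[of s 0] that by simp
  ultimately show ?thesis by (rule that)
qed

lemma zeta_series_summable:
  fixes s :: complex
  assumes "Re s > 1"
  shows "summable (\<lambda>n. 1 / of_nat (Suc n) powr s)"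
proof -
  have "summable (\<lambda>n. 1 / of_nat (Suc (Suc n)) powr s)"
    using D_summable[OF assms] by (simp add: powr_minus_divide)
  then show ?thesis by (subst (asm) summable_Suc_iff)
qed

lemma ex1_zeta: "\<exists>!f. is_zeta f"
proof (rule ex_ex1I)
  obtain g where g: "g holomorphic_on UNIV" and gW: "\<And>s. Re s > 1 \<Longrightarrow> g s = W s"
    using W_entire by blast
  let ?f = "\<lambda>s. if s = 1 then 0 else g s / (s - 1) + 1"
  have "(\<lambda>s. g s / (s - 1) + 1) holomorphic_on (- {1})"
    by (intro holomorphic_intros holomorphic_on_subset[OF g]) auto
  then have "?f holomorphic_on (- {1})"
    by (rule holomorphic_transform) auto
  moreover have "?f s = (\<Sum>n. 1 / of_nat (Suc n) powr s)" if s: "Re s > 1" for s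
  proof -
    have "(\<lambda>n. of_nat (n + 2) powr (-s)) sums D s"
      unfolding D_def by (intro summable_sums D_summable s)
    then have "(\<lambda>n. 1 / of_nat (Suc (Suc n)) powr s) sums D s"
      by (simp add: powr_minus_divide)
    then have "(\<lambda>n. 1 / of_nat (Suc n) powr s) sums (D s + 1 / of_nat (Suc 0) powr s)"
      by (rule sums_Suc)
    moreover have "?f s = D s + 1"
      using s by (auto simp: gW W_def)
    ultimately show ?thesis
      by (simp add: sums_iff)
  qed
  ultimately show "\<exists>f. is_zeta f"
    unfolding is_zeta_def by (intro exI[of _ ?f]) simp
qed (rule is_zeta_unique)

end

lemma is_zeta_zeta: "is_zeta zeta"
  unfolding zeta_def by (rule theI'[OF ex1_zeta])

lemma zeta_cnj: "zeta (cnj s) = cnj (zeta s)"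
proof -
  have "is_zeta (cnj \<circ> zeta \<circ> cnj)"
    unfolding is_zeta_def
  proof (intro conjI allI impI)
    have "x \<in> cnj ` (- {1})" if "x \<noteq> 1" for x
      using that by (intro image_eqI[of _ _ "cnj x"]) auto
    then have "cnj ` (- {1}) = - {1}" by auto
    then show "cnj \<circ> zeta \<circ> cnj holomorphic_on - {1}"
      using is_zeta_zeta by (intro holomorphic_on_compose_cnj_cnj) (auto simp: is_zeta_def)
  next
    fix s :: complex assume s: "Re s > 1"
    have "zeta (cnj s) = (\<Sum>n. 1 / of_nat (Suc n) powr cnj s)"
      using is_zeta_zeta s by (simp add: is_zeta_def)
    also have "\<dots> = (\<Sum>n. cnj (1 / of_nat (Suc n) powr s))"
      by (simp add: cnj_powr)
    also have "\<dots> = cnj (\<Sum>n. 1 / of_nat (Suc n) powr s)"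
    proof (rule sums_unique[symmetric])
      show "(\<lambda>n. cnj (1 / of_nat (Suc n) powr s)) sums cnj (\<Sum>n. 1 / of_nat (Suc n) powr s)"
        unfolding sums_cnj by (rule summable_sums[OF zeta_series_summable[OF s]])
    qed
    finally show "(cnj \<circ> zeta \<circ> cnj) s = (\<Sum>n. 1 / of_nat (Suc n) powr s)"
      by simp
  qed (use is_zeta_zeta in \<open>simp add: is_zeta_def\<close>)
  from is_zeta_unique[OF is_zeta_zeta this] show ?thesis
    by (metis comp_apply complex_cnj_cnj)
qed

definition real_zeta :: "real \<Rightarrow> real" where
  "real_zeta x = Re (zeta (of_real x))"

text \<open>Taking the real part loses nothing, also left of the line \<open>Re s = 1\<close>.\<close>

lemma of_real_real_zeta: "of_real (real_zeta x) = zeta (of_real x)"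
  using zeta_cnj[of "of_real x"] by (simp add: real_zeta_def complex_eq_iff)


section \<open>The tail integral\<close>

definition Q_integrand :: "real \<Rightarrow> real \<Rightarrow> real" where
  "Q_integrand \<sigma> t = (cmod (zeta (Complex \<sigma> t) / Complex \<sigma> t))\<^sup>2"

definition Q :: "real \<Rightarrow> real \<Rightarrow> real" where
  "Q \<sigma> T = 1 / (2 * pi) *
     ((LBINT t:{..-T}. Q_integrand \<sigma> t) + (LBINT t:{T..}. Q_integrand \<sigma> t))"

text \<open>
  The integral of a non-integrable function is 0 by convention, so an upper bound on \<open>Q\<close> is
  only meaningful together with this condition. As the integrand is nonnegative, it is equivalent
  to the convergence of the two improper integrals.
\<close>

definition Q_converges :: "real \<Rightarrow> real \<Rightarrow> bool" where
  "Q_converges \<sigma> T \<longleftrightarrow>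
     set_integrable lborel {..-T} (Q_integrand \<sigma>) \<and> set_integrable lborel {T..} (Q_integrand \<sigma>)"


section \<open>The constants\<close>

text \<open>A trailing \<open>s\<close> in a name stands for a star in the subscript.\<close>

definition kappa :: real where "kappa = 27.8821"
definition kappa111 :: real where "kappa111 = 0.15659"
definition kappa112 :: real where "kappa112 = 0.15655"
definition kappa113 :: real where "kappa113 = 0.00979"
definition kappa114 :: real where "kappa114 = 0.07407"
definition kappa12s :: real where "kappa12s = 0.30016"
definition kappa314 :: real where "kappa314 = 0.11361"

definition c111 :: "real \<Rightarrow> real" where "c111 \<sigma> = kappa powr \<sigma> * kappa111"
definition c112 :: "real \<Rightarrow> real" where "c112 \<sigma> = kappa powr \<sigma> * kappa112"
definition c113 :: "real \<Rightarrow> real" where "c113 \<sigma> = kappa powr \<sigma> * kappa113"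
definition c114 :: "real \<Rightarrow> real" where "c114 \<sigma> = kappa powr \<sigma> * kappa114"
definition c12s :: "real \<Rightarrow> real" where "c12s \<sigma> = kappa powr \<sigma> * kappa12s"

definition c21s :: real where "c21s = 2.4476"
definition c22s :: real where "c22s = 1.58493"

definition c30s :: real where "c30s = 0.39113"
definition c311 :: "real \<Rightarrow> real" where "c311 \<sigma> = c111 \<sigma>"
definition c312 :: "real \<Rightarrow> real" where "c312 \<sigma> = c112 \<sigma>"
definition c313 :: "real \<Rightarrow> real" where "c313 \<sigma> = c113 \<sigma>"
definition c314 :: "real \<Rightarrow> real" where "c314 \<sigma> = kappa powr \<sigma> * kappa314"
definition c32s :: "real \<Rightarrow> real" where "c32s \<sigma> = c12s \<sigma>"

end

theory Submission
  imports Defs "HOL-Probability.Characteristic_Functions"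
begin

text \<open>
  For \<open>0 < \<sigma> < 1\<close> and \<open>s = \<sigma> + it\<close>, the function \<open>- \<zeta>(s) / s\<close> is the Mellin transform of the fractional
  part \<open>{x}\<close>. Let \<open>\<delta> = 5 / T\<close> and subtract from \<open>{x}\<close> its average over \<open>{x y}\<close>, with \<open>y\<close> distributed on
  \<open>[1 - \<delta>, 1 + \<delta>]\<close> with tent-shaped density. This multiplies the transform by \<open>1 - M(s)\<close>, where \<open>M\<close> is
  close to \<open>(sin(\<delta>t/2) / (\<delta>t/2))\<^sup>2\<close>, so that \<open>|M(s)| \<le> 0.0785\<close> whenever \<open>|t| \<ge> T\<close>. Hence, by Plancherel,
  \<open>Q(\<sigma>, T)\<close> is at most \<open>1 / 0.9215\<^sup>2\<close> times the \<open>L\<^sup>2\<close> norm squared of the difference, with weight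
  \<open>x powr (- 2 * \<sigma> - 1)\<close>.

  The average preserves linear functions, so for \<open>x \<le> T / 5\<close> the difference is concentrated around the
  integers; the jump at \<open>n\<close> contributes about \<open>n powr (- 2 * \<sigma>) * \<delta> / 10\<close>, and overlapping contributions of
  neighbouring jumps have opposite signs. For \<open>x \<ge> T / 5\<close> the difference is at most \<open>1/2\<close> in absolute
  value. The resulting partial sum of \<open>\<zeta>(2\<sigma>)\<close> is compared with \<open>\<zeta>(2\<sigma>)\<close> itself. The case \<open>\<sigma> = 1\<close>, in which
  \<open>{x}\<close> is not square integrable at 0 with the weight above, follows by Fatou's lemma.
\<close>

section \<open>An inequality of Plancherel type\<close>

text \<open>Plancherel for {x} itself would measure all frequencies, and those with |t| < T
  dominate. Near t = 0 the factor 1 - M(s) is small, so subtracting the average damps them while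
  costing little for |t| \<ge> T. The width \<delta> = 5 / T is a compromise. For \<delta> = c / T a
  jump has energy about \<delta> / 10, because (1 - v)^4 / 4 integrates to 1/20 over [0, 1] and a
  jump has two sides. The leading coefficient is therefore about c / (10 * (1 - m)^2), where m
  bounds |M(s)|. Larger c raises the numerator, smaller c raises m. With c = 5 the coefficient is
  below 0.59, short of the 3/5 in the claim. The cut at x = T / c puts the factor c^(2\<sigma>) = 25
  powr \<sigma> in front of T powr (-2\<sigma>); that 25 is below \<open>kappa\<close> leaves room
  for the other losses. The estimate \<open>Q_bound\<close> is uniform in \<sigma>. The three cases
  separate only at the end, since \<zeta>(2\<sigma>) and 1 / (1 - 2\<sigma>) change sign at \<sigma>
  = 1/2, where \<zeta>(2\<sigma>) has its pole and a logarithm takes its place.\<close>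

lemma nn_integral_le_limit:
  fixes f :: "nat \<Rightarrow> 'a \<Rightarrow> real" and c :: "nat \<Rightarrow> real"
  assumes meas: "\<And>n. f n \<in> borel_measurable M"
    and lim: "\<And>x. x \<in> space M \<Longrightarrow> (\<lambda>n. f n x) \<longlonglongrightarrow> g x"
    and bound: "\<And>n. (\<integral>\<^sup>+x. ennreal (f n x) \<partial>M) \<le> ennreal (c n)"
    and c: "c \<longlonglongrightarrow> c'"
  shows "(\<integral>\<^sup>+x. ennreal (g x) \<partial>M) \<le> ennreal c'"
proof -
  have "(\<integral>\<^sup>+x. ennreal (g x) \<partial>M) = (\<integral>\<^sup>+x. liminf (\<lambda>n. ennreal (f n x)) \<partial>M)"
    by (intro nn_integral_cong lim_imp_Liminf[symmetric] tendsto_ennrealI lim) auto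
  also have "\<dots> \<le> liminf (\<lambda>n. \<integral>\<^sup>+x. ennreal (f n x) \<partial>M)"
    using meas by (intro nn_integral_liminf) auto
  also have "\<dots> \<le> liminf (\<lambda>n. ennreal (c n))"
    by (intro Liminf_mono always_eventually allI bound)
  also have "\<dots> = ennreal c'"
    by (intro lim_imp_Liminf tendsto_ennrealI c) auto
  finally show ?thesis .
qed

text \<open>Fubini, dominated by B |f(x)| |g(y)|. It will be applied with a Gaussian and
  \<open>h\<close> as the integrable functions; the kernel is an oscillating factor, possibly times
  a bounded Fourier transform.\<close>

lemma integral_bounded_kernel_swap:
  fixes f g :: "real \<Rightarrow> complex" and K :: "real \<Rightarrow> real \<Rightarrow> complex"
  assumes f: "integrable lborel f" and g: "integrable lborel g"
    and K [measurable]: "(\<lambda>(x, y). K x y) \<in> borel_measurable (lborel \<Otimes>\<^sub>M lborel)"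
    and bound: "\<And>x y. norm (K x y) \<le> B"
  shows "(\<integral>x. f x * (\<integral>y. g y * K x y \<partial>lborel) \<partial>lborel) =
         (\<integral>y. g y * (\<integral>x. f x * K x y \<partial>lborel) \<partial>lborel)"
proof -
  have [measurable]: "f \<in> borel_measurable lborel" "g \<in> borel_measurable lborel"
    using f g by auto
  have B: "B \<ge> 0"
    using bound[of 0 0] norm_ge_zero order_trans by blast
  have K1: "K x \<in> borel_measurable lborel" for x
    using measurable_compose[OF _ K, of "\<lambda>y. (x, y)" lborel] by simp
  have K2: "(\<lambda>x. K x y) \<in> borel_measurable lborel" for y
    using measurable_compose[OF _ K, of "\<lambda>x. (x, y)" lborel] by simp
  have gK: "integrable lborel (\<lambda>y. g y * K x y)" for x
  proof (rule Bochner_Integration.integrable_bound)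
    show "integrable lborel (\<lambda>y. B * norm (g y))"
      using g by (intro integrable_mult_right integrable_norm)
    show "AE y in lborel. norm (g y * K x y) \<le> norm (B * norm (g y))"
      using B bound[of x] by (intro AE_I2) (auto simp: norm_mult abs_mult mult.commute[of B] intro!: mult_left_mono)
  qed (use K1 in measurable)
  have int: "integrable (lborel \<Otimes>\<^sub>M lborel) (\<lambda>(x, y). f x * g y * K x y)"
  proof (rule lborel_pair.Fubini_integrable)
    show "(\<lambda>(x, y). f x * g y * K x y) \<in> borel_measurable (lborel \<Otimes>\<^sub>M lborel)"
      by measurable
    have 1: "(\<integral>y. norm (f x * g y * K x y) \<partial>lborel) = norm (f x) * (\<integral>y. norm (g y * K x y) \<partial>lborel)" for x
      by (simp add: norm_mult mult.assoc)
    have 2: "(\<integral>y. norm (g y * K x y) \<partial>lborel) \<le> (\<integral>y. B * norm (g y) \<partial>lborel)" for x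
      using gK g by (intro integral_mono integrable_norm integrable_mult_right)
         (auto simp: norm_mult mult.commute[of B] intro!: mult_left_mono bound)
    have "integrable lborel (\<lambda>x. norm (f x) * (\<integral>y. norm (g y * K x y) \<partial>lborel))"
    proof (rule Bochner_Integration.integrable_bound)
      show "integrable lborel (\<lambda>x. norm (f x) * (\<integral>y. B * norm (g y) \<partial>lborel))"
        using f by (intro integrable_mult_left integrable_norm)
      show "AE x in lborel. norm (norm (f x) * (\<integral>y. norm (g y * K x y) \<partial>lborel))
              \<le> norm (norm (f x) * (\<integral>y. B * norm (g y) \<partial>lborel))"
        using 2 by (intro AE_I2) (auto simp: abs_mult B intro!: mult_left_mono integral_nonneg_AE)
    qed measurable
    then show "integrable lborel (\<lambda>x. \<integral>y. norm (case (x, y) of (x, y) \<Rightarrow> f x * g y * K x y) \<partial>lborel)"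
      by (simp add: 1)
    show "AE x in lborel. integrable lborel (\<lambda>y. case (x, y) of (x, y) \<Rightarrow> f x * g y * K x y)"
      using gK by (auto simp: mult.assoc)
  qed
  have "(\<integral>x. f x * (\<integral>y. g y * K x y \<partial>lborel) \<partial>lborel) = (\<integral>x. (\<integral>y. f x * g y * K x y \<partial>lborel) \<partial>lborel)"
    by (simp add: mult.assoc)
  also have "\<dots> = (\<integral>y. (\<integral>x. f x * g y * K x y \<partial>lborel) \<partial>lborel)"
    using lborel_pair.Fubini_integral[OF int] by simp
  also have "\<dots> = (\<integral>y. (\<integral>x. g y * (f x * K x y) \<partial>lborel) \<partial>lborel)"
    by (simp only: mult_ac)
  also have "\<dots> = (\<integral>y. g y * (\<integral>x. f x * K x y \<partial>lborel) \<partial>lborel)"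
    by simp
  finally show ?thesis .
qed

section \<open>Fourier transform and Gaussian-weighted Plancherel inequality\<close>

definition fourier :: "(real \<Rightarrow> real) \<Rightarrow> real \<Rightarrow> complex" where
  "fourier h t = (\<integral>u. of_real (h u) * cis (-(t * u)) \<partial>lborel)"

lemma borel_measurable_fourier [measurable]:
  assumes [measurable]: "h \<in> borel_measurable borel"
  shows "fourier h \<in> borel_measurable borel"
  unfolding fourier_def cis_conv_exp by measurable

lemma norm_fourier_le: "norm (fourier h t) \<le> (\<integral>u. \<bar>h u\<bar> \<partial>lborel)"
  unfolding fourier_def by (rule order_trans[OF integral_norm_bound]) (simp add: norm_mult)

lemma fourier_std_normal:
  assumes e: "e > 0"
  shows "(\<integral>t. of_real (std_normal_density (e * t)) * cis (t * a) \<partial>lborel) =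
         of_real (sqrt (2 * pi) * normal_density 0 e a)"
proof -
  have "(\<integral>x. of_real (std_normal_density x) * cis (x * b) \<partial>lborel) = of_real (exp (- b\<^sup>2 / 2))" for b
  proof -
    have "char std_normal_distribution b = (\<integral>x. std_normal_density x *\<^sub>R iexp (b * x) \<partial>lborel)"
      unfolding char_def by (subst integral_density) (auto simp: normal_density_nonneg)
    then show ?thesis
      by (simp add: char_std_normal_distribution cis_conv_exp scaleR_conv_of_real mult_ac)
  qed
  from this[of "a / e"]
  have "of_real (exp (- (a / e)\<^sup>2 / 2)) =
      \<bar>e\<bar> *\<^sub>R (\<integral>t. of_real (std_normal_density (0 + e * t)) * cis ((0 + e * t) * (a / e)) \<partial>lborel)"
    by (subst lborel_integral_real_affine[symmetric, of e _ 0]) (use e in auto)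
  also have "\<dots> = of_real e * (\<integral>t. of_real (std_normal_density (e * t)) * cis (t * a) \<partial>lborel)"
    using e by (simp add: scaleR_conv_of_real)
  finally have "(\<integral>t. of_real (std_normal_density (e * t)) * cis (t * a) \<partial>lborel) =
      of_real (exp (- (a / e)\<^sup>2 / 2)) / of_real e"
    using e by (simp add: field_simps)
  also have "\<dots> = of_real (exp (- (a / e)\<^sup>2 / 2) / e)"
    by simp
  also have "exp (- (a / e)\<^sup>2 / 2) / e = sqrt (2 * pi) * normal_density 0 e a"
    using e by (simp add: normal_density_def real_sqrt_mult power_divide field_simps)
  finally show ?thesis .
qed

text \<open>
  With the Gaussian weight, the left-hand side is a quadratic form in \<open>h\<close> whose kernel is a positive
  convolution kernel of integral \<open>sqrt (2 * pi)\<close>, to which Schur's test applies.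
\<close>

lemma nn_integral_fourier_gaussian_le:
  fixes h :: "real \<Rightarrow> real"
  assumes h: "integrable lborel h" and e: "e > 0"
  shows "(\<integral>\<^sup>+t. ennreal (std_normal_density (e * t) * (cmod (fourier h t))\<^sup>2) \<partial>lborel)
           \<le> ennreal (sqrt (2 * pi)) * (\<integral>\<^sup>+u. ennreal ((h u)\<^sup>2) \<partial>lborel)"
proof -
  have [measurable]: "h \<in> borel_measurable borel"
    using h by auto
  define w where "w t = std_normal_density (e * t)" for t
  define K where "K a = sqrt (2 * pi) * normal_density 0 e a" for a
  have [measurable]: "w \<in> borel_measurable borel" "K \<in> borel_measurable borel"
    unfolding w_def[abs_def] K_def[abs_def] by measurable
  have K0: "K a \<ge> 0" and w0: "w a \<ge> 0" for a
    by (simp_all add: K_def w_def)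
  have intK: "(\<integral>\<^sup>+a. ennreal (K (b + c * a)) \<partial>lborel) = ennreal (sqrt (2 * pi))" if "\<bar>c\<bar> = 1" for b c
  proof -
    have "c \<noteq> 0" using that by auto
    have "(\<integral>\<^sup>+a. ennreal (K (b + c * a)) \<partial>lborel) = (\<integral>\<^sup>+a. ennreal (K a) \<partial>lborel)"
      using that \<open>c \<noteq> 0\<close> nn_integral_real_affine[of "\<lambda>a. ennreal (K a)" c b] by simp
    also have "\<dots> = ennreal (sqrt (2 * pi)) * (\<integral>\<^sup>+a. ennreal (normal_density 0 e a) \<partial>lborel)"
      unfolding K_def by (simp add: ennreal_mult nn_integral_cmult)
    also have "(\<integral>\<^sup>+a. ennreal (normal_density 0 e a) \<partial>lborel) = 1"
      using e by (subst nn_integral_eq_integral) auto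
    finally show ?thesis by simp
  qed
  have intK1: "(\<integral>\<^sup>+u. ennreal (1/2 * c\<^sup>2 * K (u - v)) \<partial>lborel) = ennreal (1/2 * c\<^sup>2) * ennreal (sqrt (2 * pi))" for c v
    using intK[of 1 "-v"] K0 by (simp add: ennreal_mult nn_integral_cmult del: times_divide_eq_left)
  have intK2: "(\<integral>\<^sup>+v. ennreal (1/2 * c\<^sup>2 * K (u - v)) \<partial>lborel) = ennreal (1/2 * c\<^sup>2) * ennreal (sqrt (2 * pi))" for c u
    using intK[of "-1" u] K0 by (simp add: ennreal_mult nn_integral_cmult del: times_divide_eq_left)
  have w_int: "integrable lborel (\<lambda>t. complex_of_real (w t))"
  proof -
    have "integrable lborel (\<lambda>t. std_normal_density (0 + e * t))"
      using e by (intro lborel_integrable_real_affine) auto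
    then show ?thesis unfolding w_def by (simp add: complex_of_real_integrable_eq)
  qed
  have h_int: "integrable lborel (\<lambda>t. complex_of_real (h t))"
    using h by (simp add: complex_of_real_integrable_eq)
  define B where "B = (\<integral>u. \<bar>h u\<bar> \<partial>lborel)"
  have wF_int: "integrable lborel (\<lambda>t. w t * (cmod (fourier h t))\<^sup>2)"
  proof (rule Bochner_Integration.integrable_bound)
    show "integrable lborel (\<lambda>t. w t * B\<^sup>2)"
      using w_int by (intro integrable_mult_left) (simp add: complex_of_real_integrable_eq)
    show "AE t in lborel. norm (w t * (cmod (fourier h t))\<^sup>2) \<le> norm (w t * B\<^sup>2)"
      unfolding B_def using w0
      by (intro AE_I2) (auto simp: abs_mult intro!: mult_left_mono power_mono norm_fourier_le)
  qed measurable
  let ?V = "\<integral>t. w t * (cmod (fourier h t))\<^sup>2 \<partial>lborel"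
  have inner: "(\<integral>t. of_real (w t) * (cis (-(t * u)) * cnj (fourier h t)) \<partial>lborel) =
               of_real (\<integral>v. h v * K (u - v) \<partial>lborel)" for u
  proof -
    have "(\<integral>t. of_real (w t) * (cis (-(t * u)) * cnj (fourier h t)) \<partial>lborel) =
      (\<integral>t. of_real (w t) * (\<integral>v. of_real (h v) * cis (t * (v - u)) \<partial>lborel) \<partial>lborel)"
      unfolding fourier_def
    proof (intro Bochner_Integration.integral_cong refl arg_cong2[where f = "(*)"])
      fix t
      have "cis (-(t * u)) * cnj (\<integral>v. of_real (h v) * cis (-(t * v)) \<partial>lborel) =
            (\<integral>v. cis (-(t * u)) * (of_real (h v) * cis (t * v)) \<partial>lborel)"
        by (simp add: cis_cnj flip: Bochner_Integration.integral_cnj)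
      also have "\<dots> = (\<integral>v. of_real (h v) * cis (t * (v - u)) \<partial>lborel)"
        by (simp add: cis_mult mult.left_commute algebra_simps)
      finally show "cis (-(t * u)) * cnj (\<integral>v. of_real (h v) * cis (-(t * v)) \<partial>lborel) =
            (\<integral>v. of_real (h v) * cis (t * (v - u)) \<partial>lborel)" .
    qed
    also have "\<dots> = (\<integral>v. of_real (h v) * (\<integral>t. of_real (w t) * cis (t * (v - u)) \<partial>lborel) \<partial>lborel)"
    proof (rule integral_bounded_kernel_swap[OF w_int h_int, of _ 1])
      show "(\<lambda>(t, v). cis (t * (v - u))) \<in> borel_measurable (lborel \<Otimes>\<^sub>M lborel)"
        unfolding cis_conv_exp by measurable
    qed simp
    also have "\<dots> = (\<integral>v. of_real (h v * K (u - v)) \<partial>lborel)"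
      unfolding w_def fourier_std_normal[OF e]
      by (simp add: K_def normal_density_def power2_commute)
    finally show ?thesis by (simp only: integral_complex_of_real)
  qed
  \<comment> \<open>|F|^2 is F times its conjugate. Unfolding one factor here and evaluating the
    other by \<open>inner\<close> turns the weighted norm into the quadratic form of
    \<open>K\<close>.\<close>
  have "complex_of_real ?V = (\<integral>t. of_real (w t) * (fourier h t * cnj (fourier h t)) \<partial>lborel)"
    by (simp flip: integral_complex_of_real complex_norm_square)
  also have "\<dots> = (\<integral>t. of_real (w t) * (\<integral>u. of_real (h u) * (cis (-(t * u)) * cnj (fourier h t)) \<partial>lborel) \<partial>lborel)"
    by (simp add: fourier_def mult.assoc flip: integral_mult_left_zero)
  also have "\<dots> = (\<integral>u. of_real (h u) * (\<integral>t. of_real (w t) * (cis (-(t * u)) * cnj (fourier h t)) \<partial>lborel) \<partial>lborel)"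
  proof (rule integral_bounded_kernel_swap[OF w_int h_int, of _ B])
    have "cnj \<in> borel_measurable borel"
      by (intro borel_measurable_continuous_onI continuous_intros)
    then have [measurable]: "(\<lambda>t. cnj (fourier h t)) \<in> borel_measurable borel"
      by (rule measurable_compose[rotated]) measurable
    show "(\<lambda>(t, u). cis (- (t * u)) * cnj (fourier h t)) \<in> borel_measurable (lborel \<Otimes>\<^sub>M lborel)"
      unfolding cis_conv_exp by measurable
  qed (simp add: norm_mult norm_fourier_le B_def)
  also have "\<dots> = (\<integral>u. of_real (h u * (\<integral>v. h v * K (u - v) \<partial>lborel)) \<partial>lborel)"
    by (simp only: inner of_real_mult)
  finally have V: "?V = (\<integral>u. h u * (\<integral>v. h v * K (u - v) \<partial>lborel) \<partial>lborel)"
    by (simp only: integral_complex_of_real of_real_eq_iff)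
  \<comment> \<open>A non-integrable function has integral 0 by convention, so this bound holds for
    every \<open>f\<close>.\<close>
  have le: "ennreal \<bar>\<integral>x. f x \<partial>lborel\<bar> \<le> (\<integral>\<^sup>+x. ennreal \<bar>f x\<bar> \<partial>lborel)" for f :: "real \<Rightarrow> real"
    using integral_norm_bound_ennreal[of lborel f]
    by (cases "integrable lborel f") (simp_all add: not_integrable_integral_eq)
  have "(\<integral>\<^sup>+t. ennreal (w t * (cmod (fourier h t))\<^sup>2) \<partial>lborel) = ennreal ?V"
    using wF_int w0 by (intro nn_integral_eq_integral) auto
  also have "\<dots> \<le> (\<integral>\<^sup>+u. ennreal \<bar>h u * (\<integral>v. h v * K (u - v) \<partial>lborel)\<bar> \<partial>lborel)"
    unfolding V by (rule order_trans[OF _ le]) (simp add: ennreal_leI)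
  also have "\<dots> \<le> (\<integral>\<^sup>+u. ennreal \<bar>h u\<bar> * (\<integral>\<^sup>+v. ennreal \<bar>h v * K (u - v)\<bar> \<partial>lborel) \<partial>lborel)"
    unfolding abs_mult[of "h _" "integral\<^sup>L _ _"]
    by (intro nn_integral_mono) (auto simp: ennreal_mult intro!: mult_left_mono le)
  also have "\<dots> = (\<integral>\<^sup>+u. (\<integral>\<^sup>+v. ennreal (\<bar>h u\<bar> * \<bar>h v\<bar> * K (u - v)) \<partial>lborel) \<partial>lborel)"
    by (simp add: abs_mult K0 ennreal_mult mult.assoc flip: nn_integral_cmult)
  \<comment> \<open>The inequality of arithmetic and geometric means splits the form into two terms.
    In each of them the kernel can be integrated over the variable that the square does not
    contain.\<close>
  also have "\<dots> \<le> (\<integral>\<^sup>+u. (\<integral>\<^sup>+v. ennreal (1/2 * (h u)\<^sup>2 * K (u - v)) + ennreal (1/2 * (h v)\<^sup>2 * K (u - v)) \<partial>lborel) \<partial>lborel)"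
  proof (intro nn_integral_mono)
    fix u v :: real
    have "0 \<le> (\<bar>h u\<bar> - \<bar>h v\<bar>)\<^sup>2" by simp
    then have "\<bar>h u\<bar> * \<bar>h v\<bar> \<le> 1/2 * (h u)\<^sup>2 + 1/2 * (h v)\<^sup>2"
      by (simp add: power2_diff)
    from mult_right_mono[OF this K0[of "u - v"]]
    have "ennreal (\<bar>h u\<bar> * \<bar>h v\<bar> * K (u - v)) \<le> ennreal (1/2 * (h u)\<^sup>2 * K (u - v) + 1/2 * (h v)\<^sup>2 * K (u - v))"
      by (intro ennreal_leI) (simp only: distrib_right)
    also have "\<dots> = ennreal (1/2 * (h u)\<^sup>2 * K (u - v)) + ennreal (1/2 * (h v)\<^sup>2 * K (u - v))"
      by (rule ennreal_plus) (use K0 in simp_all)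
    finally show "ennreal (\<bar>h u\<bar> * \<bar>h v\<bar> * K (u - v)) \<le>
        ennreal (1/2 * (h u)\<^sup>2 * K (u - v)) + ennreal (1/2 * (h v)\<^sup>2 * K (u - v))" .
  qed
  also have "\<dots> = (\<integral>\<^sup>+u. (\<integral>\<^sup>+v. ennreal (1/2 * (h u)\<^sup>2 * K (u - v)) \<partial>lborel) \<partial>lborel) +
                   (\<integral>\<^sup>+u. (\<integral>\<^sup>+v. ennreal (1/2 * (h v)\<^sup>2 * K (u - v)) \<partial>lborel) \<partial>lborel)"
    by (simp add: nn_integral_add)
  also have "(\<integral>\<^sup>+u. (\<integral>\<^sup>+v. ennreal (1/2 * (h v)\<^sup>2 * K (u - v)) \<partial>lborel) \<partial>lborel) =
             (\<integral>\<^sup>+v. (\<integral>\<^sup>+u. ennreal (1/2 * (h v)\<^sup>2 * K (u - v)) \<partial>lborel) \<partial>lborel)"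
    by (rule lborel_pair.Fubini') measurable
  also have "\<dots> = (\<integral>\<^sup>+v. ennreal (1/2 * (h v)\<^sup>2) * ennreal (sqrt (2 * pi)) \<partial>lborel)"
    by (simp only: intK1)
  also have "(\<integral>\<^sup>+u. (\<integral>\<^sup>+v. ennreal (1/2 * (h u)\<^sup>2 * K (u - v)) \<partial>lborel) \<partial>lborel) =
             (\<integral>\<^sup>+v. ennreal (1/2 * (h v)\<^sup>2) * ennreal (sqrt (2 * pi)) \<partial>lborel)"
    by (simp only: intK2)
  also have "(\<integral>\<^sup>+v. ennreal (1/2 * (h v)\<^sup>2) * ennreal (sqrt (2 * pi)) \<partial>lborel) +
             (\<integral>\<^sup>+v. ennreal (1/2 * (h v)\<^sup>2) * ennreal (sqrt (2 * pi)) \<partial>lborel) =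
             (\<integral>\<^sup>+v. ennreal (sqrt (2 * pi)) * ennreal ((h v)\<^sup>2) \<partial>lborel)"
    by (subst nn_integral_add[symmetric], measurable)
       (intro nn_integral_cong, simp flip: ennreal_mult ennreal_plus)
  finally show ?thesis
    by (simp add: w_def nn_integral_cmult)
qed

text \<open>The weight \<open>sqrt (2 * pi) * std_normal_density (e * t)\<close> tends to 1 as e
  tends to 0, and Fatou carries the uniform bound to the limit. One factor
  \<open>sqrt (2 * pi)\<close> normalises the weight, the other is the mass of the convolution
  kernel.\<close>

lemma plancherel_le:
  fixes h :: "real \<Rightarrow> real"
  assumes h: "integrable lborel h" and h2: "(\<integral>\<^sup>+u. ennreal ((h u)\<^sup>2) \<partial>lborel) \<le> ennreal E"
  shows "(\<integral>\<^sup>+t. ennreal ((cmod (fourier h t))\<^sup>2) \<partial>lborel) \<le> ennreal (2 * pi * E)"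
proof (cases "E \<ge> 0")
  case E: True
  have [measurable]: "h \<in> borel_measurable borel"
    using h by auto
  let ?e = "\<lambda>n. 1 / real (Suc n)"
  define f where "f n t = sqrt (2 * pi) * (std_normal_density (?e n * t) * (cmod (fourier h t))\<^sup>2)" for n t
  show ?thesis
  proof (rule nn_integral_le_limit[of f _ _ "\<lambda>_. 2 * pi * E"])
    show "f n \<in> borel_measurable lborel" for n
      unfolding f_def[abs_def] by measurable
    fix t
    have "(\<lambda>n. ?e n * t) \<longlonglongrightarrow> 0 * t"
      by (intro tendsto_intros) real_asymp
    then have "(\<lambda>n. f n t) \<longlonglongrightarrow> sqrt (2 * pi) * (1 / sqrt (2 * pi) * exp (- 0\<^sup>2 / 2) * (cmod (fourier h t))\<^sup>2)"
      unfolding f_def std_normal_density_def by (intro tendsto_intros) auto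
    then show "(\<lambda>n. f n t) \<longlonglongrightarrow> (cmod (fourier h t))\<^sup>2"
      by simp
  next
    fix n
    have "(\<integral>\<^sup>+t. ennreal (f n t) \<partial>lborel) =
      ennreal (sqrt (2 * pi)) * (\<integral>\<^sup>+t. ennreal (std_normal_density (?e n * t) * (cmod (fourier h t))\<^sup>2) \<partial>lborel)"
      unfolding f_def by (subst ennreal_mult) (auto simp: nn_integral_cmult)
    also have "\<dots> \<le> ennreal (sqrt (2 * pi)) * (ennreal (sqrt (2 * pi)) * ennreal E)"
      by (intro mult_left_mono order_trans[OF nn_integral_fourier_gaussian_le[OF h]] h2) auto
    also have "\<dots> = ennreal (2 * pi * E)"
      using E by (simp flip: ennreal_mult mult.assoc)
    finally show "(\<integral>\<^sup>+t. ennreal (f n t) \<partial>lborel) \<le> ennreal (2 * pi * E)" .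
  qed auto
next
  \<comment> \<open>For negative \<open>E\<close> the bound \<open>ennreal E\<close> is 0, so
    \<open>h\<close> vanishes almost everywhere.\<close>
  case False
  then have "(\<integral>\<^sup>+u. ennreal ((h u)\<^sup>2) \<partial>lborel) = 0"
    using h2 by (simp add: ennreal_neg)
  then have "AE u in lborel. h u = 0"
    using h by (subst (asm) nn_integral_0_iff_AE) auto
  then have "fourier h t = 0" for t
    unfolding fourier_def by (intro integral_eq_zero_AE) auto
  then show ?thesis by simp
qed

section \<open>The zeta function to the right of the imaginary axis\<close>

text \<open>The quotient is the integral of x powr (-s) over [a, b], for s on either side of 1, and
  the integrand is decreasing. The mean value theorem makes this precise.\<close>

lemma powr_Suc_diff_le:
  fixes s :: real
  assumes "0 < a" "a \<le> b" "0 < s" "s \<noteq> 1"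
  shows "(b powr (1 - s) - a powr (1 - s)) / (1 - s) \<le> (b - a) * a powr (-s)"
    and "(b - a) * b powr (-s) \<le> (b powr (1 - s) - a powr (1 - s)) / (1 - s)"
proof -
  have "(b - a) * b powr (-s) \<le> (b powr (1 - s) - a powr (1 - s)) / (1 - s) \<and>
        (b powr (1 - s) - a powr (1 - s)) / (1 - s) \<le> (b - a) * a powr (-s)"
  proof (cases "a = b")
    case False
    then have ab: "a < b" using assms by simp
    have "\<exists>z. z > a \<and> z < b \<and> b powr (1 - s) / (1 - s) - a powr (1 - s) / (1 - s) = (b - a) * z powr (-s)"
    proof (rule MVT2[OF ab])
      fix x assume "a \<le> x" "x \<le> b"
      then have "((\<lambda>x. x powr (1 - s)) has_real_derivative (1 - s) * x powr (1 - s - 1)) (at x)"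
        using assms by (intro has_real_derivative_powr) auto
      from DERIV_cdivide[OF this, of "1 - s"]
      show "((\<lambda>x. x powr (1 - s) / (1 - s)) has_real_derivative x powr (-s)) (at x)"
        using assms by simp
    qed
    then obtain z where z: "a < z" "z < b"
      "b powr (1 - s) / (1 - s) - a powr (1 - s) / (1 - s) = (b - a) * z powr (-s)" by blast
    have "b powr (-s) \<le> z powr (-s)" "z powr (-s) \<le> a powr (-s)"
      using z assms by (auto intro!: powr_mono2')
    then show ?thesis
      using z ab assms by (auto simp: diff_divide_distrib intro!: mult_left_mono)
  qed simp
  then show "(b powr (1 - s) - a powr (1 - s)) / (1 - s) \<le> (b - a) * a powr (-s)"
    "(b - a) * b powr (-s) \<le> (b powr (1 - s) - a powr (1 - s)) / (1 - s)" by auto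
qed

text \<open>\<open>zterm (n - 1) s\<close> is \<open>s\<close> times the integral of \<open>{x} * x powr (- s - 1)\<close> over \<open>[n, n + 1]\<close>.\<close>

definition zterm :: "nat \<Rightarrow> complex \<Rightarrow> complex" where
  "zterm n s = (of_nat (n + 2) powr (1 - s) - of_nat (n + 1) powr (1 - s)) / (1 - s)
                 - of_nat (n + 2) powr (-s)"

lemma frac_exp_piece:
  assumes "ln (real (n + 1)) \<le> u" "u < ln (real (n + 2))"
  shows "frac (exp u) = exp u - real (n + 1)"
proof -
  have "real (n + 1) \<le> exp u" "exp u < real (n + 2)"
    using assms exp_le_cancel_iff[of "ln (real (n + 1))" u] exp_less_cancel_iff[of u "ln (real (n + 2))"]
    by simp_all
  then have "\<lfloor>exp u\<rfloor> = int (n + 1)" by (intro floor_unique) auto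
  then show ?thesis by (simp add: frac_def)
qed

lemma zterm_has_integral:
  assumes s: "s \<noteq> 0" "s \<noteq> 1"
  shows "((\<lambda>u. (of_real (exp u) - of_nat (n + 1)) * exp (- (s * of_real u)))
           has_integral (zterm n s / s)) {ln (real (n + 1))..ln (real (n + 2))}"
proof -
  let ?F = "\<lambda>z::complex. exp ((1 - s) * z) / (1 - s) + of_nat (n + 1) * exp (- (s * z)) / s"
  have pw: "exp (c * of_real (ln (real m))) = of_nat m powr c" if "m > 0" for m :: nat and c :: complex
    using that by (simp add: powr_def Ln_of_nat)
  have "((\<lambda>u. (of_real (exp u) - of_nat (n + 1)) * exp (- (s * of_real u)))
          has_integral (?F (of_real (ln (real (n + 2)))) - ?F (of_real (ln (real (n + 1))))))
          {ln (real (n + 1))..ln (real (n + 2))}"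
  proof (rule fundamental_theorem_of_calculus)
    fix u
    have "(?F has_field_derivative ((1 - s) * exp ((1 - s) * of_real u) / (1 - s) +
             of_nat (n + 1) * (- s * exp (- (s * of_real u))) / s)) (at (of_real u))"
      by (auto intro!: derivative_eq_intros)
    also have "(1 - s) * exp ((1 - s) * of_real u) / (1 - s) + of_nat (n + 1) * (- s * exp (- (s * of_real u))) / s =
               (exp (of_real u) - of_nat (n + 1)) * exp (- (s * of_real u))"
    proof -
      have "exp ((1 - s) * of_real u) = exp (of_real u) * exp (- (s * of_real u))"
        by (simp add: algebra_simps flip: exp_add)
      moreover have "(1 - s) * E / (1 - s) = E" for E
        using s by simp
      ultimately show ?thesis
        using s by (simp only: left_diff_distrib) simp
    qed
    finally have "(?F has_field_derivative (exp (of_real u) - of_nat (n + 1)) * exp (- (s * of_real u))) (at (of_real u))" .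
    then have "((\<lambda>u. ?F (of_real u)) has_vector_derivative (exp (of_real u) - of_nat (n + 1)) * exp (- (s * of_real u))) (at u)"
      by (rule has_vector_derivative_real_field)
    then show "((\<lambda>u. ?F (of_real u)) has_vector_derivative (of_real (exp u) - of_nat (n + 1)) * exp (- (s * of_real u)))
        (at u within {ln (real (n + 1))..ln (real (n + 2))})"
      by (simp add: exp_of_real has_vector_derivative_at_within)
  qed simp
  also have "?F (of_real (ln (real (n + 2)))) - ?F (of_real (ln (real (n + 1)))) = zterm n s / s"
  proof -
    have 1: "exp (- (s * of_real (ln (real m)))) = of_nat m powr (-s)" if "m > 0" for m
      using pw[OF that, of "-s"] by simp
    have 2: "of_nat m powr (1 - s) = of_nat m * of_nat m powr (-s)" if "m > 0" for m
      using that by (simp add: powr_diff powr_minus divide_inverse)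
    have alg: "(b * B / (1 - s) + a * B / s) - (a * A / (1 - s) + a * A / s) = ((b * B - a * A) / (1 - s) - B) / s"
      if "b = a + 1" for a b A B
    proof -
      have "(b * B / (1 - s) + a * B / s) - (a * A / (1 - s) + a * A / s) =
            ((b * B - a * A) * s + (a * B - a * A) * (1 - s)) / ((1 - s) * s)"
        using s by (simp add: add_divide_distrib diff_divide_distrib)
      also have "(b * B - a * A) * s + (a * B - a * A) * (1 - s) = (b * B - a * A) - B * (1 - s)"
        unfolding that by (simp add: algebra_simps)
      also have "\<dots> / ((1 - s) * s) = ((b * B - a * A) / (1 - s) - B) / s"
        using s by (simp add: diff_divide_distrib)
      finally show ?thesis .
    qed
    have pos: "n + 1 > 0" "n + 2 > 0" by simp_all
    have "(of_nat (n + 2) :: complex) = of_nat (n + 1) + 1" by simp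
    then show ?thesis
      unfolding zterm_def pw[OF pos(1)] pw[OF pos(2)] 1[OF pos(1)] 1[OF pos(2)] 2[OF pos(1)] 2[OF pos(2)]
      by (rule alg)
  qed
  finally show ?thesis .
qed


text \<open>On the interval, {x} is at most 1 and the exponential is largest at the left end. The
  length of the interval in u = ln x adds a factor 1 / (n + 1), which makes the series converge for
  all Re s > 0.\<close>

lemma norm_zterm_le:
  assumes "Re s > 0" "s \<noteq> 1"
  shows "norm (zterm n s) \<le> norm s * real (n + 1) powr (- Re s - 1)"
proof -
  have s0: "s \<noteq> 0" using assms by auto
  let ?a = "ln (real (n + 1))" and ?b = "ln (real (n + 2))"
  have ab: "?a \<le> ?b" by simp
  have "norm (zterm n s / s) \<le> real (n + 1) powr (- Re s) * measure lborel {?a..?b}"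
  proof (rule has_integral_bound_real[OF _ _ zterm_has_integral[OF s0 assms(2)], of _ "{}"])
    fix u assume u: "u \<in> {?a..?b} - {}"
    then have "real (n + 1) \<le> exp u" "exp u \<le> real (n + 2)"
      using exp_le_cancel_iff[of ?a u] exp_le_cancel_iff[of u ?b] by simp_all
    then have "norm (complex_of_real (exp u - real (n + 1))) \<le> 1"
      by (simp only: norm_of_real)
    then have 1: "norm (of_real (exp u) - of_nat (n + 1) :: complex) \<le> 1"
      by simp
    have "norm (exp (- (s * of_real u))) = exp (- (Re s * u))"
      by (simp add: norm_exp_eq_Re)
    also have "\<dots> \<le> exp (- (Re s * ?a))"
      using u assms by (auto intro!: mult_left_mono)
    also have "\<dots> = real (n + 1) powr (- Re s)"
      by (simp add: powr_def)
    finally show "norm ((of_real (exp u) - of_nat (n + 1)) * exp (- (s * of_real u))) \<le> real (n + 1) powr (- Re s)"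
      using mult_mono[OF 1, of "norm (exp (- (s * of_real u)))"] by (simp add: norm_mult)
  qed auto
  also have "\<dots> \<le> real (n + 1) powr (- Re s) * (1 / real (n + 1))"
  proof (rule mult_left_mono)
    have "measure lborel {?a..?b} = ln (real (n + 2) / real (n + 1))"
      using ab by (simp add: ln_div)
    also have "real (n + 2) / real (n + 1) = 1 + 1 / real (n + 1)"
      by (simp add: divide_simps)
    also have "ln (1 + 1 / real (n + 1)) \<le> 1 / real (n + 1)"
      by (rule ln_add_one_self_le_self) auto
    finally show "measure lborel {?a..?b} \<le> 1 / real (n + 1)" .
  qed simp
  also have "real (n + 1) powr (- Re s) * (1 / real (n + 1)) = real (n + 1) powr (- Re s - 1)"
    by (simp add: powr_diff)
  finally have "norm (zterm n s) / norm s \<le> real (n + 1) powr (- Re s - 1)"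
    by (simp only: norm_divide)
  then show ?thesis
    using s0 by (simp add: pos_divide_le_eq mult.commute)
qed

lemma zterm_holomorphic: "zterm n holomorphic_on - {1}"
  unfolding zterm_def[abs_def] by (intro holomorphic_intros) auto

lemma summable_zterm_bound:
  assumes "x > 0"
  shows "summable (\<lambda>n. C * real (n + 1) powr (- x - 1))"
proof -
  have "summable (\<lambda>n. real n powr (- x - 1))"
    using assms by (simp add: summable_real_powr_iff)
  then show ?thesis
    by (intro summable_mult summable_ignore_initial_segment[of _ 1])
qed

lemma suminf_zterm_holomorphic:
  "(\<lambda>s. \<Sum>n. zterm n s) holomorphic_on ({s. Re s > 0} - {1})" (is "_ holomorphic_on ?S")
proof (rule holomorphic_uniform_sequence[where f = "\<lambda>n s. \<Sum>i<n. zterm i s"])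
  show S: "open ?S"
    by (intro open_delete open_halfspace_Re_gt)
  show "(\<lambda>s. \<Sum>i<n. zterm i s) holomorphic_on ?S" for n
    by (intro holomorphic_intros holomorphic_on_subset[OF zterm_holomorphic]) auto
  fix x assume x: "x \<in> ?S"
  then obtain d where d: "d > 0" "cball x d \<subseteq> ?S"
    using S open_contains_cball by blast
  define e where "e = min d (Re x / 2)"
  have e: "e > 0" "cball x e \<subseteq> ?S"
    using d x by (auto simp: e_def)
  have "uniform_limit (cball x e) (\<lambda>n s. \<Sum>i<n. zterm i s) (\<lambda>s. \<Sum>n. zterm n s) sequentially"
  proof (rule Weierstrass_m_test)
    fix n y assume y: "y \<in> cball x e"
    then have "\<bar>Re (x - y)\<bar> \<le> e" "norm (y - x) \<le> e"
      using abs_Re_le_cmod[of "x - y"] by (simp_all add: dist_norm norm_minus_commute)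
    moreover have "e \<le> Re x / 2"
      by (simp add: e_def)
    ultimately have "Re y \<ge> Re x / 2" "norm y \<le> norm x + e"
      using norm_triangle_ineq[of x "y - x"] by (auto simp: abs_le_iff)
    moreover have "norm (zterm n y) \<le> norm y * real (n + 1) powr (- Re y - 1)"
      using y e by (intro norm_zterm_le) auto
    ultimately show "norm (zterm n y) \<le> (norm x + e) * real (n + 1) powr (- (Re x / 2) - 1)"
      using e by (elim order_trans) (intro mult_mono powr_mono, auto)
  qed (use x in \<open>intro summable_zterm_bound, simp\<close>)
  then show "\<exists>d>0. cball x d \<subseteq> ?S \<and>
      uniform_limit (cball x d) (\<lambda>n s. \<Sum>i<n. zterm i s) (\<lambda>s. \<Sum>n. zterm n s) sequentially"
    using e by blast
qed

text \<open>For Re s > 1 the quotients telescope to 1 / (s - 1) and the subtracted powers sum to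
  \<zeta>(s) - 1. Both sides are holomorphic on the punctured right half-plane, so the identity
  theorem extends the formula.\<close>

lemma zeta_eq_suminf_zterm:
  assumes "Re s > 0" "s \<noteq> 1"
  shows "zeta s = s / (s - 1) - (\<Sum>n. zterm n s)"
proof (rule analytic_continuation_open[where s = "{s. Re s > 1}" and s' = "{s. Re s > 0} - {1}"
      and f = zeta and g = "\<lambda>s. s / (s - 1) - (\<Sum>n. zterm n s)"])
  show "open {s. Re s > 1}"
    by (rule open_halfspace_Re_gt)
  show "open ({s. Re s > 0} - {1 :: complex})"
    by (intro open_delete open_halfspace_Re_gt)
  show "{s. Re s > 1} \<noteq> {}"
    by (rule ex_in_conv[THEN iffD1], rule exI[of _ 2]) simp
  show "connected ({s. Re s > 0} - {1 :: complex})"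
    by (intro connected_open_delete open_halfspace_Re_gt convex_connected convex_halfspace_Re_gt) simp
  show "zeta holomorphic_on ({s. Re s > 0} - {1})"
    by (rule holomorphic_on_subset[of _ "- {1}"]) (use is_zeta_zeta in \<open>auto simp: is_zeta_def\<close>)
  show "(\<lambda>s. s / (s - 1) - (\<Sum>n. zterm n s)) holomorphic_on ({s. Re s > 0} - {1})"
    by (intro holomorphic_intros suminf_zterm_holomorphic) auto
  fix z :: complex assume "z \<in> {s. Re s > 1}"
  then have s: "Re z > 1" by simp
  then have s1: "z \<noteq> 1" by auto
  have "(\<lambda>n. real (n + 1) powr (1 - Re z)) \<longlonglongrightarrow> 0"
    by (rule tendsto_neg_powr) (use s in simp, real_asymp)
  also have "(\<lambda>n. real (n + 1) powr (1 - Re z)) = (\<lambda>n. norm (of_nat (n + 1) powr (1 - z)))"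
    by (subst norm_powr_real_powr) auto
  finally have "(\<lambda>n. of_nat (n + 1) powr (1 - z)) \<longlonglongrightarrow> 0"
    by (rule tendsto_norm_zero_cancel)
  from telescope_sums[OF this]
  have 1: "(\<lambda>n. (of_nat (n + 2) powr (1 - z) - of_nat (n + 1) powr (1 - z)) / (1 - z)) sums ((0 - 1) / (1 - z))"
    by (intro sums_divide) simp
  have "(\<lambda>n. 1 / of_nat (Suc n) powr z) sums zeta z"
    using is_zeta_zeta s zeta_series_summable[OF s] by (simp add: is_zeta_def sums_iff)
  then have "(\<lambda>n. 1 / of_nat (Suc (Suc n)) powr z) sums (zeta z - 1)"
    by (subst sums_Suc_iff) simp
  then have 2: "(\<lambda>n. of_nat (n + 2) powr (-z)) sums (zeta z - 1)"
    by (simp add: powr_minus_divide)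
  have "(\<lambda>n. zterm n z) sums ((0 - 1) / (1 - z) - (zeta z - 1))"
    unfolding zterm_def by (rule sums_diff[OF 1 2])
  then show "zeta z = z / (z - 1) - (\<Sum>n. zterm n z)"
    using s1 by (simp add: sums_iff field_simps)
qed (use assms in auto)

section \<open>The transform of the fractional part\<close>

text \<open>Mellin transforms are written as Fourier transforms in the variable \<open>u = ln x\<close>.\<close>

definition sawtooth :: "real \<Rightarrow> real \<Rightarrow> real" where
  "sawtooth \<sigma> u = frac (exp u) * exp (- (\<sigma> * u))"

lemma borel_measurable_frac_real [measurable]: "(frac :: real \<Rightarrow> real) \<in> borel_measurable borel"
  unfolding frac_def by measurable

lemma borel_measurable_sawtooth [measurable]: "sawtooth \<sigma> \<in> borel_measurable borel"
  unfolding sawtooth_def[abs_def] by measurable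

lemma nn_integral_exp_tail:
  fixes a b :: real
  assumes "a > 0"
  shows "(\<integral>\<^sup>+u. ennreal (exp (- (a * u))) * indicator {b..} u \<partial>lborel) = ennreal (exp (- (a * b)) / a)"
proof -
  have "(\<integral>\<^sup>+u. ennreal (exp (- (a * u))) * indicator {b..} u \<partial>lborel) = ennreal (0 - (- exp (- (a * b)) / a))"
  proof (rule nn_integral_FTC_atLeast)
    show "((\<lambda>u. - exp (- (a * u)) / a) has_real_derivative exp (- (a * x))) (at x)" for x
      using assms by (auto intro!: derivative_eq_intros)
    show "((\<lambda>u. - exp (- (a * u)) / a) \<longlongrightarrow> 0) at_top"
      using assms by real_asymp
  qed auto
  then show ?thesis by simp
qed

lemma set_integrable_exp_tail:
  fixes a b :: real
  assumes "a > 0"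
  shows "set_integrable lborel {b..} (\<lambda>u. exp (- (a * u)))"
  unfolding set_integrable_def
proof (rule Bochner_Integration.integrableI_nonneg)
  have "(\<integral>\<^sup>+u. ennreal (indicat_real {b..} u *\<^sub>R exp (- (a * u))) \<partial>lborel) =
        (\<integral>\<^sup>+u. ennreal (exp (- (a * u))) * indicator {b..} u \<partial>lborel)"
    by (intro nn_integral_cong) (auto split: split_indicator)
  then show "(\<integral>\<^sup>+u. ennreal (indicat_real {b..} u *\<^sub>R exp (- (a * u))) \<partial>lborel) < \<infinity>"
    using nn_integral_exp_tail[OF assms, of b] by simp
qed auto

lemma set_integrable_exp_head:
  fixes a b :: real
  assumes "a > 0"
  shows "set_integrable lborel {..b} (\<lambda>u. exp (a * u))"
proof -
  have "integrable lborel (\<lambda>u. indicat_real {-b..} (0 + (-1) * u) *\<^sub>R exp (- (a * (0 + (-1) * u))))"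
    using set_integrable_exp_tail[OF assms, of "-b"] unfolding set_integrable_def
    by (rule lborel_integrable_real_affine) simp
  moreover have "indicat_real {-b..} (0 + (-1) * u) = indicat_real {..b} u" for u
    by (auto split: split_indicator)
  ultimately show ?thesis
    unfolding set_integrable_def by simp
qed

text \<open>For u < 0 the function is exp ((1 - \<sigma>) * u), for u \<ge> 0 it is at most exp (-
  (\<sigma> * u)); the two ends use \<sigma> < 1 and \<sigma> > 0 respectively.\<close>

lemma integrable_sawtooth:
  assumes "0 < \<sigma>" "\<sigma> < 1"
  shows "integrable lborel (sawtooth \<sigma>)"
proof (rule Bochner_Integration.integrable_bound)
  show "integrable lborel (\<lambda>u. indicat_real {..0} u *\<^sub>R exp ((1 - \<sigma>) * u) + indicat_real {0..} u *\<^sub>R exp (- (\<sigma> * u)))"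
    using set_integrable_exp_tail[of \<sigma> 0] set_integrable_exp_head[of "1 - \<sigma>" 0] assms
    unfolding set_integrable_def by (intro Bochner_Integration.integrable_add) auto
  show "AE u in lborel. norm (sawtooth \<sigma> u) \<le>
    norm (indicat_real {..0} u *\<^sub>R exp ((1 - \<sigma>) * u) + indicat_real {0..} u *\<^sub>R exp (- (\<sigma> * u)))"
  proof (intro AE_I2)
    fix u :: real
    have "sawtooth \<sigma> u \<ge> 0"
      by (simp add: sawtooth_def)
    moreover have "sawtooth \<sigma> u \<le> indicat_real {..0} u *\<^sub>R exp ((1 - \<sigma>) * u) + indicat_real {0..} u *\<^sub>R exp (- (\<sigma> * u))"
    proof (cases "u \<ge> 0")
      case True
      have "sawtooth \<sigma> u \<le> 1 * exp (- (\<sigma> * u))"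
        unfolding sawtooth_def by (intro mult_right_mono) (auto intro: less_imp_le frac_lt_1)
      then show ?thesis using True by (auto split: split_indicator)
    next
      case False
      then have "frac (exp u) = exp u" by (simp add: frac_eq)
      then have "sawtooth \<sigma> u = exp ((1 - \<sigma>) * u)"
        by (simp add: sawtooth_def left_diff_distrib flip: exp_add)
      then show ?thesis using False by simp
    qed
    ultimately show "norm (sawtooth \<sigma> u) \<le>
      norm (indicat_real {..0} u *\<^sub>R exp ((1 - \<sigma>) * u) + indicat_real {0..} u *\<^sub>R exp (- (\<sigma> * u)))"
      by simp
  qed
qed measurable

text \<open>The part u < 0, where {x} = x, gives 1 / (1 - s). The rest is the series for s / (s - 1)
  - \<zeta>(s), divided by s. The elementary terms cancel.\<close>

lemma fourier_sawtooth:
  assumes "0 < \<sigma>" "\<sigma> < 1"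
  shows "fourier (sawtooth \<sigma>) t = - (zeta (Complex \<sigma> t) / Complex \<sigma> t)"
proof -
  define s where "s = Complex \<sigma> t"
  have s: "Re s > 0" "s \<noteq> 0" "s \<noteq> 1" "Re (1 - s) > 0"
    using assms by (auto simp: s_def complex_eq_iff)
  define g where "g u = of_real (frac (exp u)) * exp (- (s * of_real u))" for u
  have g: "of_real (sawtooth \<sigma> u) * cis (-(t * u)) = g u" for u
  proof -
    have "of_real (exp (- (\<sigma> * u))) * cis (-(t * u)) = exp (- (s * of_real u))"
      by (simp add: s_def exp_eq_polar)
    then show ?thesis
      by (simp add: sawtooth_def g_def mult.assoc)
  qed
  have int_g: "integrable lborel g"
  proof (rule Bochner_Integration.integrable_bound[OF integrable_sawtooth[OF assms]])
    show "g \<in> borel_measurable lborel"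
      unfolding g_def[abs_def] by measurable
    show "AE u in lborel. norm (g u) \<le> norm (sawtooth \<sigma> u)"
      by (intro AE_I2) (simp add: norm_mult flip: g)
  qed
  then have int_gS: "set_integrable lborel S g" if "S \<in> sets borel" for S
    using that unfolding set_integrable_def by (intro integrable_mult_indicator) auto
  have "fourier (sawtooth \<sigma>) t = (LINT u:{..<0} \<union> {0..}|lborel. g u)"
    unfolding fourier_def g set_lebesgue_integral_def
    by (intro Bochner_Integration.integral_cong) (auto split: split_indicator)
  also have "\<dots> = (LINT u:{..<0}|lborel. g u) + (LINT u:{0..}|lborel. g u)"
    by (intro set_integral_Un int_gS) auto
  also have "(LINT u:{..<0}|lborel. g u) = 1 / (1 - s)"
  proof -
    let ?f = "\<lambda>u::real. exp ((1 - s) * of_real u)"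
    have eq: "g u = ?f u" if "u < 0" for u
    proof -
      have "frac (exp u) = exp u" using that by (simp add: frac_eq)
      then show ?thesis
        by (simp add: g_def algebra_simps exp_of_real flip: exp_add)
           (simp add: exp_diff exp_minus exp_of_real divide_inverse)
    qed
    have ei: "einterval (-\<infinity>) 0 = {..<0::real}"
      by (auto simp: einterval_def)
    have "(LINT u:{..<0}|lborel. g u) = (LINT u:{..<0}|lborel. ?f u)"
      by (intro set_lebesgue_integral_cong) (auto simp: eq)
    also have "\<dots> = (LBINT u=-\<infinity>..0. ?f u)"
      by (simp add: interval_lebesgue_integral_def ei)
    also have "\<dots> = 1 / (1 - s) - 0"
    proof (rule interval_integral_FTC_integrable)
      fix x :: real
      have "((\<lambda>z. exp ((1 - s) * z) / (1 - s)) has_field_derivative ?f x) (at (of_real x))"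
        using s by (auto intro!: derivative_eq_intros)
      then show "((\<lambda>u. exp ((1 - s) * of_real u) / (1 - s)) has_vector_derivative ?f x) (at x)"
        by (rule has_vector_derivative_real_field)
      show "isCont ?f x"
        by (intro continuous_intros)
    next
      have "set_integrable lborel {..<0} ?f \<longleftrightarrow> set_integrable lborel {..<0} g"
        by (intro set_integrable_cong) (auto simp: eq)
      then show "set_integrable lborel (einterval (-\<infinity>) 0) ?f"
        unfolding ei using int_gS by simp
    next
      have "((\<lambda>u::real. exp ((1 - Re s) * u)) \<longlongrightarrow> 0) at_bot"
        using s(4) by simp real_asymp
      then have "((\<lambda>u. norm (exp ((1 - s) * of_real u))) \<longlongrightarrow> 0) at_bot"
        by (simp add: norm_exp_eq_Re)
      then have "((\<lambda>u. exp ((1 - s) * of_real u)) \<longlongrightarrow> 0) at_bot"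
        by (rule tendsto_norm_zero_cancel)
      then have "((\<lambda>u. exp ((1 - s) * of_real u) / (1 - s)) \<longlongrightarrow> 0 / (1 - s)) at_bot"
        by (intro tendsto_intros) (use s in auto)
      then show "(((\<lambda>u. exp ((1 - s) * of_real u) / (1 - s)) \<circ> real_of_ereal) \<longlongrightarrow> 0) (at_right (-\<infinity>))"
        by (simp add: at_right_MInf filterlim_filtermap o_def)
    next
      have "((\<lambda>u::real. exp ((1 - s) * of_real u) / (1 - s)) \<longlongrightarrow> exp ((1 - s) * of_real 0) / (1 - s)) (at_left 0)"
        by (intro tendsto_intros) (use s in auto)
      then show "(((\<lambda>u. exp ((1 - s) * of_real u) / (1 - s)) \<circ> real_of_ereal) \<longlongrightarrow> 1 / (1 - s)) (at_left 0)"
        by (simp add: zero_ereal_def ereal_tendsto_simps)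
    qed auto
    finally show ?thesis by simp
  qed
  also have "(LINT u:{0..}|lborel. g u) = (\<Sum>n. zterm n s) / s"
  proof -
    \<comment> \<open>Half-open intervals make the decomposition disjoint and have {exp u} = exp u -
      (n + 1) throughout. The closed intervals of \<open>zterm_has_integral\<close> differ from them
      by a null set.\<close>
    define A where "A n = {ln (real (n + 1))..<ln (real (n + 2))}" for n
    have U: "(\<Union>n. A n) = {0..}"
    proof (intro equalityI subsetI)
      fix u :: real assume u: "u \<in> {0..}"
      define n where "n = nat \<lfloor>exp u\<rfloor> - 1"
      have "exp u \<ge> 1" using u by simp
      then have "\<lfloor>exp u\<rfloor> \<ge> 1" by simp
      then have "real (n + 1) = of_int \<lfloor>exp u\<rfloor>"
        unfolding n_def by (simp add: of_nat_diff)
      then have "real (n + 1) \<le> exp u" "exp u < real (n + 2)"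
        by linarith+
      then have "ln (real (n + 1)) \<le> ln (exp u)" "ln (exp u) < ln (real (n + 2))"
        by (simp_all del: ln_exp)
      then have "u \<in> A n"
        by (simp add: A_def)
      then show "u \<in> (\<Union>n. A n)" by blast
    next
      fix u assume "u \<in> (\<Union>n. A n)"
      then obtain n where "ln (real (n + 1)) \<le> u" by (auto simp: A_def)
      moreover have "ln (real (n + 1)) \<ge> 0" by simp
      ultimately show "u \<in> {0..}" unfolding atLeast_iff by linarith
    qed
    have disj: "A i \<inter> A j = {}" if "i < j" for i j
    proof -
      have "ln (real (i + 2)) \<le> ln (real (j + 1))"
        using that by (subst ln_le_cancel_iff) auto
      then show ?thesis by (auto simp: A_def)
    qed
    then have disj: "A i \<inter> A j = {}" if "i \<noteq> j" for i j
      using that by (metis Int_commute linorder_less_linear)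
    have piece: "(LINT u:A n|lborel. g u) = zterm n s / s" for n
    proof -
      have "(LINT u:A n|lborel. g u) = integral (A n) g"
        by (rule set_borel_integral_eq_integral) (auto intro!: int_gS simp: A_def)
      also have "\<dots> = zterm n s / s"
      proof (rule integral_unique)
        let ?f = "\<lambda>u. (of_real (exp u) - of_nat (n + 1)) * exp (- (s * of_real u))"
        have "(?f has_integral (zterm n s / s)) (A n)"
        proof (rule iffD1[OF has_integral_spike_set_eq zterm_has_integral[OF s(2,3)]])
          show "negligible {x \<in> {ln (real (n + 1))..ln (real (n + 2))} - A n. ?f x \<noteq> 0}"
            by (rule negligible_subset[of "{ln (real (n + 2))}"]) (auto simp: A_def)
          show "negligible {x \<in> A n - {ln (real (n + 1))..ln (real (n + 2))}. ?f x \<noteq> 0}"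
            by (rule negligible_subset[of "{}"]) (auto simp: A_def)
        qed
        moreover have "?f u = g u" if "u \<in> A n" for u
          using frac_exp_piece[of n u] that by (simp add: A_def g_def)
        ultimately show "(g has_integral (zterm n s / s)) (A n)"
          by (rule has_integral_eq[rotated])
      qed
      finally show ?thesis .
    qed
    have "(LINT u:(\<Union>n. A n)|lborel. g u) = (\<Sum>n. (LINT u:A n|lborel. g u))"
      by (rule lebesgue_integral_countable_add) (auto simp: disj U intro!: int_gS, auto simp: A_def)
    also have "\<dots> = (\<Sum>n. zterm n s / s)"
      by (simp only: piece)
    also have "\<dots> = (\<Sum>n. zterm n s) / s"
    proof (rule suminf_divide)
      show "summable (\<lambda>n. zterm n s)"
        by (rule summable_comparison_test'[OF summable_zterm_bound[OF s(1)] norm_zterm_le[OF s(1,3)]])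
    qed
    finally show ?thesis by (simp only: U)
  qed
  also have "1 / (1 - s) + (\<Sum>n. zterm n s) / s = - (zeta s / s)"
    unfolding zeta_eq_suminf_zterm[OF s(1,3)] using s by (simp add: field_simps)
  finally show ?thesis by (simp add: s_def)
qed

section \<open>Partial sums of the zeta series on the real axis\<close>

definition real_zterm :: "nat \<Rightarrow> real \<Rightarrow> real" where
  "real_zterm n s = (real (n + 2) powr (1 - s) - real (n + 1) powr (1 - s)) / (1 - s) - real (n + 2) powr (-s)"

text \<open>The term is the integral of x powr (-s) over [n + 1, n + 2] minus the value at the right
  end. The upper bound telescopes, so a remainder of the series is bounded by a single
  power.\<close>

lemma real_zterm_bounds:
  assumes "s > 0" "s \<noteq> 1"
  shows "0 \<le> real_zterm n s" "real_zterm n s \<le> real (n + 1) powr (-s) - real (n + 2) powr (-s)"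
  using powr_Suc_diff_le[of "real (n + 1)" "real (n + 2)" s] assms
  unfolding real_zterm_def by simp_all

lemma zterm_of_real: "zterm n (of_real s) = of_real (real_zterm n s)"
proof -
  have "(of_nat m :: complex) powr of_real x = of_real (real m powr x)" for m x
    using powr_of_real[of "real m" x] by simp
  from this[of "n + 2" "1 - s"] this[of "n + 1" "1 - s"] this[of "n + 2" "- s"]
  show ?thesis by (simp add: zterm_def real_zterm_def)
qed

lemma real_zeta_sums:
  assumes "s > 0" "s \<noteq> 1"
  shows "(\<lambda>n. real_zterm n s) sums (s / (s - 1) - real_zeta s)"
proof -
  have s: "Re (complex_of_real s) > 0" "complex_of_real s \<noteq> 1"
    using assms by auto
  have "summable (\<lambda>n. zterm n (of_real s))"
    by (rule summable_comparison_test'[OF summable_zterm_bound[OF s(1)] norm_zterm_le[OF s]])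
  then have "(\<lambda>n. zterm n (of_real s)) sums (of_real s / (of_real s - 1) - zeta (of_real s))"
    unfolding zeta_eq_suminf_zterm[OF s] by (simp add: summable_sums)
  also have "of_real s / (of_real s - 1) - zeta (of_real s) = of_real (s / (s - 1) - real_zeta s)"
    by (simp flip: of_real_real_zeta)
  finally show ?thesis
    unfolding zterm_of_real by (simp only: sums_of_real_iff)
qed

text \<open>Exactly, the sum is \<zeta>(s) + N powr (1 - s) / (1 - s) + R, where R is the tail of
  the series of \<open>real_zterm\<close>. Non-negative terms and telescoping give 0 \<le> R \<le> N
  powr (-s), on both sides of s = 1.\<close>

lemma sum_powr_le_zeta:
  fixes s :: real
  assumes s: "s > 0" "s \<noteq> 1" and N: "N \<ge> 1"
  shows "(\<Sum>k=1..N. real k powr (-s)) \<le> real_zeta s + real N powr (1 - s) / (1 - s) + real N powr (-s)"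
    and "real_zeta s \<le> (\<Sum>k=1..N. real k powr (-s)) - real N powr (1 - s) / (1 - s)"
proof -
  define R where "R = (\<Sum>n. real_zterm (n + (N - 1)) s)"
  have sums: "(\<lambda>n. real_zterm (n + (N - 1)) s) sums (s / (s - 1) - real_zeta s - (\<Sum>n<N-1. real_zterm n s))"
    using real_zeta_sums[OF s] by (subst sums_iff_shift) simp
  have "(\<Sum>n<N-1. real_zterm n s) = s / (s - 1) - ((\<Sum>k=1..N. real k powr (-s)) - real N powr (1 - s) / (1 - s))"
    using N
  proof (induction N rule: nat_induct_at_least)
    case base
    then show ?case using s by (simp add: field_simps)
  next
    case (Suc n)
    then obtain m where m: "n = Suc m" by (cases n) auto
    show ?case using Suc.IH by (simp add: m real_zterm_def diff_divide_distrib algebra_simps)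
  qed
  with sums have R: "R = (\<Sum>k=1..N. real k powr (-s)) - real N powr (1 - s) / (1 - s) - real_zeta s"
    unfolding R_def by (simp add: sums_iff)
  have sm: "summable (\<lambda>n. real_zterm (n + (N - 1)) s)"
    using sums by (rule sums_summable)
  have "(\<lambda>n. real (n + N) powr (-s)) \<longlonglongrightarrow> 0"
    by (rule tendsto_neg_powr) (use s in simp, real_asymp)
  from telescope_sums'[OF this]
  have tele: "(\<lambda>n. real (n + N) powr (-s) - real (Suc n + N) powr (-s)) sums (real N powr (-s))"
    by simp
  have "R \<le> real N powr (-s)"
    unfolding R_def
  proof (rule sums_le[OF _ summable_sums[OF sm] tele])
    fix n
    have "n + (N - 1) + 1 = n + N" "n + (N - 1) + 2 = Suc n + N" using N by auto
    then show "real_zterm (n + (N - 1)) s \<le> real (n + N) powr (-s) - real (Suc n + N) powr (-s)"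
      using real_zterm_bounds(2)[OF s, of "n + (N - 1)"] by simp
  qed
  moreover have "R \<ge> 0"
    unfolding R_def by (intro suminf_nonneg sm real_zterm_bounds s)
  ultimately show "(\<Sum>k=1..N. real k powr (-s)) \<le> real_zeta s + real N powr (1 - s) / (1 - s) + real N powr (-s)"
    "real_zeta s \<le> (\<Sum>k=1..N. real k powr (-s)) - real N powr (1 - s) / (1 - s)"
    unfolding R by simp_all
qed

lemma real_zeta_pos:
  assumes "s > 1"
  shows "real_zeta s > 0"
proof -
  have "0 < 1 / (s - 1)" using assms by simp
  also have "\<dots> \<le> real_zeta s"
    using sum_powr_le_zeta(1)[of s 1] assms by (simp add: field_simps)
  finally show ?thesis .
qed

lemma real_zeta_neg:
  assumes "0 < s" "s < 1"
  shows "real_zeta s < 0"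
proof -
  have "real_zeta s \<le> 1 - 1 / (1 - s)"
    using sum_powr_le_zeta(2)[of s 1] assms by simp
  also have "\<dots> < 0"
    using assms by (simp add: field_simps)
  finally show ?thesis .
qed

text \<open>Passing from the integer \<open>N\<close> to the real cut-off \<open>X\<close> costs one
  more X powr (-s), since they differ by at most 1.\<close>

lemma sum_powr_le_zeta_real:
  fixes s X :: real
  assumes s: "s > 0" "s \<noteq> 1" and N: "N \<ge> 1" and X: "0 < X" "X \<le> real N" "real N \<le> X + 1"
  shows "(\<Sum>k=1..N. real k powr (-s)) \<le> real_zeta s + X powr (1 - s) / (1 - s) + 2 * X powr (-s)"
proof -
  have "(real N powr (1 - s) - X powr (1 - s)) / (1 - s) \<le> (real N - X) * X powr (-s)"
    using powr_Suc_diff_le(1)[of X "real N" s] s X by simp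
  also have "\<dots> \<le> 1 * X powr (-s)"
    using X by (intro mult_right_mono) auto
  finally have "real N powr (1 - s) / (1 - s) \<le> X powr (1 - s) / (1 - s) + X powr (-s)"
    by (simp add: diff_divide_distrib)
  moreover have "real N powr (-s) \<le> X powr (-s)"
    using s X by (intro powr_mono2') auto
  ultimately show ?thesis
    using sum_powr_le_zeta(1)[OF s N] by simp
qed

lemma sum_inverse_le_ln:
  fixes N :: nat
  assumes "N \<ge> 1"
  shows "(\<Sum>k=1..N. real k powr (-1)) \<le> 1 + ln (real N)"
  using assms
proof (induction N rule: nat_induct_at_least)
  case (Suc n)
  have "1 / real (Suc n) \<le> ln (real (Suc n) / real n)"
  proof -
    have "ln (real n / real (Suc n)) \<le> real n / real (Suc n) - 1"
      using Suc by (intro ln_le_minus_one) auto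
    then show ?thesis using Suc by (simp add: ln_div field_simps)
  qed
  also have "\<dots> = ln (real (Suc n)) - ln (real n)"
    using Suc by (simp add: ln_div)
  finally have "real (Suc n) powr (-1) \<le> ln (real (Suc n)) - ln (real n)"
    by (simp add: powr_minus_divide)
  then show ?case
    using Suc.IH by simp
qed simp

section \<open>The multiplier of the tent-shaped average\<close>

text \<open>The value is chosen so that 2 * pi - 5 < 1.2974, which just suffices for the multiplier
  bound at x = 5. If pi were at least 3.1487, the Taylor polynomial with its remainder would force
  sin (pi / 6) > 1/2.\<close>

lemma pi_upper_bound: "pi < 3.1487"
proof (rule ccontr)
  assume "\<not> pi < 3.1487"
  define y where "y = pi / 6"
  have y: "0.52478 \<le> y" "y \<le> 0.67"
    using \<open>\<not> pi < 3.1487\<close> pi_less_4 by (simp_all add: y_def)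
  have "\<bar>sin y - (\<Sum>m<5. sin_coeff m * y ^ m)\<bar> \<le> inverse (fact 5) * \<bar>y\<bar> ^ 5"
    by (rule Maclaurin_sin_bound)
  moreover have "sin y = 1 / 2"
    by (simp add: y_def sin_30)
  moreover have "(\<Sum>m<5. sin_coeff m * y ^ m) = y - y ^ 3 / 6"
  proof -
    have "(\<Sum>m<5. sin_coeff m * y ^ m) = sin_coeff 0 * y ^ 0 + sin_coeff 1 * y ^ 1 + sin_coeff 2 * y ^ 2
        + sin_coeff 3 * y ^ 3 + sin_coeff 4 * y ^ 4"
      by (simp add: eval_nat_numeral)
    then show ?thesis
      by (simp add: sin_coeff_def fact_numeral)
  qed
  moreover have "inverse (fact 5) * \<bar>y\<bar> ^ 5 = y ^ 5 / 120"
    using y by (simp add: fact_numeral)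
  ultimately have *: "y - y ^ 3 / 6 - y ^ 5 / 120 \<le> 1 / 2"
    by (simp only: abs_le_iff) linarith
  let ?g = "\<lambda>y::real. y - y ^ 3 / 6 - y ^ 5 / 120"
  \<comment> \<open>The minorant of sin increases up to y, so its value at 0.52478, slightly less
    than 3.1487 / 6, decides.\<close>
  have "?g 0.52478 \<le> ?g y"
  proof (rule DERIV_nonneg_imp_nondecreasing[OF y(1)])
    fix x :: real assume x: "0.52478 \<le> x" "x \<le> y"
    then have "x ^ 2 \<le> 1 ^ 2" "x ^ 4 \<le> 1 ^ 4"
      using y by (intro power_mono; simp)+
    then have "1 - x ^ 2 / 2 - x ^ 4 / 24 \<ge> 0" by simp
    moreover have "(?g has_real_derivative 1 - x ^ 2 / 2 - x ^ 4 / 24) (at x)"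
      by (auto intro!: derivative_eq_intros simp: field_simps)
    ultimately show "\<exists>y. (?g has_real_derivative y) (at x) \<and> 0 \<le> y"
      by blast
  qed
  moreover have "?g 0.52478 > 1 / 2"
    by (simp add: eval_nat_numeral)
  ultimately show False using * by linarith
qed

text \<open>A second-order bound at the zero 2 * pi, from 2 - 2 cos x = 4 sin^2 (x / 2 - pi) and
  |sin y| \<le> |y|.\<close>

lemma two_minus_two_cos_le: "2 - 2 * cos x \<le> (x - 2 * pi)\<^sup>2" for x :: real
proof -
  let ?y = "(x - 2 * pi) / 2"
  have "cos x = cos (2 * ?y + 2 * pi)"
    by (rule arg_cong[of _ _ cos]) (simp add: field_simps)
  also have "\<dots> = cos (2 * ?y)"
    by (rule cos_periodic)
  also have "\<dots> = 1 - 2 * (sin ?y)\<^sup>2"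
    by (rule cos_double_sin)
  finally have "2 - 2 * cos x = 4 * (sin ?y)\<^sup>2" by simp
  also have "(sin ?y)\<^sup>2 \<le> ?y\<^sup>2"
    using abs_sin_x_le_abs_x[of ?y] by (simp only: abs_le_square_iff)
  finally show ?thesis by (simp add: power_divide)
qed

text \<open>Beyond 7.5 the crude bound 2 - 2 cos x \<le> 4 suffices. From 5 to 7.5 it is replaced by
  the bound around the zero 2 * pi. The constant 0.0785 is dictated by x = 5, where the estimate
  below has almost no slack.\<close>

lemma multiplier_numeric_bound:
  fixes x :: real
  assumes "x \<ge> 5"
  shows "2 - 2 * cos x + 0.0258 * x + 0.1501 \<le> 0.0785 * x\<^sup>2"
proof (cases "x \<le> 7.5")
  case True
  define c where "c = 2 * pi"
  have c: "6 < c" "c < 6.2974"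
    using pi_gt3 pi_upper_bound by (simp_all add: c_def)
  \<comment> \<open>The convex parabola (x - c)^2 lies below its chord over [5, 7.5]. Together with
    the tangent of x^2 at 5 this leaves a linear inequality.\<close>
  have "(x - 5) * (x - 7.5) \<le> 0"
    using assms True by (intro mult_nonneg_nonpos) auto
  then have "(x - c)\<^sup>2 \<le> (c - 5)\<^sup>2 + (x - 5) * (12.5 - 2 * c)"
    by (simp add: power2_eq_square field_simps)
  also have "(c - 5)\<^sup>2 \<le> 1.2974\<^sup>2"
    using c by (intro power_mono) auto
  also have "(x - 5) * (12.5 - 2 * c) \<le> (x - 5) * 0.5"
    using c assms by (intro mult_left_mono) auto
  finally have "2 - 2 * cos x \<le> 1.2974\<^sup>2 + (x - 5) * 0.5"
    using two_minus_two_cos_le[of x] unfolding c_def by linarith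
  moreover have "x\<^sup>2 \<ge> 10 * x - 25"
    using zero_le_power2[of "x - 5"] by (simp add: power2_eq_square algebra_simps)
  moreover have "2 - 2 * C + 0.0258 * x + 0.1501 \<le> 0.0785 * q"
    if "2 - 2 * C \<le> 1.2974\<^sup>2 + (x - 5) * 0.5" "10 * x - 25 \<le> q" for C q :: real
  proof -
    show ?thesis
      using that assms by (simp add: power2_eq_square diff_divide_distrib)
  qed
  ultimately show ?thesis by blast
next
  case False
  then have "7.5 * x \<le> x\<^sup>2" by (simp add: power2_eq_square)
  with False have "4 + 0.0258 * x + 0.1501 \<le> 0.0785 * x\<^sup>2" by simp
  moreover have "2 - 2 * cos x \<le> 4" using cos_ge_minus_one[of x] by linarith
  ultimately show ?thesis by linarith
qed

lemma ln_one_plus_ge: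
  fixes x :: real
  assumes "0 \<le> x"
  shows "x - x\<^sup>2 / 2 \<le> ln (1 + x)"
proof -
  let ?g = "\<lambda>x. ln (1 + x) - x + x\<^sup>2 / 2"
  have "?g 0 \<le> ?g x"
  proof (rule DERIV_nonneg_imp_nondecreasing[OF assms])
    fix y :: real assume y: "0 \<le> y" "y \<le> x"
    have "(?g has_real_derivative 1 / (1 + y) - 1 + y) (at y)"
      using y by (auto intro!: derivative_eq_intros)
    moreover have "1 / (1 + y) - 1 + y = y\<^sup>2 / (1 + y)"
      using y by (simp add: field_simps power2_eq_square)
    moreover have "y\<^sup>2 / (1 + y) \<ge> 0" using y by simp
    ultimately show "\<exists>d. (?g has_real_derivative d) (at y) \<and> 0 \<le> d" by (intro exI conjI) (assumption, simp only:)
  qed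
  then show ?thesis by simp
qed

text \<open>The coefficient 0.53 in place of 1/2 pays for the cubic and higher terms: the derivative
  of the difference has the factor \<open>0.06 - 1.06 * y\<close>, which is still positive on
  [0, 1/40].\<close>

lemma ln_one_minus_ge:
  fixes x :: real
  assumes "0 \<le> x" "x \<le> 1/40"
  shows "- x - 0.53 * x\<^sup>2 \<le> ln (1 - x)"
proof -
  let ?g = "\<lambda>x::real. ln (1 - x) + x + 0.53 * x\<^sup>2"
  have "?g 0 \<le> ?g x"
  proof (rule DERIV_nonneg_imp_nondecreasing[OF assms(1)])
    fix y :: real assume y: "0 \<le> y" "y \<le> x"
    have "(?g has_real_derivative - 1 / (1 - y) + 1 + 1.06 * y) (at y)"
      using y assms by (auto intro!: derivative_eq_intros)
    moreover have "- 1 / (1 - y) + 1 + 1.06 * y = y * (0.06 - 1.06 * y) / (1 - y)"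
      using y assms by (simp add: field_simps)
    moreover have "y * (0.06 - 1.06 * y) / (1 - y) \<ge> 0" using y assms by simp
    ultimately show "\<exists>d. (?g has_real_derivative d) (at y) \<and> 0 \<le> d" by (intro exI conjI) (assumption, simp only:)
  qed
  then show ?thesis by simp
qed

section \<open>The multiplier as a second difference of complex powers\<close>

lemma norm_cis_diff_le: "norm (cis a - cis b) \<le> \<bar>a - b\<bar>"
proof -
  have "cis a - cis b = cis b * (cis (a - b) - 1)"
    by (simp add: right_diff_distrib cis_mult)
  then have "norm (cis a - cis b) = norm (cis (a - b) - 1)"
    by (simp add: norm_mult)
  also have "\<dots> \<le> \<bar>a - b\<bar>"
    using iexp_approx1[of "a - b" 0] by (simp add: cis_conv_exp)
  finally show ?thesis .
qed

lemma powr_real_cis: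
  assumes "r > 0"
  shows "of_real r powr Complex p t = of_real (r powr p) * cis (t * ln r)"
  using assms by (simp add: powr_def exp_eq_polar Ln_of_real)

text \<open>Replacing the powers of 1 \<plusminus> \<delta> by cis (\<plusminus> t * \<delta>) costs
  the change of modulus, at most 6 * \<delta> + 2 * \<delta>^3 in total, and the change of phase, at
  most 1.03 * t * \<delta>^2. What remains has modulus exactly 2 - 2 cos (t * \<delta>).\<close>

lemma second_difference_bound:
  fixes \<delta> t p :: real
  assumes d: "0 < \<delta>" "\<delta> \<le> 1/40" and p: "0 \<le> p" "p \<le> 3" and t: "t \<ge> 0"
  shows "norm (of_real (1 + \<delta>) powr Complex p t + of_real (1 - \<delta>) powr Complex p t - 2) \<le>
           2 - 2 * cos (t * \<delta>) + 0.0258 * (t * \<delta>) + 0.1501"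
proof -
  have main: "norm (of_real (r powr p) * cis (t * ln r) - cis b) \<le> \<bar>r powr p - 1\<bar> + \<bar>t * ln r - b\<bar>" for r b
  proof -
    have "of_real (r powr p) * cis (t * ln r) - cis b = of_real (r powr p - 1) * cis (t * ln r) + (cis (t * ln r) - cis b)"
      by (simp add: algebra_simps)
    also have "norm \<dots> \<le> norm (of_real (r powr p - 1) * cis (t * ln r)) + norm (cis (t * ln r) - cis b)"
      by (rule norm_triangle_ineq)
    also have "\<dots> \<le> \<bar>r powr p - 1\<bar> + \<bar>t * ln r - b\<bar>"
      by (intro add_mono norm_cis_diff_le) (simp only: norm_mult norm_of_real norm_cis, simp)
    finally show ?thesis .
  qed
  \<comment> \<open>The exponent will be \<sigma> + 2 \<le> 3, and over [0, 3] the deviation from 1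
    is largest at 3.\<close>
  have "(1 + \<delta>) powr p \<le> (1 + \<delta>) powr 3" "1 \<le> (1 + \<delta>) powr p"
    using d p powr_mono[of p 3 "1 + \<delta>"] by (auto intro: ge_one_powr_ge_zero simp del: powr_numeral)
  moreover have "(1 + \<delta>) powr 3 = (1 + \<delta>) ^ 3" "(1 - \<delta>) powr 3 = (1 - \<delta>) ^ 3"
    using d by (simp_all add: powr_numeral)
  moreover have "(1 - \<delta>) powr 3 \<le> (1 - \<delta>) powr p" "(1 - \<delta>) powr p \<le> 1"
    using d p powr_mono'[of p 3 "1 - \<delta>"] by (auto intro: powr_le1 simp del: powr_numeral)
  ultimately have "\<bar>(1 + \<delta>) powr p - 1\<bar> + \<bar>(1 - \<delta>) powr p - 1\<bar> \<le> (1 + \<delta>) ^ 3 - (1 - \<delta>) ^ 3"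
    by simp
  also have "\<dots> = 6 * \<delta> + 2 * \<delta> * \<delta>\<^sup>2"
    by (simp add: eval_nat_numeral algebra_simps)
  also have "\<dots> \<le> 0.1501"
  proof -
    have "\<delta> * \<delta>\<^sup>2 \<le> (1/40) * (1/40)\<^sup>2"
      using d by (intro mult_mono power_mono) auto
    then show ?thesis using d by (simp add: power2_eq_square)
  qed
  finally have P: "\<bar>(1 + \<delta>) powr p - 1\<bar> + \<bar>(1 - \<delta>) powr p - 1\<bar> \<le> 0.1501" .
  have "\<bar>t * ln (1 + \<delta>) - t * \<delta>\<bar> + \<bar>t * ln (1 - \<delta>) - - (t * \<delta>)\<bar> =
        t * (\<bar>ln (1 + \<delta>) - \<delta>\<bar> + \<bar>ln (1 - \<delta>) + \<delta>\<bar>)"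
  proof -
    have "t * ln (1 + \<delta>) - t * \<delta> = t * (ln (1 + \<delta>) - \<delta>)" "t * ln (1 - \<delta>) - - (t * \<delta>) = t * (ln (1 - \<delta>) + \<delta>)"
      by (simp_all add: algebra_simps)
    then have "\<bar>t * ln (1 + \<delta>) - t * \<delta>\<bar> = t * \<bar>ln (1 + \<delta>) - \<delta>\<bar>"
      "\<bar>t * ln (1 - \<delta>) - - (t * \<delta>)\<bar> = t * \<bar>ln (1 - \<delta>) + \<delta>\<bar>"
      using t by (simp_all only: abs_mult abs_of_nonneg)
    then show ?thesis by (simp only: distrib_left)
  qed
  also have "\<dots> \<le> t * (1.03 * \<delta>\<^sup>2)"
  proof (rule mult_left_mono[OF _ t])
    \<comment> \<open>1.03 = 0.5 + 0.53 collects the quadratic errors of the two logarithms.\<close>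
    show "\<bar>ln (1 + \<delta>) - \<delta>\<bar> + \<bar>ln (1 - \<delta>) + \<delta>\<bar> \<le> 1.03 * \<delta>\<^sup>2"
      using ln_one_plus_ge[of \<delta>] ln_one_minus_ge[of \<delta>] d
        ln_add_one_self_le_self[of \<delta>] ln_one_minus_pos_upper_bound[of \<delta>] by simp
  qed
  also have "\<dots> = (1.03 * \<delta>) * (t * \<delta>)"
    by (simp add: power2_eq_square)
  also have "\<dots> \<le> 0.0258 * (t * \<delta>)"
    using d t by (intro mult_right_mono) auto
  finally have L: "\<bar>t * ln (1 + \<delta>) - t * \<delta>\<bar> + \<bar>t * ln (1 - \<delta>) - - (t * \<delta>)\<bar> \<le> 0.0258 * (t * \<delta>)" .
  have C: "norm (cis (t * \<delta>) + cis (- (t * \<delta>)) - 2) = 2 - 2 * cos (t * \<delta>)"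
  proof -
    have "cis (t * \<delta>) + cis (- (t * \<delta>)) - 2 = of_real (2 * cos (t * \<delta>) - 2)"
      by (simp add: complex_eq_iff)
    then show ?thesis by (simp only: norm_of_real) (simp add: abs_le_iff)
  qed
  let ?a = "of_real ((1 + \<delta>) powr p) * cis (t * ln (1 + \<delta>))" and ?b = "of_real ((1 - \<delta>) powr p) * cis (t * ln (1 - \<delta>))"
  have "norm (?a + ?b - 2) = norm ((?a - cis (t * \<delta>)) + ((?b - cis (- (t * \<delta>))) + (cis (t * \<delta>) + cis (- (t * \<delta>)) - 2)))"
    by (rule arg_cong[of _ _ norm]) simp
  also have "\<dots> \<le> norm (?a - cis (t * \<delta>)) + (norm (?b - cis (- (t * \<delta>))) + norm (cis (t * \<delta>) + cis (- (t * \<delta>)) - 2))"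
    by (intro order_trans[OF norm_triangle_ineq] add_mono order_refl norm_triangle_ineq)
  also have "\<dots> \<le> 2 - 2 * cos (t * \<delta>) + 0.0258 * (t * \<delta>) + 0.1501"
    using main[of "1 + \<delta>" "t * \<delta>"] main[of "1 - \<delta>" "- (t * \<delta>)"] P L C by linarith
  finally show ?thesis
    using d powr_real_cis[of "1 + \<delta>" p t] powr_real_cis[of "1 - \<delta>" p t] by simp
qed

text \<open>Integration by parts; the factor 1 - v kills the boundary term at v = 1. The term odd in
  \<delta> will cancel against the same formula for \<open>- \<delta>\<close>.\<close>

lemma tent_powr_has_integral:
  fixes \<delta> :: real and s :: complex
  assumes d: "\<bar>\<delta>\<bar> < 1" "\<delta> \<noteq> 0" and s: "s \<noteq> -1" "s \<noteq> -2"
  shows "((\<lambda>v. of_real (1 - v) * of_real (1 + \<delta> * v) powr s) has_integral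
          (of_real (1 + \<delta>) powr (s + 2) - 1) / (of_real \<delta> ^ 2 * ((s + 1) * (s + 2))) - 1 / (of_real \<delta> * (s + 1))) {0..1}"
proof -
  have s': "s + 1 \<noteq> 0" "s + 2 \<noteq> 0"
    using s by (auto simp: add_eq_0_iff2)
  let ?d = "complex_of_real \<delta>"
  let ?F = "\<lambda>z. (1 - z) * (1 + ?d * z) powr (s + 1) / (?d * (s + 1)) + (1 + ?d * z) powr (s + 2) / (?d ^ 2 * ((s + 1) * (s + 2)))"
  have "((\<lambda>v. of_real (1 - v) * of_real (1 + \<delta> * v) powr s) has_integral (?F (of_real 1) - ?F (of_real 0))) {0..1}"
  proof (rule fundamental_theorem_of_calculus)
    fix v :: real assume v: "v \<in> {0..1}"
    define z where "z = complex_of_real v"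
    have "\<bar>\<delta> * v\<bar> \<le> \<bar>\<delta>\<bar> * 1"
      unfolding abs_mult using v by (intro mult_left_mono) auto
    then have pos: "1 + \<delta> * v > 0" using d by linarith
    have z: "1 + ?d * z = of_real (1 + \<delta> * v)" by (simp add: z_def)
    then have nz: "1 + ?d * z \<noteq> 0" and nn: "1 + ?d * z \<notin> \<real>\<^sub>\<le>\<^sub>0"
      using pos by (auto simp: complex_nonpos_Reals_iff simp del: of_real_add)
    have e: "(1 + ?d * z) powr (s + 2) = (1 + ?d * z) powr (s + 1) * (1 + ?d * z)"
       "(1 + ?d * z) powr (s + 1) = (1 + ?d * z) powr s * (1 + ?d * z)"
      using nz powr_add[of "1 + ?d * z" "s + 1" 1] powr_add[of "1 + ?d * z" "s" 1] by (simp_all add: add.assoc)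
    have D1: "((\<lambda>z. (1 + ?d * z) powr c) has_field_derivative (c * (1 + ?d * z) powr (c - 1) * ?d)) (at z)" for c
      using nn by (auto intro!: derivative_eq_intros)
    have "(?F has_field_derivative
        (((-1) * (1 + ?d * z) powr (s + 1) + ((s + 1) * (1 + ?d * z) powr (s + 1 - 1) * ?d) * (1 - z)) / (?d * (s + 1)) +
         ((s + 2) * (1 + ?d * z) powr (s + 2 - 1) * ?d) / (?d ^ 2 * ((s + 1) * (s + 2))))) (at z)"
      by (intro DERIV_add DERIV_cdivide DERIV_mult D1) (auto intro!: derivative_eq_intros)
    also have "(((-1) * (1 + ?d * z) powr (s + 1) + ((s + 1) * (1 + ?d * z) powr (s + 1 - 1) * ?d) * (1 - z)) / (?d * (s + 1)) +
         ((s + 2) * (1 + ?d * z) powr (s + 2 - 1) * ?d) / (?d ^ 2 * ((s + 1) * (s + 2)))) = (1 - z) * (1 + ?d * z) powr s"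
    proof -
      have 1: "((s + 2) * (1 + ?d * z) powr (s + 2 - 1) * ?d) / (?d ^ 2 * ((s + 1) * (s + 2))) = (1 + ?d * z) powr (s + 1) / (?d * (s + 1))"
        using s' d by (simp add: power2_eq_square add.commute)
      have 2: "((s + 1) * (1 + ?d * z) powr (s + 1 - 1) * ?d) * (1 - z) / (?d * (s + 1)) = (1 - z) * (1 + ?d * z) powr s"
        using s' d by simp
      show ?thesis
        unfolding add_divide_distrib 1 2 by (simp add: add.commute)
    qed
    finally have "(?F has_field_derivative ((1 - z) * (1 + ?d * z) powr s)) (at (of_real v))"
      by (simp only: z_def)
    from has_vector_derivative_real_field[OF this]
    show "((\<lambda>v. ?F (of_real v)) has_vector_derivative of_real (1 - v) * of_real (1 + \<delta> * v) powr s) (at v within {0..1})"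
      by (simp add: z_def has_vector_derivative_at_within)
  qed simp
  also have "?F (of_real 1) - ?F (of_real 0) =
     (of_real (1 + \<delta>) powr (s + 2) - 1) / (of_real \<delta> ^ 2 * ((s + 1) * (s + 2))) - 1 / (of_real \<delta> * (s + 1))"
    by (simp add: diff_divide_distrib)
  finally show ?thesis .
qed

text \<open>The two halves of the tent add up to the second difference of powers divided by
  \<delta>^2 (s + 1) (s + 2). This denominator has modulus at least (t * \<delta>)^2, so the
  numerical bound at x = t * \<delta> applies.\<close>

lemma tent_multiplier_bound:
  fixes \<delta> \<sigma> t :: real
  assumes d: "0 < \<delta>" "\<delta> \<le> 1/40" and sg: "0 < \<sigma>" "\<sigma> \<le> 1" and t: "t * \<delta> \<ge> 5"
    and I1: "((\<lambda>v. of_real (1 - v) * of_real (1 + \<delta> * v) powr Complex \<sigma> t) has_integral I1) {0..1}"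
    and I2: "((\<lambda>v. of_real (1 - v) * of_real (1 - \<delta> * v) powr Complex \<sigma> t) has_integral I2) {0..1}"
  shows "norm (I1 + I2) \<le> 0.0785"
proof -
  define s where "s = Complex \<sigma> t"
  have s: "s \<noteq> -1" "s \<noteq> -2" and s': "s + 1 \<noteq> 0" "s + 2 \<noteq> 0"
    using sg by (auto simp: s_def complex_eq_iff)
  have t0: "t > 0"
    using mult_nonpos_nonneg[of t \<delta>] t d by linarith
  have "s + 2 = Complex (\<sigma> + 2) t" by (simp add: s_def complex_eq_iff)
  have e1: "I1 = (of_real (1 + \<delta>) powr (s + 2) - 1) / (of_real \<delta> ^ 2 * ((s + 1) * (s + 2))) - 1 / (of_real \<delta> * (s + 1))"
    using has_integral_unique[OF I1[folded s_def] tent_powr_has_integral[of \<delta> s]] d s by simp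
  have e2: "I2 = (of_real (1 + - \<delta>) powr (s + 2) - 1) / (of_real (-\<delta>) ^ 2 * ((s + 1) * (s + 2))) - 1 / (of_real (-\<delta>) * (s + 1))"
    by (rule has_integral_unique[OF I2[folded s_def]]) (use tent_powr_has_integral[of "-\<delta>" s] d s in simp)
  have "I1 + I2 = (of_real (1 + \<delta>) powr (s + 2) + of_real (1 - \<delta>) powr (s + 2) - 2) / (of_real \<delta> ^ 2 * ((s + 1) * (s + 2)))"
    unfolding e1 e2 by (simp add: diff_divide_distrib add_divide_distrib)
  also have "norm \<dots> = norm (of_real (1 + \<delta>) powr (s + 2) + of_real (1 - \<delta>) powr (s + 2) - 2) / (\<delta>\<^sup>2 * (norm (s + 1) * norm (s + 2)))"
    using d by (simp add: norm_divide norm_mult norm_power)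
  also have "\<dots> \<le> 0.0785"
  proof -
    have "\<bar>Im (s + 1)\<bar> \<le> norm (s + 1)" "\<bar>Im (s + 2)\<bar> \<le> norm (s + 2)"
      by (rule abs_Im_le_cmod)+
    then have "t \<le> norm (s + 1)" "t \<le> norm (s + 2)" by (simp_all add: s_def)
    then have "t * t \<le> norm (s + 1) * norm (s + 2)"
      using t0 by (intro mult_mono) auto
    then have lo: "(t * \<delta>)\<^sup>2 \<le> \<delta>\<^sup>2 * (norm (s + 1) * norm (s + 2))"
    proof -
      have "(t * \<delta>)\<^sup>2 = \<delta>\<^sup>2 * (t * t)"
        by (simp add: power2_eq_square)
      then show ?thesis using mult_left_mono[OF \<open>t * t \<le> _\<close>, of "\<delta>\<^sup>2"] by simp
    qed
    have "norm (of_real (1 + \<delta>) powr (s + 2) + of_real (1 - \<delta>) powr (s + 2) - 2) \<le>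
           2 - 2 * cos (t * \<delta>) + 0.0258 * (t * \<delta>) + 0.1501"
      unfolding \<open>s + 2 = Complex (\<sigma> + 2) t\<close>
      by (rule second_difference_bound) (use d sg t0 in auto)
    also have "\<dots> \<le> 0.0785 * (t * \<delta>)\<^sup>2"
      by (rule multiplier_numeric_bound[OF t])
    also have "\<dots> \<le> 0.0785 * (\<delta>\<^sup>2 * (norm (s + 1) * norm (s + 2)))"
      using lo by (intro mult_left_mono) auto
    finally show ?thesis
      using d s' by (subst pos_divide_le_eq) auto
  qed
  finally show ?thesis .
qed

section \<open>Averaging over dilations on the Fourier side\<close>

lemma fourier_shift_average:
  fixes S k a :: "real \<Rightarrow> real"
  assumes S: "integrable lborel S" and k: "integrable lborel k" and a [measurable]: "a \<in> borel_measurable borel"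
  shows "integrable lborel (\<lambda>u. \<integral>v. k v * S (u + a v) \<partial>lborel)"
    and "fourier (\<lambda>u. \<integral>v. k v * S (u + a v) \<partial>lborel) t = (\<integral>v. of_real (k v) * cis (t * a v) \<partial>lborel) * fourier S t"
proof -
  have [measurable]: "S \<in> borel_measurable borel" "k \<in> borel_measurable borel"
    using S k by auto
  have shift: "integrable lborel (\<lambda>u. S (u + b))" for b
    using lborel_integrable_real_affine[OF S, of 1 b] by (simp add: add.commute)
  have norm_shift: "(\<integral>u. \<bar>S (u + b)\<bar> \<partial>lborel) = (\<integral>u. \<bar>S u\<bar> \<partial>lborel)" for b
    using lborel_integral_real_affine[of 1 "\<lambda>u. \<bar>S u\<bar>" b] by (simp add: add.commute)
  have int: "integrable (lborel \<Otimes>\<^sub>M lborel) (\<lambda>(v, u). k v * S (u + a v))"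
  proof (rule lborel_pair.Fubini_integrable)
    show "(\<lambda>(v, u). k v * S (u + a v)) \<in> borel_measurable (lborel \<Otimes>\<^sub>M lborel)"
      by measurable
    have "integrable lborel (\<lambda>v. \<bar>k v\<bar> * (\<integral>u. \<bar>S u\<bar> \<partial>lborel))"
      using k by (intro integrable_mult_left integrable_abs)
    then show "integrable lborel (\<lambda>v. \<integral>u. norm (case (v, u) of (v, u) \<Rightarrow> k v * S (u + a v)) \<partial>lborel)"
      by (simp add: abs_mult norm_shift)
    show "AE v in lborel. integrable lborel (\<lambda>u. case (v, u) of (v, u) \<Rightarrow> k v * S (u + a v))"
      using shift by auto
  qed
  show "integrable lborel (\<lambda>u. \<integral>v. k v * S (u + a v) \<partial>lborel)"
    using lborel_pair.integrable_snd[OF int] .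
  have intc: "integrable (lborel \<Otimes>\<^sub>M lborel) (\<lambda>(v, u). of_real (k v * S (u + a v)) * cis (-(t * u)))"
  proof (rule Bochner_Integration.integrable_bound[OF int])
    show "(\<lambda>(v, u). of_real (k v * S (u + a v)) * cis (-(t * u))) \<in> borel_measurable (lborel \<Otimes>\<^sub>M lborel)"
      unfolding cis_conv_exp by measurable
  qed (auto simp: norm_mult)
  \<comment> \<open>A translation by b in u = ln x, that is, a dilation of x, multiplies the
    transform by cis (t * b).\<close>
  have inner: "(\<integral>u. of_real (S (u + b)) * cis (-(t * u)) \<partial>lborel) = cis (t * b) * fourier S t" for b
  proof -
    have "(\<integral>u. of_real (S (u + b)) * cis (-(t * u)) \<partial>lborel) =
          (\<integral>u. of_real (S (-b + 1 * u + b)) * cis (-(t * (-b + 1 * u))) \<partial>lborel)"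
      using lborel_integral_real_affine[of 1 "\<lambda>u. of_real (S (u + b)) * cis (-(t * u))" "-b"] by simp
    also have "\<dots> = (\<integral>u. cis (t * b) * (of_real (S u) * cis (-(t * u))) \<partial>lborel)"
      by (intro Bochner_Integration.integral_cong refl)
         (simp add: cis_mult mult.left_commute[of "cis _"] algebra_simps)
    finally show ?thesis by (simp add: fourier_def)
  qed
  have "fourier (\<lambda>u. \<integral>v. k v * S (u + a v) \<partial>lborel) t =
        (\<integral>u. (\<integral>v. of_real (k v * S (u + a v)) * cis (-(t * u)) \<partial>lborel) \<partial>lborel)"
    unfolding fourier_def by (simp only: integral_complex_of_real[symmetric] integral_mult_left_zero)
  also have "\<dots> = (\<integral>v. (\<integral>u. of_real (k v * S (u + a v)) * cis (-(t * u)) \<partial>lborel) \<partial>lborel)"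
    using lborel_pair.Fubini_integral[OF intc] by simp
  also have "\<dots> = (\<integral>v. of_real (k v) * (cis (t * a v) * fourier S t) \<partial>lborel)"
    by (simp add: mult.assoc inner)
  also have "\<dots> = (\<integral>v. of_real (k v) * cis (t * a v) \<partial>lborel) * fourier S t"
    by (simp flip: mult.assoc)
  finally show "fourier (\<lambda>u. \<integral>v. k v * S (u + a v) \<partial>lborel) t = (\<integral>v. of_real (k v) * cis (t * a v) \<partial>lborel) * fourier S t" .
qed

text \<open>The density \<open>1 - \<bar>v\<bar>\<close> on \<open>[-1, 1]\<close> is folded at \<open>v = 0\<close>.\<close>

definition tent_defect :: "real \<Rightarrow> real \<Rightarrow> real" where
  "tent_defect \<delta> x = (LINT v:{0..1}|lborel. (1 - v) * (2 * frac x - frac (x * (1 + \<delta> * v)) - frac (x * (1 - \<delta> * v))))"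

definition tent_defect_exp :: "real \<Rightarrow> real \<Rightarrow> real \<Rightarrow> real" where
  "tent_defect_exp \<delta> \<sigma> u = tent_defect \<delta> (exp u) * exp (- (\<sigma> * u))"

text \<open>The factor (1 + \<delta> * v) powr \<sigma> undoes the change in the weight exp (-
  (\<sigma> * u)) of the translated sawtooth, so that the average acts on {x} itself and does not
  depend on \<sigma>.\<close>

definition tent_kernel :: "real \<Rightarrow> real \<Rightarrow> real \<Rightarrow> real" where
  "tent_kernel \<delta> \<sigma> v = indicator {0..1} v * ((1 - v) * (1 + \<delta> * v) powr \<sigma>)"

lemma one_plus_mult_pos:
  fixes \<delta> v :: real
  assumes "\<bar>\<delta>\<bar> < 1" "v \<in> {0..1}"
  shows "1 + \<delta> * v > 0"
proof -
  have "\<bar>\<delta> * v\<bar> \<le> \<bar>\<delta>\<bar> * 1"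
    unfolding abs_mult using assms by (intro mult_left_mono) auto
  then show ?thesis using assms by linarith
qed

lemma integrable_tent_kernel:
  assumes "\<bar>\<delta>\<bar> < 1"
  shows "integrable lborel (tent_kernel \<delta> \<sigma>)"
proof -
  have "set_integrable lborel {0..1} (\<lambda>v. (1 - v) * (1 + \<delta> * v) powr \<sigma>)"
    by (intro borel_integrable_atLeastAtMost' continuous_intros)
       (use one_plus_mult_pos[OF assms] in fastforce)+
  then show ?thesis
    by (simp add: set_integrable_def tent_kernel_def[abs_def])
qed

lemma sawtooth_bounds:
  assumes "0 < \<sigma>" "\<sigma> < 1"
  shows "0 \<le> sawtooth \<sigma> u" "sawtooth \<sigma> u \<le> 1"
proof -
  show "0 \<le> sawtooth \<sigma> u" by (simp add: sawtooth_def)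
  show "sawtooth \<sigma> u \<le> 1"
  proof (cases "u \<ge> 0")
    case True
    then have "frac (exp u) * exp (- (\<sigma> * u)) \<le> 1 * 1"
      using assms by (intro mult_mono) (auto intro: less_imp_le frac_lt_1)
    then show ?thesis by (simp add: sawtooth_def)
  next
    case False
    then have "frac (exp u) = exp u" by (simp add: frac_eq)
    then have "sawtooth \<sigma> u = exp ((1 - \<sigma>) * u)"
      by (simp add: sawtooth_def left_diff_distrib flip: exp_add)
    then show ?thesis using False assms by (simp add: mult_nonneg_nonpos)
  qed
qed

lemma integrable_tent_kernel_mult:
  assumes "\<bar>\<delta>\<bar> < 1" "0 < \<sigma>" "\<sigma> < 1"
  shows "integrable lborel (\<lambda>v. tent_kernel \<delta> \<sigma> v * sawtooth \<sigma> (u + ln (1 + \<delta> * v)))"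
proof (rule Bochner_Integration.integrable_bound[OF integrable_tent_kernel[OF assms(1), of \<sigma>]])
  show "(\<lambda>v. tent_kernel \<delta> \<sigma> v * sawtooth \<sigma> (u + ln (1 + \<delta> * v))) \<in> borel_measurable lborel"
    unfolding tent_kernel_def by measurable
  show "AE v in lborel. norm (tent_kernel \<delta> \<sigma> v * sawtooth \<sigma> (u + ln (1 + \<delta> * v))) \<le> norm (tent_kernel \<delta> \<sigma> v)"
    using sawtooth_bounds[OF assms(2,3)] by (intro AE_I2) (auto simp: abs_mult intro!: mult_left_le)
qed

lemma tent_kernel_sawtooth:
  assumes "\<bar>\<delta>\<bar> < 1"
  shows "tent_kernel \<delta> \<sigma> v * sawtooth \<sigma> (u + ln (1 + \<delta> * v)) =
         indicator {0..1} v * ((1 - v) * frac (exp u * (1 + \<delta> * v))) * exp (- (\<sigma> * u))"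
proof (cases "v \<in> {0..1}")
  case True
  define r where "r = 1 + \<delta> * v"
  have r: "r > 0" unfolding r_def by (rule one_plus_mult_pos[OF assms True])
  have "r powr \<sigma> * exp (- (\<sigma> * (u + ln r))) = exp (- (\<sigma> * u))"
    using r by (simp add: powr_def algebra_simps flip: exp_add)
  moreover have "exp (u + ln r) = exp u * r"
    using r by (simp add: exp_add)
  ultimately show ?thesis
    using True by (simp add: tent_kernel_def sawtooth_def mult_ac flip: r_def)
qed (simp add: tent_kernel_def)

lemma tent_defect_exp_eq:
  assumes "\<bar>\<delta>\<bar> < 1" "0 < \<sigma>" "\<sigma> < 1"
  shows "tent_defect_exp \<delta> \<sigma> u = sawtooth \<sigma> u
     - (\<integral>v. tent_kernel \<delta> \<sigma> v * sawtooth \<sigma> (u + ln (1 + \<delta> * v)) \<partial>lborel)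
     - (\<integral>v. tent_kernel (-\<delta>) \<sigma> v * sawtooth \<sigma> (u + ln (1 + -\<delta> * v)) \<partial>lborel)"
proof -
  \<comment> \<open>The folded tent has total mass 1, which turns \<open>2 * frac x\<close> inside
    the integral into a single {x}.\<close>
  let ?k = "\<lambda>v. indicator {0..1} v * (2 * (1 - v)) :: real"
  have one: "(\<integral>v. ?k v \<partial>lborel) = 1" and int1: "integrable lborel ?k"
  proof -
    have si: "set_integrable lborel {0..1} (\<lambda>v::real. 2 * (1 - v))"
      by (intro borel_integrable_atLeastAtMost' continuous_intros)
    then show "integrable lborel ?k" by (simp add: set_integrable_def)
    have "((\<lambda>v::real. 2 * (1 - v)) has_integral ((2 * 1 - 1\<^sup>2) - (2 * 0 - 0\<^sup>2))) {0..1}"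
      by (rule fundamental_theorem_of_calculus)
         (auto intro!: derivative_eq_intros simp flip: has_real_derivative_iff_has_vector_derivative)
    then show "(\<integral>v. ?k v \<partial>lborel) = 1"
      using set_borel_integral_eq_integral(2)[OF si] by (simp add: set_lebesgue_integral_def integral_unique)
  qed
  have d': "\<bar>-\<delta>\<bar> < 1" using assms by simp
  note k1 = integrable_tent_kernel_mult[OF assms, of u] and k2 = integrable_tent_kernel_mult[OF d' assms(2,3), of u]
  have "tent_defect_exp \<delta> \<sigma> u = (\<integral>v. indicator {0..1} v * ((1 - v) * (2 * frac (exp u) - frac (exp u * (1 + \<delta> * v)) - frac (exp u * (1 - \<delta> * v)))) * exp (- (\<sigma> * u)) \<partial>lborel)"
    by (simp add: tent_defect_exp_def tent_defect_def set_lebesgue_integral_def)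
  also have "\<dots> = (\<integral>v. ?k v * sawtooth \<sigma> u - tent_kernel \<delta> \<sigma> v * sawtooth \<sigma> (u + ln (1 + \<delta> * v))
      - tent_kernel (-\<delta>) \<sigma> v * sawtooth \<sigma> (u + ln (1 + -\<delta> * v)) \<partial>lborel)"
    unfolding tent_kernel_sawtooth[OF assms(1)] tent_kernel_sawtooth[OF d']
    by (intro Bochner_Integration.integral_cong refl) (simp add: sawtooth_def algebra_simps)
  also have "\<dots> = (\<integral>v. ?k v * sawtooth \<sigma> u \<partial>lborel) - (\<integral>v. tent_kernel \<delta> \<sigma> v * sawtooth \<sigma> (u + ln (1 + \<delta> * v)) \<partial>lborel)
      - (\<integral>v. tent_kernel (-\<delta>) \<sigma> v * sawtooth \<sigma> (u + ln (1 + -\<delta> * v)) \<partial>lborel)"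
    by (subst Bochner_Integration.integral_diff Bochner_Integration.integral_diff; (intro Bochner_Integration.integrable_diff integrable_mult_left k1 k2 int1)?)+ simp
  also have "(\<integral>v. ?k v * sawtooth \<sigma> u \<partial>lborel) = sawtooth \<sigma> u"
    using one by simp
  finally show ?thesis .
qed

lemma fourier_diff:
  assumes "integrable lborel f" "integrable lborel g"
  shows "fourier (\<lambda>u. f u - g u) t = fourier f t - fourier g t"
proof -
  have int: "integrable lborel (\<lambda>u. of_real (f u) * cis (-(t * u)))" if f: "integrable lborel f" for f :: "real \<Rightarrow> real"
  proof (rule Bochner_Integration.integrable_bound[OF f])
    have [measurable]: "f \<in> borel_measurable borel" using f by auto
    show "(\<lambda>u. of_real (f u) * cis (-(t * u))) \<in> borel_measurable lborel"
      unfolding cis_conv_exp by measurable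
  qed (simp add: norm_mult)
  show ?thesis
    unfolding fourier_def using int[OF assms(1)] int[OF assms(2)]
    by (simp add: left_diff_distrib)
qed

lemma fourier_cnj: "fourier h (-t) = cnj (fourier h t)"
  unfolding fourier_def by (simp add: cis_cnj flip: Bochner_Integration.integral_cnj)

text \<open>A complex power of a positive real is modulus times phase. Hence the multiplier of
  \<open>fourier_shift_average\<close> is the integral that \<open>tent_powr_has_integral\<close>
  evaluates.\<close>

lemma tent_kernel_transform:
  assumes d: "\<bar>\<delta>\<bar> < 1"
  shows "((\<lambda>v. of_real (1 - v) * of_real (1 + \<delta> * v) powr Complex \<sigma> t) has_integral
           (\<integral>v. of_real (tent_kernel \<delta> \<sigma> v) * cis (t * ln (1 + \<delta> * v)) \<partial>lborel)) {0..1}"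
proof -
  let ?f = "\<lambda>v. of_real (1 - v) * of_real (1 + \<delta> * v) powr Complex \<sigma> t"
  have pos: "1 + \<delta> * v > 0" if "v \<in> {0..1}" for v
    by (rule one_plus_mult_pos[OF d that])
  have si: "set_integrable lborel {0..1} ?f"
  proof (rule borel_integrable_atLeastAtMost')
    have "continuous_on {0..1} (\<lambda>v. of_real (1 - v) * (of_real ((1 + \<delta> * v) powr \<sigma>) * cis (t * ln (1 + \<delta> * v))))"
      using pos by (intro continuous_intros) force+
    then show "continuous_on {0..1} ?f"
      by (rule iffD1[OF continuous_on_cong, rotated -1]) (simp_all only: powr_real_cis[OF pos])
  qed
  have "(\<integral>v. of_real (tent_kernel \<delta> \<sigma> v) * cis (t * ln (1 + \<delta> * v)) \<partial>lborel) = (LINT v:{0..1}|lborel. ?f v)"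
    unfolding set_lebesgue_integral_def
  proof (intro Bochner_Integration.integral_cong refl)
    fix v :: real
    show "of_real (tent_kernel \<delta> \<sigma> v) * cis (t * ln (1 + \<delta> * v)) = indicat_real {0..1} v *\<^sub>R ?f v"
    proof (cases "v \<in> {0..1}")
      case True
      then show ?thesis
        unfolding powr_real_cis[OF pos[OF True]] by (simp add: tent_kernel_def mult.assoc)
    qed (simp add: tent_kernel_def)
  qed
  also have "\<dots> = integral {0..1} ?f"
    by (rule set_borel_integral_eq_integral(2)[OF si])
  finally show ?thesis
    using set_borel_integral_eq_integral(1)[OF si] by (simp add: integrable_integral)
qed

lemma fourier_tent_defect_exp:
  fixes \<delta> \<sigma> t :: real
  defines "I \<equiv> \<lambda>d. \<integral>v. of_real (tent_kernel d \<sigma> v) * cis (t * ln (1 + d * v)) \<partial>lborel"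
  assumes "\<bar>\<delta>\<bar> < 1" "0 < \<sigma>" "\<sigma> < 1"
  shows "integrable lborel (tent_defect_exp \<delta> \<sigma>)"
    and "fourier (tent_defect_exp \<delta> \<sigma>) t = (1 - (I \<delta> + I (-\<delta>))) * fourier (sawtooth \<sigma>) t"
proof -
  have d': "\<bar>-\<delta>\<bar> < 1" using assms by simp
  have [measurable]: "(\<lambda>v. ln (1 + d * v)) \<in> borel_measurable borel" for d :: real
    by measurable
  note S = integrable_sawtooth[OF assms(3,4)]
  note A = fourier_shift_average[OF S integrable_tent_kernel[OF assms(2)], of "\<lambda>v. ln (1 + \<delta> * v)"]
  note B = fourier_shift_average[OF S integrable_tent_kernel[OF d'], of "\<lambda>v. ln (1 + - \<delta> * v)"]
  have eq: "tent_defect_exp \<delta> \<sigma> = (\<lambda>u. sawtooth \<sigma> u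
     - (\<integral>v. tent_kernel \<delta> \<sigma> v * sawtooth \<sigma> (u + ln (1 + \<delta> * v)) \<partial>lborel)
     - (\<integral>v. tent_kernel (-\<delta>) \<sigma> v * sawtooth \<sigma> (u + ln (1 + -\<delta> * v)) \<partial>lborel))"
    by (intro ext tent_defect_exp_eq assms)
  show "integrable lborel (tent_defect_exp \<delta> \<sigma>)"
    unfolding eq by (intro Bochner_Integration.integrable_diff S A(1) B(1)) measurable
  show "fourier (tent_defect_exp \<delta> \<sigma>) t = (1 - (I \<delta> + I (-\<delta>))) * fourier (sawtooth \<sigma>) t"
    unfolding eq I_def
    by (subst fourier_diff fourier_diff A(2) B(2);
        (intro Bochner_Integration.integrable_diff S A(1) B(1))?; measurable?)+ (simp add: algebra_simps)
qed

lemma Q_integrand_minus: "Q_integrand \<sigma> (-t) = Q_integrand \<sigma> t"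
proof -
  have "Complex \<sigma> (-t) = cnj (Complex \<sigma> t)" by (simp add: complex_eq_iff)
  then show ?thesis
    by (simp add: Q_integrand_def zeta_cnj norm_divide del: complex_cnj)
qed

text \<open>For t > 0 the multiplier satisfies |1 - M| \<ge> 1 - 0.0785 = 0.9215; negative t reduces
  to this by conjugating both transforms.\<close>

lemma Q_integrand_le:
  fixes \<delta> \<sigma> t :: real
  assumes d: "0 < \<delta>" "\<delta> \<le> 1/40" and sg: "0 < \<sigma>" "\<sigma> < 1" and t: "\<bar>t\<bar> * \<delta> \<ge> 5"
  shows "Q_integrand \<sigma> t \<le> (cmod (fourier (tent_defect_exp \<delta> \<sigma>) t) / 0.9215)\<^sup>2"
proof -
  have pos: "Q_integrand \<sigma> t \<le> (cmod (fourier (tent_defect_exp \<delta> \<sigma>) t) / 0.9215)\<^sup>2"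
    if t: "t * \<delta> \<ge> 5" for t
  proof -
    have d1: "\<bar>\<delta>\<bar> < 1" "\<bar>-\<delta>\<bar> < 1" using d by auto
    define M where "M = (\<integral>v. of_real (tent_kernel \<delta> \<sigma> v) * cis (t * ln (1 + \<delta> * v)) \<partial>lborel)
        + (\<integral>v. of_real (tent_kernel (-\<delta>) \<sigma> v) * cis (t * ln (1 + -\<delta> * v)) \<partial>lborel)"
    have "norm M \<le> 0.0785"
      unfolding M_def
    proof (rule tent_multiplier_bound[OF d sg(1) less_imp_le[OF sg(2)] t])
      show "((\<lambda>v. of_real (1 - v) * of_real (1 + \<delta> * v) powr Complex \<sigma> t) has_integral
          (\<integral>v. of_real (tent_kernel \<delta> \<sigma> v) * cis (t * ln (1 + \<delta> * v)) \<partial>lborel)) {0..1}"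
        by (rule tent_kernel_transform[OF d1(1)])
      show "((\<lambda>v. of_real (1 - v) * of_real (1 - \<delta> * v) powr Complex \<sigma> t) has_integral
          (\<integral>v. of_real (tent_kernel (-\<delta>) \<sigma> v) * cis (t * ln (1 + -\<delta> * v)) \<partial>lborel)) {0..1}"
        using tent_kernel_transform[OF d1(2), of \<sigma> t] by simp
    qed
    then have "0.9215 \<le> norm (1 - M)"
      using norm_triangle_ineq2[of 1 M] by simp
    then have "0.9215 * cmod (fourier (sawtooth \<sigma>) t) \<le> cmod (fourier (tent_defect_exp \<delta> \<sigma>) t)"
      unfolding fourier_tent_defect_exp(2)[OF d1(1) sg] norm_mult
      by (intro mult_right_mono) (simp_all add: M_def)
    then have "cmod (zeta (Complex \<sigma> t) / Complex \<sigma> t) \<le> cmod (fourier (tent_defect_exp \<delta> \<sigma>) t) / 0.9215"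
      by (simp add: fourier_sawtooth[OF sg])
    then show ?thesis
      unfolding Q_integrand_def by (intro power_mono) auto
  qed
  show ?thesis
  proof (cases "t \<ge> 0")
    case True
    then show ?thesis using pos t by simp
  next
    case False
    then have "(-t) * \<delta> \<ge> 5" using t by simp
    from pos[OF this] show ?thesis
      by (simp add: Q_integrand_minus fourier_cnj)
  qed
qed

section \<open>The norm of the defect\<close>

lemma integral_one_minus:
  fixes b :: real
  assumes "0 \<le> b" "b \<le> 1"
  shows "set_integrable lborel {b..1} (\<lambda>v. 1 - v)"
    and "(LINT v:{b..1}|lborel. (1 - v)) = (1 - b)\<^sup>2 / 2"
proof -
  show si: "set_integrable lborel {b..1} (\<lambda>v. 1 - v)"
    by (intro borel_integrable_atLeastAtMost' continuous_intros)
  have "((\<lambda>v::real. 1 - v) has_integral ((1 - 1\<^sup>2 / 2) - (b - b\<^sup>2 / 2))) {b..1}"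
    by (rule fundamental_theorem_of_calculus)
       (use assms in \<open>auto intro!: derivative_eq_intros simp flip: has_real_derivative_iff_has_vector_derivative\<close>)
  then show "(LINT v:{b..1}|lborel. (1 - v)) = (1 - b)\<^sup>2 / 2"
    using set_borel_integral_eq_integral(2)[OF si] by (simp add: integral_unique power2_eq_square field_simps)
qed

section \<open>Pointwise size of the defect\<close>

lemma frac_second_difference:
  fixes x w :: real
  shows "2 * frac x - frac (x + w) - frac (x - w) = of_int ((\<lfloor>x + w\<rfloor> - \<lfloor>x\<rfloor>) - (\<lfloor>x\<rfloor> - \<lfloor>x - w\<rfloor>))"
  by (simp add: frac_def)

text \<open>The linear parts cancel in the second difference, leaving an integer, and this integer
  lies strictly between -2 and 2.\<close>

lemma abs_frac_second_difference_le: "\<bar>2 * frac x - frac (x + w) - frac (x - w)\<bar> \<le> 1" for x w :: real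
proof -
  have "\<bar>2 * frac x - frac (x + w) - frac (x - w)\<bar> < 2"
    using frac_ge_0[of x] frac_lt_1[of x] frac_ge_0[of "x + w"] frac_lt_1[of "x + w"]
      frac_ge_0[of "x - w"] frac_lt_1[of "x - w"] by linarith
  then have "real_of_int \<bar>(\<lfloor>x + w\<rfloor> - \<lfloor>x\<rfloor>) - (\<lfloor>x\<rfloor> - \<lfloor>x - w\<rfloor>)\<bar> < real_of_int 2"
    unfolding frac_second_difference by simp
  then have "\<bar>(\<lfloor>x + w\<rfloor> - \<lfloor>x\<rfloor>) - (\<lfloor>x\<rfloor> - \<lfloor>x - w\<rfloor>)\<bar> \<le> 1"
    by (simp only: of_int_less_iff)
  then have "real_of_int \<bar>(\<lfloor>x + w\<rfloor> - \<lfloor>x\<rfloor>) - (\<lfloor>x\<rfloor> - \<lfloor>x - w\<rfloor>)\<bar> \<le> real_of_int 1"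
    by (simp only: of_int_le_iff)
  then show ?thesis
    unfolding frac_second_difference by simp
qed

lemma abs_frac_scaled_difference_le:
  "\<bar>2 * frac x - frac (x * (1 + \<delta> * v)) - frac (x * (1 - \<delta> * v))\<bar> \<le> 1" for x \<delta> v :: real
  using abs_frac_second_difference_le[of x "x * (\<delta> * v)"] by (simp add: algebra_simps)

lemma set_integrable_tent_defect:
  fixes x \<delta> :: real
  shows
  "set_integrable lborel {0..1} (\<lambda>v. (1 - v) * (2 * frac x - frac (x * (1 + \<delta> * v)) - frac (x * (1 - \<delta> * v))))"
  unfolding set_integrable_def
proof (rule Bochner_Integration.integrable_bound)
  show "integrable lborel (\<lambda>v::real. indicat_real {0..1} v *\<^sub>R (1 - v))"
    using integral_one_minus(1)[of 0] by (simp add: set_integrable_def)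
  show "AE v in lborel. norm (indicat_real {0..1} (v :: real) *\<^sub>R ((1 - v) * (2 * frac x - frac (x * (1 + \<delta> * v)) - frac (x * (1 - \<delta> * v)))))
          \<le> norm (indicat_real {0..1} v *\<^sub>R (1 - v))"
    using abs_frac_scaled_difference_le[of x \<delta>]
    by (intro AE_I2) (auto simp: abs_mult intro!: mult_left_le split: split_indicator)
qed measurable

lemma abs_tent_defect_le: "\<bar>tent_defect \<delta> x\<bar> \<le> 1 / 2"
proof -
  let ?D = "\<lambda>v. 2 * frac x - frac (x * (1 + \<delta> * v)) - frac (x * (1 - \<delta> * v))"
  have "\<bar>tent_defect \<delta> x\<bar> \<le> (LINT v:{0..1}|lborel. \<bar>(1 - v) * ?D v\<bar>)"
    unfolding tent_defect_def using set_integral_norm_bound[OF set_integrable_tent_defect[of x \<delta>]] by simp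
  also have "\<dots> \<le> (LINT v:{0..1}|lborel. 1 - v)"
    by (intro set_integral_mono set_integrable_abs set_integrable_tent_defect integral_one_minus(1))
       (use abs_frac_scaled_difference_le[of x \<delta>] in \<open>auto simp: abs_mult intro!: mult_left_le\<close>)
  also have "\<dots> = 1 / 2"
    by (subst integral_one_minus) auto
  finally show ?thesis .
qed

text \<open>For an integer k next to x and r = k / x, put a = \<bar>r - 1\<bar> / \<delta>, the
  value of v at which the dilated point reaches k. Integrating the density 1 - v over v \<ge> a
  gives (1 - a)^2 / 2, and this function is its square.\<close>

definition jump_energy :: "real \<Rightarrow> real \<Rightarrow> real" where
  "jump_energy \<delta> r = (max 0 (1 - \<bar>r - 1\<bar> / \<delta>)) ^ 4 / 4"

lemma jump_energy_nonneg: "jump_energy \<delta> r \<ge> 0"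
  by (simp add: jump_energy_def)

lemma borel_measurable_jump_energy [measurable]: "jump_energy \<delta> \<in> borel_measurable borel"
  unfolding jump_energy_def[abs_def] by measurable

lemma tail_one_minus:
  assumes "0 \<le> b"
  shows "(LINT v:{0..1}|lborel. (1 - v) * of_bool (b \<le> v)) = (max 0 (1 - b))\<^sup>2 / 2"
    and "set_integrable lborel {0..1} (\<lambda>v::real. (1 - v) * of_bool (b \<le> v))"
proof -
  have eq: "indicat_real {0..1} v *\<^sub>R ((1 - v) * of_bool (b \<le> v)) = indicat_real {b..1} v *\<^sub>R (1 - v)" for v
    using assms by (auto split: split_indicator)
  show "(LINT v:{0..1}|lborel. (1 - v) * of_bool (b \<le> v)) = (max 0 (1 - b))\<^sup>2 / 2"
    unfolding set_lebesgue_integral_def eq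
    using integral_one_minus(2)[of b] assms
    by (cases "b \<le> 1") (simp_all add: set_lebesgue_integral_def max_def)
  show "set_integrable lborel {0..1} (\<lambda>v::real. (1 - v) * of_bool (b \<le> v))"
    unfolding set_integrable_def eq
    using integral_one_minus(1)[of b] assms
    by (cases "b \<le> 1") (simp_all add: set_integrable_def)
qed

text \<open>
  The defect is the difference of the nonnegative contributions of the integers next to \<open>x\<close> on either
  side, so that the square of the larger one bounds its square.
\<close>

lemma tent_defect_sq_le:
  fixes \<delta> x :: real
  assumes d: "\<delta> > 0" and x: "x > 0" and dx: "\<delta> * x \<le> 1"
  shows "(tent_defect \<delta> x)\<^sup>2 \<le> jump_energy \<delta> (of_int (\<lfloor>x\<rfloor> + 1) / x) + jump_energy \<delta> (of_int \<lfloor>x\<rfloor> / x)"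
proof -
  define w where "w = \<delta> * x"
  define a b where "a = (1 - frac x) / w" and "b = frac x / w"
  have w: "0 < w" "w \<le> 1" using assms by (auto simp: w_def)
  have ab: "a \<ge> 0" "b \<ge> 0" using w by (auto simp: a_def b_def less_imp_le frac_lt_1)
  let ?D = "\<lambda>v. 2 * frac x - frac (x * (1 + \<delta> * v)) - frac (x * (1 - \<delta> * v))"
  have D: "- of_bool (b \<le> v) \<le> ?D v \<and> ?D v \<le> of_bool (a \<le> v)" if "v \<in> {0..1}" for v
  proof -
    have wv: "0 \<le> w * v" "w * v \<le> 1"
      using that w mult_mono[of w 1 v 1] by auto
    have "?D v = 2 * frac x - frac (x + w * v) - frac (x - w * v)"
      by (simp add: w_def algebra_simps)
    also have "\<dots> = of_int ((\<lfloor>x + w * v\<rfloor> - \<lfloor>x\<rfloor>) - (\<lfloor>x\<rfloor> - \<lfloor>x - w * v\<rfloor>))"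
      by (rule frac_second_difference)
    finally have eq: "?D v = of_int ((\<lfloor>x + w * v\<rfloor> - \<lfloor>x\<rfloor>) - (\<lfloor>x\<rfloor> - \<lfloor>x - w * v\<rfloor>))" .
    \<comment> \<open>Since \<delta> * x \<le> 1, each of the points x \<plusminus> w * v crosses at
      most one integer: upwards only for v \<ge> a, downwards only for v \<ge> b.\<close>
    have up: "\<lfloor>x\<rfloor> \<le> \<lfloor>x + w * v\<rfloor>" "\<lfloor>x - w * v\<rfloor> \<le> \<lfloor>x\<rfloor>" "\<lfloor>x + w * v\<rfloor> \<le> \<lfloor>x\<rfloor> + 1" "\<lfloor>x\<rfloor> - 1 \<le> \<lfloor>x - w * v\<rfloor>"
      using wv by linarith+
    have 1: "\<lfloor>x + w * v\<rfloor> \<le> \<lfloor>x\<rfloor>" if "\<not> a \<le> v"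
    proof -
      have "w * v < 1 - frac x"
        using that w by (simp add: a_def field_simps)
      then show ?thesis unfolding frac_def by linarith
    qed
    have 2: "\<lfloor>x\<rfloor> \<le> \<lfloor>x - w * v\<rfloor>" if "\<not> b \<le> v"
    proof -
      have "w * v < frac x"
        using that w by (simp add: b_def field_simps)
      then show ?thesis unfolding frac_def by linarith
    qed
    have "(\<lfloor>x + w * v\<rfloor> - \<lfloor>x\<rfloor>) - (\<lfloor>x\<rfloor> - \<lfloor>x - w * v\<rfloor>) \<le> of_bool (a \<le> v)"
      using up 1 by (cases "a \<le> v") auto
    moreover have "- of_bool (b \<le> v) \<le> (\<lfloor>x + w * v\<rfloor> - \<lfloor>x\<rfloor>) - (\<lfloor>x\<rfloor> - \<lfloor>x - w * v\<rfloor>)"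
      using up 2 by (cases "b \<le> v") auto
    ultimately show ?thesis
      unfolding eq by (simp only: of_bool_def) (auto split: if_splits)
  qed
  have "tent_defect \<delta> x \<le> (LINT v:{0..1}|lborel. (1 - v) * of_bool (a \<le> v))"
    unfolding tent_defect_def
    by (intro set_integral_mono set_integrable_tent_defect tail_one_minus(2) ab mult_left_mono) (use D in auto)
  then have U: "tent_defect \<delta> x \<le> (max 0 (1 - a))\<^sup>2 / 2"
    by (simp only: tail_one_minus(1)[OF ab(1)])
  have "(LINT v:{0..1}|lborel. - ((1 - v) * of_bool (b \<le> v))) \<le> tent_defect \<delta> x"
    unfolding tent_defect_def
  proof (intro set_integral_mono set_integrable_tent_defect)
    show "set_integrable lborel {0..1} (\<lambda>v::real. - ((1 - v) * of_bool (b \<le> v)))"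
      using tail_one_minus(2)[OF ab(2)] by (simp add: set_integrable_def)
    fix v :: real assume v: "v \<in> {0..1}"
    have "(1 - v) * (- of_bool (b \<le> v)) \<le> (1 - v) * ?D v"
      using D[OF v] v by (intro mult_left_mono) auto
    then show "- ((1 - v) * of_bool (b \<le> v)) \<le> (1 - v) * ?D v" by simp
  qed
  then have L: "- ((max 0 (1 - b))\<^sup>2 / 2) \<le> tent_defect \<delta> x"
    using tail_one_minus(1)[OF ab(2)] by (simp add: set_lebesgue_integral_def)
  have sq: "g\<^sup>2 \<le> P\<^sup>2 + R\<^sup>2" if "g \<le> P" "- R \<le> g" for g P R :: real
  proof (cases "g \<ge> 0")
    case True
    then have "g\<^sup>2 \<le> P\<^sup>2" using that by (intro power_mono)
    then show ?thesis using zero_le_power2[of R] by linarith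
  next
    case False
    then have "(-g)\<^sup>2 \<le> R\<^sup>2" using that by (intro power_mono) auto
    then show ?thesis using zero_le_power2[of P] by (simp only: power2_minus)
  qed
  have "(tent_defect \<delta> x)\<^sup>2 \<le> ((max 0 (1 - a))\<^sup>2 / 2)\<^sup>2 + ((max 0 (1 - b))\<^sup>2 / 2)\<^sup>2"
    by (rule sq[OF U L])
  also have "\<dots> = (max 0 (1 - a)) ^ 4 / 4 + (max 0 (1 - b)) ^ 4 / 4"
    by (simp add: power_divide flip: power_mult)
  also have "a = \<bar>of_int (\<lfloor>x\<rfloor> + 1) / x - 1\<bar> / \<delta>"
  proof -
    have "of_int (\<lfloor>x\<rfloor> + 1) / x - 1 = (1 - frac x) / x"
      using x by (simp add: frac_def field_simps)
    moreover have "(1 - frac x) / x \<ge> 0" using x by (simp add: less_imp_le frac_lt_1)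
    ultimately show ?thesis by (simp only: abs_of_nonneg) (simp add: a_def w_def)
  qed
  also have "b = \<bar>of_int \<lfloor>x\<rfloor> / x - 1\<bar> / \<delta>"
  proof -
    have "of_int \<lfloor>x\<rfloor> / x - 1 = - (frac x / x)"
      using x by (simp add: frac_def field_simps)
    moreover have "frac x / x \<ge> 0" using x by simp
    ultimately show ?thesis by (simp only: abs_minus_cancel abs_of_nonneg) (simp add: b_def w_def)
  qed
  finally show ?thesis by (simp only: jump_energy_def)
qed

lemma tent_defect_sq_le_sum:
  fixes \<delta> x :: real
  assumes d: "0 < \<delta>" "\<delta> \<le> 1" and x: "x > 0" "\<delta> * x \<le> 1" and N: "of_int \<lfloor>x\<rfloor> + 1 \<le> real N"
  shows "(tent_defect \<delta> x)\<^sup>2 \<le> (\<Sum>k=1..N. jump_energy \<delta> (real k / x))"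
proof -
  define n where "n = nat \<lfloor>x\<rfloor>"
  have n: "of_int \<lfloor>x\<rfloor> = real n" "of_int (\<lfloor>x\<rfloor> + 1) = real (n + 1)" using x by (simp_all add: n_def)
  have "n + 1 \<le> N" using N n by simp
  have "(tent_defect \<delta> x)\<^sup>2 \<le> jump_energy \<delta> (real (n + 1) / x) + jump_energy \<delta> (real n / x)"
    using tent_defect_sq_le[OF d(1) x] unfolding n .
  also have "\<dots> \<le> (\<Sum>k=1..N. jump_energy \<delta> (real k / x))"
  \<comment> \<open>For x < 1 the left neighbour is 0, which the sum from 1 omits; its energy is 0
    because \<delta> \<le> 1.\<close>
  proof (cases "n = 0")
    case True
    have "jump_energy \<delta> (real n / x) = 0"
      using True d by (simp add: jump_energy_def max_def)
    moreover have "jump_energy \<delta> (real (n + 1) / x) \<le> (\<Sum>k=1..N. jump_energy \<delta> (real k / x))"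
      using \<open>n + 1 \<le> N\<close> by (intro member_le_sum[of "n + 1"]) (auto simp: jump_energy_nonneg)
    ultimately show ?thesis by simp
  next
    case False
    have "jump_energy \<delta> (real (n + 1) / x) + jump_energy \<delta> (real n / x) = (\<Sum>k\<in>{n + 1, n}. jump_energy \<delta> (real k / x))"
      by simp
    also have "\<dots> \<le> (\<Sum>k=1..N. jump_energy \<delta> (real k / x))"
      using False \<open>n + 1 \<le> N\<close> by (intro sum_mono2) (auto simp: jump_energy_nonneg)
    finally show ?thesis .
  qed
  finally show ?thesis .
qed

section \<open>Integrals of the jump contributions\<close>

lemma jump_energy_outside:
  assumes "\<delta> > 0" "r \<notin> {1-\<delta>..1+\<delta>}"
  shows "jump_energy \<delta> r = 0"
proof -
  have "\<bar>r - 1\<bar> \<ge> \<delta>" using assms by (auto simp: abs_if)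
  then have "\<bar>r - 1\<bar> / \<delta> \<ge> 1" using assms by simp
  then show ?thesis by (simp add: jump_energy_def max_def)
qed

text \<open>Young's inequality bounds r powr p by a convex combination of r and 1 / r. Expanding 1 /
  r about 1 leaves a linear function with a small error, and the slope will integrate to 0 against
  the symmetric energy.\<close>

lemma powr_le_linear:
  fixes \<delta> p r :: real
  assumes d: "0 < \<delta>" "\<delta> < 1" and p: "-1 \<le> p" "p \<le> 1" and r: "r \<in> {1-\<delta>..1+\<delta>}"
  shows "r powr p \<le> 1 + \<delta>\<^sup>2 / (1 - \<delta>) + p * (r - 1)"
proof -
  have r0: "r > 0" using d r by auto
  have "r powr p = r powr ((1 + p) / 2) * (1 / r) powr ((1 - p) / 2)"
    using r0 by (simp add: powr_divide powr_diff[symmetric] field_simps flip: powr_add)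
  also have "\<dots> \<le> (1 + p) / 2 * r + (1 - p) / 2 * (1 / r)"
    using r0 p by (intro Youngs_inequality_0) (auto simp: field_simps)
  also have "1 / r = 1 - (r - 1) + (r - 1)\<^sup>2 / r"
    using r0 by (simp add: power2_eq_square field_simps)
  also have "(1 + p) / 2 * r + (1 - p) / 2 * (1 - (r - 1) + (r - 1)\<^sup>2 / r) = 1 + p * (r - 1) + (1 - p) / 2 * ((r - 1)\<^sup>2 / r)"
  proof -
    have "(1 + p) / 2 * r + (1 - p) / 2 * (1 - (r - 1) + q) = 1 + p * (r - 1) + (1 - p) / 2 * q" for q
      by (simp add: field_simps)
    then show ?thesis .
  qed
  also have "(1 - p) / 2 * ((r - 1)\<^sup>2 / r) \<le> 1 * (\<delta>\<^sup>2 / (1 - \<delta>))"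
  proof (intro mult_mono frac_le)
    have "\<bar>r - 1\<bar> \<le> \<bar>\<delta>\<bar>" using r d by auto
    then show "(r - 1)\<^sup>2 \<le> \<delta>\<^sup>2" by (simp only: abs_le_square_iff)
  qed (use p r d r0 in auto)
  finally show ?thesis by simp
qed

text \<open>On each half of the interval, energy times linear majorant is a polynomial. Up to the
  common factor \<delta> / 4 the slope contributes - p * \<delta> / 30 on the left and + p *
  \<delta> / 30 on the right, so only the constant term survives.\<close>

lemma nn_integral_jump_energy_powr:
  fixes \<delta> p :: real
  assumes d: "0 < \<delta>" "\<delta> < 1" and p: "-1 \<le> p" "p \<le> 1"
  shows "(\<integral>\<^sup>+r. ennreal (jump_energy \<delta> r * r powr p) * indicator {1-\<delta>..1+\<delta>} r \<partial>lborel)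
           \<le> ennreal (\<delta> / 10 * (1 + \<delta>\<^sup>2 / (1 - \<delta>)))"
proof -
  define c where "c = 1 + \<delta>\<^sup>2 / (1 - \<delta>)"
  have c: "c \<ge> 1" using d by (simp add: c_def)
  let ?l = "\<lambda>r. (1 + (r - 1) / \<delta>) ^ 4 / 4 * (c + p * (r - 1))"
  let ?r = "\<lambda>r. (1 - (r - 1) / \<delta>) ^ 4 / 4 * (c + p * (r - 1))"
  have lin: "c + p * (r - 1) \<ge> 0" if "\<bar>r - 1\<bar> \<le> \<delta>" for r
  proof -
    have "\<bar>p * (r - 1)\<bar> \<le> 1 * \<delta>"
      unfolding abs_mult using p that d by (intro mult_mono) auto
    then show ?thesis using c d by linarith
  qed
  have le: "ennreal (jump_energy \<delta> r * r powr p) * indicator {1-\<delta>..1+\<delta>} r \<le>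
       ennreal (?l r) * indicator {1-\<delta>..1} r + ennreal (?r r) * indicator {1..1+\<delta>} r" for r
  proof (cases "r \<in> {1-\<delta>..1+\<delta>}")
    case True
    have *: "jump_energy \<delta> r * r powr p \<le> jump_energy \<delta> r * (c + p * (r - 1))"
      using powr_le_linear[OF d p True] by (intro mult_left_mono jump_energy_nonneg) (simp add: c_def)
    show ?thesis
    proof (cases "r \<le> 1")
      case True
      with \<open>r \<in> {1-\<delta>..1+\<delta>}\<close> have "\<bar>r - 1\<bar> / \<delta> \<le> 1" using d by simp
      then have "jump_energy \<delta> r = (1 + (r - 1) / \<delta>) ^ 4 / 4"
      proof -
        have "\<bar>r - 1\<bar> = - (r - 1)" using True by simp
        then have "\<bar>r - 1\<bar> / \<delta> = - ((r - 1) / \<delta>)" by (simp only: minus_divide_left)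
        then show ?thesis
          using \<open>\<bar>r - 1\<bar> / \<delta> \<le> 1\<close> by (simp only: jump_energy_def) (simp add: max_def)
      qed
      then have "ennreal (jump_energy \<delta> r * r powr p) \<le> ennreal (?l r)"
        using * by (intro ennreal_leI) (simp only:)
      then have "ennreal (jump_energy \<delta> r * r powr p) * indicator {1-\<delta>..1+\<delta>} r \<le> ennreal (?l r) * indicator {1-\<delta>..1} r"
        using True \<open>r \<in> {1-\<delta>..1+\<delta>}\<close> by (auto simp: indicator_def)
      then show ?thesis by (rule order_trans) simp
    next
      case False
      with \<open>r \<in> {1-\<delta>..1+\<delta>}\<close> have "\<bar>r - 1\<bar> / \<delta> \<le> 1" using d by simp
      then have "jump_energy \<delta> r = (1 - (r - 1) / \<delta>) ^ 4 / 4"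
        using False by (simp add: jump_energy_def max_def abs_if)
      then have "ennreal (jump_energy \<delta> r * r powr p) \<le> ennreal (?r r)"
        using * by (intro ennreal_leI) (simp only:)
      then have "ennreal (jump_energy \<delta> r * r powr p) * indicator {1-\<delta>..1+\<delta>} r \<le> ennreal (?r r) * indicator {1..1+\<delta>} r"
        using False \<open>r \<in> {1-\<delta>..1+\<delta>}\<close> by (auto simp: indicator_def)
      then show ?thesis by (rule order_trans) simp
    qed
  qed simp
  \<comment> \<open>Antiderivatives written in the distance q from the outer end of the tent, scaled
    to [0, 1]: r - 1 is \<delta> * (q - 1) on the left and \<delta> * (1 - q) on the right.\<close>
  let ?Fl = "\<lambda>r. \<delta> / 4 * ((c - p * \<delta>) * (1 + (r - 1) / \<delta>) ^ 5 / 5 + p * \<delta> * (1 + (r - 1) / \<delta>) ^ 6 / 6)"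
  let ?Fr = "\<lambda>r. - (\<delta> / 4 * ((c + p * \<delta>) * (1 - (r - 1) / \<delta>) ^ 5 / 5 - p * \<delta> * (1 - (r - 1) / \<delta>) ^ 6 / 6))"
  have "(\<integral>\<^sup>+r. ennreal (jump_energy \<delta> r * r powr p) * indicator {1-\<delta>..1+\<delta>} r \<partial>lborel) \<le>
     (\<integral>\<^sup>+r. ennreal (?l r) * indicator {1-\<delta>..1} r + ennreal (?r r) * indicator {1..1+\<delta>} r \<partial>lborel)"
    by (intro nn_integral_mono le)
  also have "\<dots> = (\<integral>\<^sup>+r. ennreal (?l r) * indicator {1-\<delta>..1} r \<partial>lborel) + (\<integral>\<^sup>+r. ennreal (?r r) * indicator {1..1+\<delta>} r \<partial>lborel)"
    by (intro nn_integral_add) measurable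
  also have "(\<integral>\<^sup>+r. ennreal (?l r) * indicator {1-\<delta>..1} r \<partial>lborel) = ennreal (?Fl 1 - ?Fl (1 - \<delta>))"
  proof (rule nn_integral_FTC_Icc)
    fix r assume r: "r \<in> {1-\<delta>..1}"
    define q where "q = 1 + (r - 1) / \<delta>"
    have rq: "r - 1 = \<delta> * (q - 1)" using d by (simp add: q_def)
    have "(?Fl has_real_derivative \<delta> / 4 * ((c - p * \<delta>) * (5 * q ^ 4 * (1 / \<delta>)) / 5 + p * \<delta> * (6 * q ^ 5 * (1 / \<delta>)) / 6)) (at r)"
      unfolding q_def using d by (auto intro!: derivative_eq_intros)
    also have "\<delta> / 4 * ((c - p * \<delta>) * (5 * q ^ 4 * (1 / \<delta>)) / 5 + p * \<delta> * (6 * q ^ 5 * (1 / \<delta>)) / 6) = q ^ 4 / 4 * (c + p * (\<delta> * (q - 1)))"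
      using d by (simp add: field_simps eval_nat_numeral)
    also have "q ^ 4 / 4 * (c + p * (\<delta> * (q - 1))) = ?l r"
      unfolding rq[symmetric] by (simp only: q_def)
    finally show "(?Fl has_real_derivative ?l r) (at r)" .
    show "0 \<le> ?l r" using lin[of r] r by simp
  qed (use d in auto)
  also have "(\<integral>\<^sup>+r. ennreal (?r r) * indicator {1..1+\<delta>} r \<partial>lborel) = ennreal (?Fr (1 + \<delta>) - ?Fr 1)"
  proof (rule nn_integral_FTC_Icc)
    fix r assume r: "r \<in> {1..1+\<delta>}"
    define q where "q = 1 - (r - 1) / \<delta>"
    have rq: "r - 1 = \<delta> * (1 - q)" using d by (simp add: q_def)
    have "(?Fr has_real_derivative - (\<delta> / 4 * ((c + p * \<delta>) * (5 * q ^ 4 * - (1 / \<delta>)) / 5 - p * \<delta> * (6 * q ^ 5 * - (1 / \<delta>)) / 6))) (at r)"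
      unfolding q_def using d by (auto intro!: derivative_eq_intros)
    also have "- (\<delta> / 4 * ((c + p * \<delta>) * (5 * q ^ 4 * - (1 / \<delta>)) / 5 - p * \<delta> * (6 * q ^ 5 * - (1 / \<delta>)) / 6)) = q ^ 4 / 4 * (c + p * (\<delta> * (1 - q)))"
      using d by (simp add: field_simps eval_nat_numeral)
    also have "q ^ 4 / 4 * (c + p * (\<delta> * (1 - q))) = ?r r"
      unfolding rq[symmetric] by (simp only: q_def)
    finally show "(?Fr has_real_derivative ?r r) (at r)" .
    show "0 \<le> ?r r" using lin[of r] r by simp
  qed (use d in auto)
  also have "?Fl 1 - ?Fl (1 - \<delta>) = \<delta> / 4 * (c / 5 - p * \<delta> / 30)"
    using d by (simp add: field_simps)
  also have "?Fr (1 + \<delta>) - ?Fr 1 = \<delta> / 4 * (c / 5 + p * \<delta> / 30)"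
    using d by (simp add: field_simps)
  also have "ennreal (\<delta> / 4 * (c / 5 - p * \<delta> / 30)) + ennreal (\<delta> / 4 * (c / 5 + p * \<delta> / 30)) = ennreal (\<delta> / 10 * c)"
  proof (subst ennreal_plus[symmetric])
    have "\<bar>p * \<delta>\<bar> \<le> 1 * 1"
      unfolding abs_mult using p d by (intro mult_mono) auto
    then have "0 \<le> c / 5 - p * \<delta> / 30" "0 \<le> c / 5 + p * \<delta> / 30" using c by linarith+
    then show "0 \<le> \<delta> / 4 * (c / 5 - p * \<delta> / 30)" "0 \<le> \<delta> / 4 * (c / 5 + p * \<delta> / 30)"
      using d by (simp_all only: zero_le_mult_iff) simp_all
  qed (simp add: field_simps)
  finally show ?thesis by (simp only: c_def)
qed

text \<open>The substitution r = k / x turns x powr (-2\<sigma>) dx / x into k powr (-2\<sigma>) r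
  powr (2\<sigma> - 1) dr. All jumps thus share one integral, whose exponent 2\<sigma> - 1 lies in
  [-1, 1].\<close>

lemma nn_integral_jump_energy_exp:
  fixes \<delta> \<sigma> :: real and k :: nat
  assumes d: "0 < \<delta>" "\<delta> < 1" and sg: "0 \<le> \<sigma>" "\<sigma> \<le> 1" and k: "k \<ge> 1"
  shows "(\<integral>\<^sup>+u. ennreal (jump_energy \<delta> (real k / exp u) * exp (- (2 * \<sigma> * u))) \<partial>lborel)
           \<le> ennreal (real k powr (-2 * \<sigma>) * (\<delta> / 10 * (1 + \<delta>\<^sup>2 / (1 - \<delta>))))"
proof -
  have k0: "real k > 0" using k by simp
  have "(\<integral>\<^sup>+u. ennreal (jump_energy \<delta> (real k / exp u) * exp (- (2 * \<sigma> * u))) \<partial>lborel) =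
        (\<integral>\<^sup>+w. ennreal (jump_energy \<delta> (real k / exp (ln k + (-1) * w)) * exp (- (2 * \<sigma> * (ln k + (-1) * w)))) \<partial>lborel)"
    by (subst nn_integral_real_affine[of _ "-1" "ln k"]) simp_all
  also have "\<dots> = (\<integral>\<^sup>+w. ennreal (real k powr (-2 * \<sigma>)) * ennreal (jump_energy \<delta> (exp w) * exp (2 * \<sigma> * w)) \<partial>lborel)"
  proof (intro nn_integral_cong)
    fix w :: real
    have "real k / exp (ln k + (-1) * w) = exp w"
      using k0 by (simp add: exp_diff)
    moreover have "exp (- (2 * \<sigma> * (ln k + (-1) * w))) = real k powr (-2 * \<sigma>) * exp (2 * \<sigma> * w)"
      using k0 by (simp add: powr_def algebra_simps flip: exp_add)
    ultimately show "ennreal (jump_energy \<delta> (real k / exp (ln k + (-1) * w)) * exp (- (2 * \<sigma> * (ln k + (-1) * w)))) =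
       ennreal (real k powr (-2 * \<sigma>)) * ennreal (jump_energy \<delta> (exp w) * exp (2 * \<sigma> * w))"
      by (simp only: ennreal_mult'[symmetric] powr_ge_zero mult.left_commute)
  qed
  also have "\<dots> = ennreal (real k powr (-2 * \<sigma>)) * (\<integral>\<^sup>+w. ennreal (jump_energy \<delta> (exp w) * exp (2 * \<sigma> * w)) \<partial>lborel)"
    by (intro nn_integral_cmult) measurable
  finally have eq: "(\<integral>\<^sup>+u. ennreal (jump_energy \<delta> (real k / exp u) * exp (- (2 * \<sigma> * u))) \<partial>lborel) =
     ennreal (real k powr (-2 * \<sigma>)) * (\<integral>\<^sup>+w. ennreal (jump_energy \<delta> (exp w) * exp (2 * \<sigma> * w)) \<partial>lborel)" .
  have "(\<integral>\<^sup>+w. ennreal (jump_energy \<delta> (exp w) * exp (2 * \<sigma> * w)) \<partial>lborel) =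
    (\<integral>\<^sup>+w. ennreal (jump_energy \<delta> (exp w) * exp w powr (2 * \<sigma> - 1) * exp w * indicator {ln (1 - \<delta>)..ln (1 + \<delta>)} w) \<partial>lborel)"
  proof (intro nn_integral_cong arg_cong[of _ _ ennreal])
    fix w :: real
    have e: "exp (2 * \<sigma> * w) = exp w powr (2 * \<sigma> - 1) * exp w"
      by (simp add: powr_def algebra_simps flip: exp_add)
    show "jump_energy \<delta> (exp w) * exp (2 * \<sigma> * w) = jump_energy \<delta> (exp w) * exp w powr (2 * \<sigma> - 1) * exp w * indicator {ln (1 - \<delta>)..ln (1 + \<delta>)} w"
    proof (cases "w \<in> {ln (1 - \<delta>)..ln (1 + \<delta>)}")
      case False
      have "exp w \<notin> {1-\<delta>..1+\<delta>}"
      proof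
        assume "exp w \<in> {1-\<delta>..1+\<delta>}"
        then have "ln (1 - \<delta>) \<le> ln (exp w)" "ln (exp w) \<le> ln (1 + \<delta>)"
          using d by (auto simp del: ln_exp)
        with False show False by simp
      qed
      then show ?thesis by (simp add: jump_energy_outside[OF d(1)])
    next
      case True
      then show ?thesis
        unfolding e by (simp only: indicator_simps mult_1_right mult.assoc[of "jump_energy _ _"])
    qed
  qed
  also have "\<dots> = (\<integral>\<^sup>+r. ennreal (jump_energy \<delta> r * r powr (2 * \<sigma> - 1) * indicator {exp (ln (1 - \<delta>))..exp (ln (1 + \<delta>))} r) \<partial>lborel)"
    by (rule nn_integral_substitution[symmetric])
       (use d in \<open>auto intro!: derivative_eq_intros continuous_intros simp: set_borel_measurable_def\<close>)
  also have "\<dots> = (\<integral>\<^sup>+r. ennreal (jump_energy \<delta> r * r powr (2 * \<sigma> - 1)) * indicator {1-\<delta>..1+\<delta>} r \<partial>lborel)"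
    using d by (intro nn_integral_cong) (auto split: split_indicator)
  also have "\<dots> \<le> ennreal (\<delta> / 10 * (1 + \<delta>\<^sup>2 / (1 - \<delta>)))"
    using sg by (intro nn_integral_jump_energy_powr d) auto
  finally have "(\<integral>\<^sup>+w. ennreal (jump_energy \<delta> (exp w) * exp (2 * \<sigma> * w)) \<partial>lborel) \<le> ennreal (\<delta> / 10 * (1 + \<delta>\<^sup>2 / (1 - \<delta>)))" .
  then show ?thesis
    unfolding eq ennreal_mult'[OF powr_ge_zero] by (rule mult_left_mono) simp
qed

lemma borel_measurable_tent_defect [measurable]: "tent_defect \<delta> \<in> borel_measurable borel"
  unfolding tent_defect_def[abs_def] set_lebesgue_integral_def by measurable

text \<open>Below x = 1 / \<delta> the jump energies bound the square; beyond it the bound 1/2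
  leaves an exponential tail. \<open>N\<close> has to reach the right neighbour of every x < 1 /
  \<delta>, hence the extra 1 in the hypothesis.\<close>

lemma nn_integral_tent_defect_exp_le:
  fixes \<delta> \<sigma> :: real and N :: nat
  assumes d: "0 < \<delta>" "\<delta> < 1" and sg: "0 < \<sigma>" "\<sigma> \<le> 1" and N: "of_int \<lfloor>1 / \<delta>\<rfloor> + 1 \<le> real N"
  shows "(\<integral>\<^sup>+u. ennreal ((tent_defect_exp \<delta> \<sigma> u)\<^sup>2) \<partial>lborel) \<le>
           ennreal ((\<Sum>k=1..N. real k powr (-2 * \<sigma>)) * (\<delta> / 10 * (1 + \<delta>\<^sup>2 / (1 - \<delta>)))
                      + (1 / \<delta>) powr (-2 * \<sigma>) / (8 * \<sigma>))"
proof -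
  define E where "E = \<delta> / 10 * (1 + \<delta>\<^sup>2 / (1 - \<delta>))"
  have E: "E \<ge> 0" using d by (simp add: E_def)
  let ?J = "\<lambda>k u. ennreal (jump_energy \<delta> (real k / exp u) * exp (- (2 * \<sigma> * u)))"
  let ?T = "\<lambda>u. ennreal (1 / 4) * (ennreal (exp (- (2 * \<sigma> * u))) * indicator {ln (1 / \<delta>)..} u)"
  have sq: "(tent_defect_exp \<delta> \<sigma> u)\<^sup>2 = (tent_defect \<delta> (exp u))\<^sup>2 * exp (- (2 * \<sigma> * u))" for u
    by (simp add: tent_defect_exp_def power_mult_distrib flip: exp_double)
  have "(\<integral>\<^sup>+u. ennreal ((tent_defect_exp \<delta> \<sigma> u)\<^sup>2) \<partial>lborel) \<le> (\<integral>\<^sup>+u. (\<Sum>k=1..N. ?J k u) + ?T u \<partial>lborel)"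
  proof (intro nn_integral_mono)
    fix u :: real
    show "ennreal ((tent_defect_exp \<delta> \<sigma> u)\<^sup>2) \<le> (\<Sum>k=1..N. ?J k u) + ?T u"
    proof (cases "u < ln (1 / \<delta>)")
      case True
      then have "exp u < exp (ln (1 / \<delta>))" by (simp only: exp_less_cancel_iff)
      then have x: "exp u < 1 / \<delta>" using d by simp
      then have "\<lfloor>exp u\<rfloor> \<le> \<lfloor>1 / \<delta>\<rfloor>" by (intro floor_mono) simp
      then have N': "of_int \<lfloor>exp u\<rfloor> + 1 \<le> real N" using N by linarith
      have "\<delta> * exp u \<le> 1" using x d by (simp add: field_simps)
      then have "(tent_defect \<delta> (exp u))\<^sup>2 \<le> (\<Sum>k=1..N. jump_energy \<delta> (real k / exp u))"
        using d N' by (intro tent_defect_sq_le_sum) auto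
      then have "(tent_defect_exp \<delta> \<sigma> u)\<^sup>2 \<le> (\<Sum>k=1..N. jump_energy \<delta> (real k / exp u) * exp (- (2 * \<sigma> * u)))"
        unfolding sq sum_distrib_right[symmetric] by (intro mult_right_mono) auto
      then have "ennreal ((tent_defect_exp \<delta> \<sigma> u)\<^sup>2) \<le> (\<Sum>k=1..N. ?J k u)"
        by (subst sum_ennreal) (auto simp: jump_energy_nonneg intro: ennreal_leI)
      then show ?thesis by (rule order_trans) simp
    next
      case False
      have "\<bar>tent_defect \<delta> (exp u)\<bar> \<le> \<bar>1 / 2\<bar>"
        using abs_tent_defect_le[of \<delta> "exp u"] by simp
      then have "(tent_defect \<delta> (exp u))\<^sup>2 \<le> (1 / 2)\<^sup>2"
        by (simp only: abs_le_square_iff)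
      then have "(tent_defect_exp \<delta> \<sigma> u)\<^sup>2 \<le> 1 / 4 * exp (- (2 * \<sigma> * u))"
        unfolding sq by (intro mult_right_mono) (auto simp: power2_eq_square)
      then have "ennreal ((tent_defect_exp \<delta> \<sigma> u)\<^sup>2) \<le> ennreal (1 / 4 * exp (- (2 * \<sigma> * u)))"
        by (rule ennreal_leI)
      also have "\<dots> = ?T u"
        using False by (subst ennreal_mult) auto
      finally show ?thesis by (rule order_trans) simp
    qed
  qed
  also have "\<dots> = (\<Sum>k=1..N. \<integral>\<^sup>+u. ?J k u \<partial>lborel) + (\<integral>\<^sup>+u. ?T u \<partial>lborel)"
    by (subst nn_integral_add) (auto simp: nn_integral_sum)
  also have "(\<integral>\<^sup>+u. ?T u \<partial>lborel) = ennreal (1 / 4) * ennreal (exp (- (2 * \<sigma> * ln (1 / \<delta>))) / (2 * \<sigma>))"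
    using nn_integral_exp_tail[of "2 * \<sigma>" "ln (1 / \<delta>)"] sg by (subst nn_integral_cmult) auto
  also have "\<dots> = ennreal ((1 / \<delta>) powr (-2 * \<sigma>) / (8 * \<sigma>))"
    using d sg by (simp add: powr_def flip: ennreal_mult)
  also have "(\<Sum>k=1..N. \<integral>\<^sup>+u. ?J k u \<partial>lborel) \<le> (\<Sum>k=1..N. ennreal (real k powr (-2 * \<sigma>) * E))"
    unfolding E_def using d sg by (intro sum_mono nn_integral_jump_energy_exp) auto
  also have "(\<Sum>k=1..N. ennreal (real k powr (-2 * \<sigma>) * E)) = ennreal ((\<Sum>k=1..N. real k powr (-2 * \<sigma>)) * E)"
    using E by (subst sum_ennreal) (auto simp: sum_distrib_right)
  also have "\<dots> + ennreal ((1 / \<delta>) powr (-2 * \<sigma>) / (8 * \<sigma>)) =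
      ennreal ((\<Sum>k=1..N. real k powr (-2 * \<sigma>)) * E + (1 / \<delta>) powr (-2 * \<sigma>) / (8 * \<sigma>))"
    using E sg by (intro ennreal_plus[symmetric]) (auto intro!: mult_nonneg_nonneg sum_nonneg)
  finally show ?thesis
    unfolding E_def by (simp add: add_right_mono)
qed

section \<open>Bounds for the tail integral\<close>

text \<open>
  The constants bound \<open>1.00065 / (2 * 0.9215\<^sup>2)\<close> and \<open>1 / (8 * 0.9215\<^sup>2)\<close>; the factor 1.00065 absorbs
  \<open>1 + \<delta>\<^sup>2 / (1 - \<delta>)\<close> for \<open>\<delta> \<le> 1/40\<close>.
\<close>

definition Q_bound :: "real \<Rightarrow> nat \<Rightarrow> real \<Rightarrow> real" where
  "Q_bound T N \<sigma> = 0.59 / T * (\<Sum>k=1..N. real k powr (-2 * \<sigma>)) + 0.1475 / \<sigma> * (T / 5) powr (-2 * \<sigma>)"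

text \<open>For \<sigma> = 1 the integrand meets the pole at t = 0. Continuity is therefore used
  only for t \<noteq> 0, and the value at 0 is put back by an indicator.\<close>

lemma borel_measurable_Q_integrand [measurable]: "Q_integrand \<sigma> \<in> borel_measurable borel"
proof -
  have C: "continuous_on (- {0}) (Complex \<sigma>)"
    unfolding continuous_on_def by (intro ballI tendsto_intros)
  have "continuous_on (Complex \<sigma> ` (- {0})) zeta"
  proof (rule holomorphic_on_imp_continuous_on, rule holomorphic_on_subset)
    show "zeta holomorphic_on - {1}" using is_zeta_zeta by (simp add: is_zeta_def)
  qed (auto simp: complex_eq_iff)
  then have "continuous_on (- {0}) (\<lambda>t. zeta (Complex \<sigma> t))"
    using continuous_on_compose[OF C, of zeta] by (simp add: o_def)
  then have "continuous_on (- {0}) (\<lambda>t. Q_integrand \<sigma> t)"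
    unfolding Q_integrand_def using C
    by (intro continuous_on_power continuous_on_norm continuous_on_divide) (auto simp: complex_eq_iff)
  from borel_measurable_continuous_on_indicator[OF _ this]
  have "(\<lambda>t. indicator (- {0}) t *\<^sub>R Q_integrand \<sigma> t) \<in> borel_measurable borel" by simp
  then have "(\<lambda>t. indicator (- {0}) t *\<^sub>R Q_integrand \<sigma> t + indicator {0} t *\<^sub>R Q_integrand \<sigma> 0) \<in> borel_measurable borel"
    by measurable
  also have "(\<lambda>t. indicator (- {0}) t *\<^sub>R Q_integrand \<sigma> t + indicator {0} t *\<^sub>R Q_integrand \<sigma> 0) = Q_integrand \<sigma>"
    by (auto simp: fun_eq_iff indicator_def)
  finally show ?thesis .
qed

lemma Q_integrand_nonneg: "Q_integrand \<sigma> t \<ge> 0"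
  by (simp add: Q_integrand_def)

lemma nn_integral_Q_integrand_lt_1:
  fixes \<sigma> T :: real and N :: nat
  assumes T: "T \<ge> 200" and sg: "0 < \<sigma>" "\<sigma> < 1" and N: "of_int \<lfloor>T / 5\<rfloor> + 1 \<le> real N"
  shows "(\<integral>\<^sup>+t. ennreal (indicator {t. \<bar>t\<bar> \<ge> T} t * Q_integrand \<sigma> t) \<partial>lborel) \<le> ennreal (2 * pi * Q_bound T N \<sigma>)"
proof -
  define \<delta> where "\<delta> = 5 / T"
  have d: "0 < \<delta>" "\<delta> \<le> 1/40" "\<delta> < 1" "\<bar>\<delta>\<bar> < 1" and inv: "1 / \<delta> = T / 5"
    using T by (auto simp: \<delta>_def field_simps)
  let ?h = "tent_defect_exp \<delta> \<sigma>"
  define e where "e = (\<Sum>k=1..N. real k powr (-2 * \<sigma>)) * (\<delta> / 10 * (1 + \<delta>\<^sup>2 / (1 - \<delta>))) + (1 / \<delta>) powr (-2 * \<sigma>) / (8 * \<sigma>)"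
  have h: "integrable lborel ?h"
    by (rule fourier_tent_defect_exp(1)[OF d(4) sg])
  have "(\<integral>\<^sup>+u. ennreal ((?h u)\<^sup>2) \<partial>lborel) \<le> ennreal e"
    unfolding e_def by (rule nn_integral_tent_defect_exp_le[OF d(1,3) sg(1) less_imp_le[OF sg(2)]]) (simp only: inv N)
  then have pl: "(\<integral>\<^sup>+t. ennreal ((cmod (fourier ?h t))\<^sup>2) \<partial>lborel) \<le> ennreal (2 * pi * e)"
    by (rule plancherel_le[OF h])
  have [measurable]: "?h \<in> borel_measurable borel" using h by auto
  have "(\<integral>\<^sup>+t. ennreal (indicator {t. \<bar>t\<bar> \<ge> T} t * Q_integrand \<sigma> t) \<partial>lborel) \<le>
        (\<integral>\<^sup>+t. ennreal (1 / 0.9215\<^sup>2) * ennreal ((cmod (fourier ?h t))\<^sup>2) \<partial>lborel)"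
  proof (intro nn_integral_mono)
    fix t :: real
    have "indicator {t. \<bar>t\<bar> \<ge> T} t * Q_integrand \<sigma> t \<le> (1 / 0.9215\<^sup>2) * (cmod (fourier ?h t))\<^sup>2"
    proof (cases "\<bar>t\<bar> \<ge> T")
      case True
      then have "\<bar>t\<bar> * \<delta> \<ge> 5" using T by (simp add: \<delta>_def field_simps)
      from Q_integrand_le[OF d(1,2) sg this] show ?thesis
        using True by (simp add: power_divide)
    qed simp
    then show "ennreal (indicator {t. \<bar>t\<bar> \<ge> T} t * Q_integrand \<sigma> t) \<le> ennreal (1 / 0.9215\<^sup>2) * ennreal ((cmod (fourier ?h t))\<^sup>2)"
      by (subst ennreal_mult[symmetric]) (auto intro: ennreal_leI)
  qed
  also have "\<dots> = ennreal (1 / 0.9215\<^sup>2) * (\<integral>\<^sup>+t. ennreal ((cmod (fourier ?h t))\<^sup>2) \<partial>lborel)"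
    by (intro nn_integral_cmult) measurable
  also have "\<dots> \<le> ennreal (1 / 0.9215\<^sup>2) * ennreal (2 * pi * e)"
    by (intro mult_left_mono pl) simp
  also have "\<dots> = ennreal (1 / 0.9215\<^sup>2 * (2 * pi * e))"
    by (rule ennreal_mult'[symmetric]) simp
  also have "\<dots> \<le> ennreal (2 * pi * Q_bound T N \<sigma>)"
  proof (rule ennreal_leI)
    have S: "(\<Sum>k=1..N. real k powr (-2 * \<sigma>)) \<ge> 0" by (intro sum_nonneg) auto
    have "1 + \<delta>\<^sup>2 / (1 - \<delta>) \<le> 1.00065"
    proof -
      have "\<delta>\<^sup>2 / (1 - \<delta>) \<le> (1/40)\<^sup>2 / (1 - 1/40)"
        using d by (intro frac_le power_mono) auto
      then show ?thesis by (simp add: power2_eq_square)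
    qed
    then have "\<delta> / 10 * (1 + \<delta>\<^sup>2 / (1 - \<delta>)) \<le> \<delta> / 10 * 1.00065"
      using d by (intro mult_left_mono) auto
    then have "1 / 0.9215\<^sup>2 * (\<delta> / 10 * (1 + \<delta>\<^sup>2 / (1 - \<delta>))) \<le> 1 / 0.9215\<^sup>2 * (\<delta> / 10 * 1.00065)"
      by (rule mult_left_mono) simp
    also have "\<dots> = (1 / 0.9215\<^sup>2 * 0.500325) / T"
      by (simp add: \<delta>_def)
    also have "\<dots> \<le> 0.59 / T"
      using T by (intro divide_right_mono) (auto simp: power2_eq_square)
    finally have 1: "1 / 0.9215\<^sup>2 * (\<delta> / 10 * (1 + \<delta>\<^sup>2 / (1 - \<delta>))) \<le> 0.59 / T" .
    have 2: "1 / 0.9215\<^sup>2 * ((T / 5) powr (-2 * \<sigma>) / (8 * \<sigma>)) \<le> 0.1475 / \<sigma> * (T / 5) powr (-2 * \<sigma>)"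
    proof -
      have "1 / 0.9215\<^sup>2 / 8 * ((T / 5) powr (-2 * \<sigma>) / \<sigma>) \<le> 0.1475 * ((T / 5) powr (-2 * \<sigma>) / \<sigma>)"
        using sg by (intro mult_right_mono) (auto simp: power2_eq_square)
      then show ?thesis by simp
    qed
    have "1 / 0.9215\<^sup>2 * e = (\<Sum>k=1..N. real k powr (-2 * \<sigma>)) * (1 / 0.9215\<^sup>2 * (\<delta> / 10 * (1 + \<delta>\<^sup>2 / (1 - \<delta>))))
        + 1 / 0.9215\<^sup>2 * ((T / 5) powr (-2 * \<sigma>) / (8 * \<sigma>))"
      unfolding e_def inv by (simp only: distrib_left mult.left_commute)
    also have "\<dots> \<le> (\<Sum>k=1..N. real k powr (-2 * \<sigma>)) * (0.59 / T) + 0.1475 / \<sigma> * (T / 5) powr (-2 * \<sigma>)"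
      by (intro add_mono mult_left_mono 1 2 S)
    also have "\<dots> = Q_bound T N \<sigma>"
      by (simp only: Q_bound_def mult.commute)
    finally have "1 / 0.9215\<^sup>2 * e \<le> Q_bound T N \<sigma>" .
    then have "2 * pi * (1 / 0.9215\<^sup>2 * e) \<le> 2 * pi * Q_bound T N \<sigma>"
      by (intro mult_left_mono) auto
    then show "1 / 0.9215\<^sup>2 * (2 * pi * e) \<le> 2 * pi * Q_bound T N \<sigma>"
      by (simp only: mult_ac)
  qed
  finally show ?thesis .
qed

text \<open>The exponents \<open>r n\<close> stay below 1 and tend to \<sigma>, so the previous
  bound holds along them. Integrand and \<open>Q_bound\<close> are both continuous in \<sigma>, the
  former because |t| \<ge> T keeps away from the pole.\<close>

lemma nn_integral_Q_integrand_le: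
  fixes \<sigma> T :: real and N :: nat
  assumes T: "T \<ge> 200" and sg: "0 < \<sigma>" "\<sigma> \<le> 1" and N: "of_int \<lfloor>T / 5\<rfloor> + 1 \<le> real N"
  shows "(\<integral>\<^sup>+t. ennreal (indicator {t. \<bar>t\<bar> \<ge> T} t * Q_integrand \<sigma> t) \<partial>lborel) \<le> ennreal (2 * pi * Q_bound T N \<sigma>)"
proof -
  define r where "r n = \<sigma> * (1 - 1 / real (n + 2))" for n
  have r: "0 < r n" "r n < 1" for n
  proof -
    have q: "0 < 1 - 1 / real (n + 2)" "1 - 1 / real (n + 2) < 1" by simp_all
    show "0 < r n" unfolding r_def using q sg by (intro mult_pos_pos)
    have "r n \<le> 1 * (1 - 1 / real (n + 2))"
      unfolding r_def using q sg by (intro mult_right_mono) auto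
    also have "\<dots> < 1" using q(2) by simp
    finally show "r n < 1" .
  qed
  have lim: "r \<longlonglongrightarrow> \<sigma>"
    unfolding r_def[abs_def] by real_asymp
  show ?thesis
  proof (rule nn_integral_le_limit[where f = "\<lambda>n t. indicator {t. \<bar>t\<bar> \<ge> T} t * Q_integrand (r n) t"])
    fix t :: real
    show "(\<lambda>n. indicator {t. \<bar>t\<bar> \<ge> T} t * Q_integrand (r n) t) \<longlonglongrightarrow> indicator {t. \<bar>t\<bar> \<ge> T} t * Q_integrand \<sigma> t"
    proof (cases "\<bar>t\<bar> \<ge> T")
      case True
      then have ne: "Complex \<sigma> t \<noteq> 1" "Complex \<sigma> t \<noteq> 0" using T by (auto simp: complex_eq_iff)
      have 1: "(\<lambda>n. Complex (r n) t) \<longlonglongrightarrow> Complex \<sigma> t"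
        by (intro tendsto_intros lim)
      have "interior (- {1 :: complex}) = - {1}"
        by (intro interior_open open_Compl closed_singleton)
      then have "isCont zeta (Complex \<sigma> t)"
        using is_zeta_zeta ne by (intro continuous_on_interior[of "- {1}"] holomorphic_on_imp_continuous_on)
          (auto simp: is_zeta_def)
      then have "(\<lambda>n. zeta (Complex (r n) t)) \<longlonglongrightarrow> zeta (Complex \<sigma> t)"
        using 1 by (rule isCont_tendsto_compose)
      then show ?thesis
        unfolding Q_integrand_def by (intro tendsto_intros 1 ne)
    qed simp
  next
    show "(\<lambda>n. 2 * pi * Q_bound T N (r n)) \<longlonglongrightarrow> 2 * pi * Q_bound T N \<sigma>"
      unfolding Q_bound_def using T sg
      by (intro tendsto_intros lim) auto
  qed (use nn_integral_Q_integrand_lt_1[OF T r N] in auto)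
qed

text \<open>A finite integral of a non-negative function yields integrability on both half-lines, so
  \<open>Q\<close> is a genuine integral rather than the default 0. The factor 2 * pi cancels
  against the normalisation of \<open>Q\<close>.\<close>

lemma Q_le_Q_bound:
  fixes \<sigma> T :: real and N :: nat
  assumes T: "T \<ge> 200" and sg: "0 < \<sigma>" "\<sigma> \<le> 1" and N: "of_int \<lfloor>T / 5\<rfloor> + 1 \<le> real N"
  shows "Q_converges \<sigma> T" and "Q \<sigma> T \<le> Q_bound T N \<sigma>"
proof -
  let ?g = "\<lambda>t. indicator {t. \<bar>t\<bar> \<ge> T} t * Q_integrand \<sigma> t"
  have le: "(\<integral>\<^sup>+t. ennreal (?g t) \<partial>lborel) \<le> ennreal (2 * pi * Q_bound T N \<sigma>)"
    by (rule nn_integral_Q_integrand_le[OF assms])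
  have int: "integrable lborel ?g"
    by (rule integrableI_nonneg) (use le in \<open>auto simp: Q_integrand_nonneg intro: le_less_trans\<close>)
  have si: "set_integrable lborel A (Q_integrand \<sigma>)" if "A \<in> sets borel" "A \<subseteq> {t. \<bar>t\<bar> \<ge> T}" for A
  proof -
    have "integrable lborel (\<lambda>t. indicator A t *\<^sub>R ?g t)"
      using that int by (intro integrable_mult_indicator) auto
    also have "(\<lambda>t. indicator A t *\<^sub>R ?g t) = (\<lambda>t. indicator A t *\<^sub>R Q_integrand \<sigma> t)"
      using that by (auto simp: fun_eq_iff indicator_def)
    finally show ?thesis by (simp add: set_integrable_def)
  qed
  have A: "{..-T} \<subseteq> {t. \<bar>t\<bar> \<ge> T}" "{T..} \<subseteq> {t. \<bar>t\<bar> \<ge> T}"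
    using T by auto
  show "Q_converges \<sigma> T"
    unfolding Q_converges_def by (intro conjI si A) auto
  have "(LBINT t:{..-T}. Q_integrand \<sigma> t) + (LBINT t:{T..}. Q_integrand \<sigma> t) = (LBINT t:{..-T} \<union> {T..}. Q_integrand \<sigma> t)"
    using T by (intro set_integral_Un[symmetric] si A) auto
  also have "{..-T} \<union> {T..} = {t. \<bar>t\<bar> \<ge> T}"
    using T by auto
  also have "(LBINT t:{t. \<bar>t\<bar> \<ge> T}. Q_integrand \<sigma> t) = (\<integral>t. ?g t \<partial>lborel)"
    by (simp add: set_lebesgue_integral_def)
  also have "\<dots> \<le> 2 * pi * Q_bound T N \<sigma>"
  proof -
    have "Q_bound T N \<sigma> \<ge> 0"
      unfolding Q_bound_def using T sg by (intro add_nonneg_nonneg mult_nonneg_nonneg sum_nonneg) auto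
    moreover have "ennreal (\<integral>t. ?g t \<partial>lborel) \<le> ennreal (2 * pi * Q_bound T N \<sigma>)"
      using le int by (subst nn_integral_eq_integral[symmetric]) (auto simp: Q_integrand_nonneg)
    ultimately show ?thesis by (subst (asm) ennreal_le_iff) auto
  qed
  finally show "Q \<sigma> T \<le> Q_bound T N \<sigma>"
    unfolding Q_def by (simp add: field_simps)
qed

section \<open>Comparison with the stated constants\<close>

lemma kappa_powr_bounds:
  assumes "0 \<le> \<sigma>" "\<sigma> \<le> 1"
  shows "25 powr \<sigma> * (1 + 0.1 * \<sigma>) \<le> kappa powr \<sigma>" and "25 powr \<sigma> \<le> kappa powr \<sigma>" and "kappa powr \<sigma> \<le> 1.2 * 25 powr \<sigma>"
proof -
  \<comment> \<open>27.8821 = 25 * 1.115284, and the logarithm of the second factor exceeds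
    0.1.\<close>
  have eq: "kappa powr \<sigma> = 25 powr \<sigma> * (1.115284 :: real) powr \<sigma>"
    by (simp add: kappa_def flip: powr_mult)
  have "0.1 \<le> ln (1 + 0.115284 :: real)"
    by (rule order_trans[OF _ ln_one_plus_ge]) (simp_all add: power2_eq_square)
  then have "0.1 * \<sigma> \<le> \<sigma> * ln 1.115284"
    using assms mult_left_mono[of "0.1" "ln (1.115284::real)" \<sigma>] by simp
  then have "1 + 0.1 * \<sigma> \<le> 1 + \<sigma> * ln 1.115284" by simp
  also have "\<dots> \<le> exp (\<sigma> * ln 1.115284)" by (rule exp_ge_add_one_self)
  also have "\<dots> = 1.115284 powr \<sigma>" by (simp add: powr_def)
  finally have "1 + 0.1 * \<sigma> \<le> 1.115284 powr \<sigma>" .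
  then show *: "25 powr \<sigma> * (1 + 0.1 * \<sigma>) \<le> kappa powr \<sigma>"
    unfolding eq by (rule mult_left_mono) simp
  have "25 powr \<sigma> * 1 \<le> 25 powr \<sigma> * (1 + 0.1 * \<sigma>)"
    using assms by (intro mult_left_mono) auto
  with * show "25 powr \<sigma> \<le> kappa powr \<sigma>" by (simp only: mult_1_right)
  have "(1.115284 :: real) powr \<sigma> \<le> 1.115284 powr 1"
    using assms by (intro powr_mono) auto
  also have "\<dots> \<le> 1.2" by simp
  finally have "25 powr \<sigma> * 1.115284 powr \<sigma> \<le> 25 powr \<sigma> * (1.2 :: real)"
    by (rule mult_left_mono) simp
  then show "kappa powr \<sigma> \<le> 1.2 * 25 powr \<sigma>"
    unfolding eq by (simp only: mult.commute)
qed

text \<open>The excess of the partial sum over \<zeta>(2\<sigma>) is about (T / 5) powr (1 -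
  2\<sigma>) / (1 - 2\<sigma>); times 0.59 / T it gives the coefficient 0.118 = 0.59 / 5. The error
  2 * (T / 5) powr (-2\<sigma>) gives 1.18 / T \<le> 0.0059, by T \<ge> 200.\<close>

lemma Q_bound_le_zeta:
  fixes \<sigma> T :: real and N :: nat
  assumes T: "T \<ge> 200" and sg: "0 < \<sigma>" "\<sigma> \<le> 1" "\<sigma> \<noteq> 1 / 2"
    and N: "T / 5 \<le> real N" "real N \<le> T / 5 + 1"
  shows "Q_bound T N \<sigma> \<le> 0.59 * real_zeta (2 * \<sigma>) / T +
           25 powr \<sigma> * T powr (-2 * \<sigma>) * (0.118 / (1 - 2 * \<sigma>) + 0.0059 + 0.1475 / \<sigma>)"
proof -
  let ?X = "T / 5" and ?P = "T powr (-2 * \<sigma>)"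
  define A where "A = 25 powr \<sigma> * ?P"
  have "(5::real) powr (2 * \<sigma>) = (5 powr 2) powr \<sigma>"
    by (simp only: powr_powr)
  then have 25: "(5::real) powr (2 * \<sigma>) = 25 powr \<sigma>" by simp
  have X: "?X powr (-(2 * \<sigma>)) = A"
  proof -
    have "?X powr (-(2 * \<sigma>)) = T powr (-(2 * \<sigma>)) / 5 powr (-(2 * \<sigma>))"
      by (rule powr_divide)
    also have "(5::real) powr (-(2 * \<sigma>)) = inverse (25 powr \<sigma>)"
      by (simp only: powr_minus 25)
    also have "T powr (-(2 * \<sigma>)) / inverse (25 powr \<sigma>) = A"
      by (simp add: A_def divide_inverse)
    finally show ?thesis .
  qed
  have X1: "?X powr (1 - 2 * \<sigma>) = ?X * A"
  proof -
    have "?X powr (1 + -(2 * \<sigma>)) = ?X powr 1 * ?X powr (-(2 * \<sigma>))" by (rule powr_add)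
    moreover have "1 + -(2 * \<sigma>) = 1 - 2 * \<sigma>" by simp
    moreover have "?X powr 1 = ?X" using T by simp
    ultimately show ?thesis by (simp only: X)
  qed
  have A: "A \<ge> 0" by (simp add: A_def)
  have N1: "N \<ge> 1" using N T by simp
  have "(\<Sum>k=1..N. real k powr (-(2 * \<sigma>))) \<le> real_zeta (2 * \<sigma>) + ?X powr (1 - 2 * \<sigma>) / (1 - 2 * \<sigma>) + 2 * ?X powr (-(2 * \<sigma>))"
    using sg T N by (intro sum_powr_le_zeta_real N1) auto
  then have "(\<Sum>k=1..N. real k powr (-2 * \<sigma>)) \<le> real_zeta (2 * \<sigma>) + ?X * A / (1 - 2 * \<sigma>) + 2 * A"
    unfolding X X1 by simp
  then have "Q_bound T N \<sigma> \<le> 0.59 / T * (real_zeta (2 * \<sigma>) + ?X * A / (1 - 2 * \<sigma>) + 2 * A) + 0.1475 / \<sigma> * A"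
    unfolding Q_bound_def using X T sg by (intro add_mono mult_left_mono) auto
  also have "\<dots> = 0.59 * real_zeta (2 * \<sigma>) / T + A * (0.118 / (1 - 2 * \<sigma>) + 1.18 / T + 0.1475 / \<sigma>)"
  proof -
    define q r where "q = A / (1 - 2 * \<sigma>)" and "r = A / \<sigma>"
    have e1: "?X * A / (1 - 2 * \<sigma>) = T / 5 * q" and e2: "0.1475 / \<sigma> * A = 0.1475 * r"
      by (simp_all add: q_def r_def)
    have e3: "A * (0.118 / (1 - 2 * \<sigma>) + 1.18 / T + 0.1475 / \<sigma>) = q * 0.118 + A * (1.18 / T) + r * 0.1475"
      by (simp add: q_def r_def distrib_left)
    have "0.59 / T * (z + T / 5 * q + 2 * A) + 0.1475 * r = 0.59 * z / T + (q * 0.118 + A * (1.18 / T) + r * 0.1475)" for z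
      using T by (simp add: field_simps)
    then show ?thesis by (simp only: e1 e2 e3)
  qed
  also have "\<dots> \<le> 0.59 * real_zeta (2 * \<sigma>) / T + A * (0.118 / (1 - 2 * \<sigma>) + 0.0059 + 0.1475 / \<sigma>)"
  proof -
    have "1.18 / T \<le> 0.0059" using T by (simp add: field_simps)
    then show ?thesis using A by (intro add_left_mono mult_left_mono) auto
  qed
  finally show ?thesis by (simp only: A_def)
qed

text \<open>Now 1 / (1 - 2\<sigma>) is negative, so its coefficient 0.118 * 25 powr \<sigma> must be
  at least \<open>c114\<close>. The upper bound 1.2 for the ratio of
  \<open>kappa powr \<sigma>\<close> to 25 powr \<sigma> ensures this, as 1.2 * 0.07407 < 0.118.
  Strictness comes from 0.59 < 3/5 and \<zeta>(2\<sigma>) > 0.\<close>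

lemma Q_bound_gt_half:
  fixes \<sigma> T :: real and N :: nat
  assumes T: "T \<ge> 200" and sg: "1 / 2 < \<sigma>" "\<sigma> \<le> 1"
    and N: "T / 5 \<le> real N" "real N \<le> T / 5 + 1"
  shows "Q_bound T N \<sigma> < 3 * real_zeta (2 * \<sigma>) / 5 * (1 / T)
         + (c111 \<sigma> / \<sigma> + c112 \<sigma> / (2 * \<sigma> + 1) + c113 \<sigma> / (\<sigma> + 1) - c114 \<sigma> / (2 * \<sigma> - 1))
             * (1 / T powr (2 * \<sigma>))
         + c12s \<sigma> * (1 / T powr (2 * \<sigma> + 1))"
proof -
  define a k P where "a = 25 powr \<sigma>" and "k = kappa powr \<sigma>" and "P = T powr (-2 * \<sigma>)"
  have P: "P > 0" "1 / T powr (2 * \<sigma>) = P"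
    using T by (simp_all add: P_def powr_minus_divide)
  have ak: "a > 0" "a \<le> k" "k \<le> 1.2 * a"
    using kappa_powr_bounds(2,3)[of \<sigma>] sg unfolding a_def k_def by simp_all
  have z: "real_zeta (2 * \<sigma>) > 0" using sg by (intro real_zeta_pos) auto
  have 1: "Q_bound T N \<sigma> \<le> 0.59 * real_zeta (2 * \<sigma>) / T + a * P * (0.118 / (1 - 2 * \<sigma>) + 0.0059 + 0.1475 / \<sigma>)"
    unfolding a_def P_def using sg by (intro Q_bound_le_zeta T N) auto
  have 2: "a * P * (0.118 / (1 - 2 * \<sigma>) + 0.0059 + 0.1475 / \<sigma>) = (a * 0.118 / (1 - 2 * \<sigma>) + a * 0.0059 + a * 0.1475 / \<sigma>) * P"
    by (simp add: algebra_simps)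
  have 3: "(a * 0.118 / (1 - 2 * \<sigma>) + a * 0.0059 + a * 0.1475 / \<sigma>) * P \<le> (c111 \<sigma> / \<sigma> + c112 \<sigma> / (2 * \<sigma> + 1) + c113 \<sigma> / (\<sigma> + 1) - c114 \<sigma> / (2 * \<sigma> - 1)) * P"
  proof (rule mult_right_mono)
    have "a * 0.1475 / \<sigma> \<le> c111 \<sigma> / \<sigma>"
      using sg ak by (intro divide_right_mono) (auto simp: c111_def kappa111_def simp flip: k_def)
    moreover have "a * 0.0059 \<le> c112 \<sigma> / (2 * \<sigma> + 1)"
    proof -
      have "a * 0.0059 \<le> k * 0.15655 / 3" using ak by simp
      also have "\<dots> \<le> k * 0.15655 / (2 * \<sigma> + 1)"
        using sg ak by (intro divide_left_mono) auto
      finally show ?thesis by (simp add: c112_def kappa112_def flip: k_def)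
    qed
    moreover have "0 \<le> c113 \<sigma> / (\<sigma> + 1)"
      using sg by (simp add: c113_def kappa113_def)
    moreover have "a * 0.118 / (1 - 2 * \<sigma>) \<le> - (c114 \<sigma> / (2 * \<sigma> - 1))"
    proof -
      have "- c114 \<sigma> \<ge> - (a * 0.118)"
        using ak by (simp add: c114_def kappa114_def flip: k_def)
      then have "- (a * 0.118) / (2 * \<sigma> - 1) \<le> - c114 \<sigma> / (2 * \<sigma> - 1)"
        using sg by (intro divide_right_mono) auto
      also have "- (a * 0.118) / (2 * \<sigma> - 1) = a * 0.118 / (1 - 2 * \<sigma>)"
        by (metis minus_diff_eq minus_divide_divide minus_minus)
      also have "- c114 \<sigma> / (2 * \<sigma> - 1) = - (c114 \<sigma> / (2 * \<sigma> - 1))"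
        by (rule minus_divide_left[symmetric])
      finally show ?thesis .
    qed
    ultimately show "a * 0.118 / (1 - 2 * \<sigma>) + a * 0.0059 + a * 0.1475 / \<sigma> \<le>
        c111 \<sigma> / \<sigma> + c112 \<sigma> / (2 * \<sigma> + 1) + c113 \<sigma> / (\<sigma> + 1) - c114 \<sigma> / (2 * \<sigma> - 1)"
      by linarith
  qed (use P in simp)
  have 4: "0.59 * real_zeta (2 * \<sigma>) / T < 3 * real_zeta (2 * \<sigma>) / 5 * (1 / T)"
    using z T by (simp add: field_simps)
  have 5: "0 \<le> c12s \<sigma> * (1 / T powr (2 * \<sigma> + 1))"
    by (simp add: c12s_def kappa12s_def)
  show ?thesis unfolding P(2) using 1 2 3 4 5 by linarith
qed

lemma Q_bound_half:
  fixes T :: real and N :: nat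
  assumes T: "T \<ge> 200" and N: "T / 5 \<le> real N" "real N \<le> T / 5 + 1"
  shows "Q_bound T N (1 / 2) < 3 / 5 * (ln T / T) + c21s * (1 / T) + c22s * (1 / T ^ 2)"
proof -
  have N1: "N \<ge> 1" using N T by simp
  have "(\<Sum>k=1..N. real k powr (-1)) \<le> 1 + ln (real N)"
    by (rule sum_inverse_le_ln[OF N1])
  \<comment> \<open>N \<le> T / 5 + 1 \<le> T / 3 \<le> T / e, so the logarithm absorbs the 1 in the
    bound for the harmonic sum.\<close>
  also have "ln (real N) \<le> ln (T / exp 1)"
  proof -
    have "real N * exp 1 \<le> (T / 5 + 1) * 3"
      using N T exp_le by (intro mult_mono) auto
    also have "\<dots> \<le> T" using T by simp
    finally have "real N \<le> T / exp 1" by (simp add: field_simps)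
    then show ?thesis using N1 T by simp
  qed
  also have "1 + ln (T / exp 1) = ln T"
    using T by (simp add: ln_div)
  finally have S: "(\<Sum>k=1..N. real k powr (-1)) \<le> ln T" by simp
  \<comment> \<open>1.475 = 2 * 0.1475 * 5, from \<sigma> = 1/2 and the cut at T / 5.\<close>
  have "Q_bound T N (1 / 2) = 0.59 / T * (\<Sum>k=1..N. real k powr (-1)) + 1.475 / T"
    using T by (simp add: Q_bound_def powr_minus_divide)
  also have "\<dots> \<le> 0.59 / T * ln T + 1.475 / T"
    using S T by (intro add_right_mono mult_left_mono) auto
  also have "\<dots> < 3 / 5 * (ln T / T) + c21s * (1 / T) + c22s * (1 / T ^ 2)"
  proof -
    have "ln T \<ge> 0" using T by simp
    then have "0.59 / T * ln T \<le> 3 / 5 * (ln T / T)"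
      using T by (simp add: field_simps)
    moreover have "1.475 / T < c21s * (1 / T)"
      using T by (simp add: c21s_def field_simps)
    moreover have "0 \<le> c22s * (1 / T ^ 2)" by (simp add: c22s_def)
    ultimately show ?thesis by linarith
  qed
  finally show ?thesis .
qed

text \<open>Here \<zeta>(2\<sigma>) < 0, so lowering its coefficient from 0.59 to 0.39113 enlarges
  the bound. The delicate term is the one in 1 / (1 - 2\<sigma>), because 0.118 exceeds
  0.11361.\<close>

lemma Q_bound_lt_half:
  fixes \<sigma> T :: real and N :: nat
  assumes T: "T \<ge> 200" and sg: "0 < \<sigma>" "\<sigma> < 1 / 2"
    and N: "T / 5 \<le> real N" "real N \<le> T / 5 + 1"
  shows "Q_bound T N \<sigma> < (c311 \<sigma> / \<sigma> + c312 \<sigma> / (2 * \<sigma> + 1) + c313 \<sigma> / (\<sigma> + 1) + c314 \<sigma> / (1 - 2 * \<sigma>))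
             * (1 / T powr (2 * \<sigma>))
         + c30s * real_zeta (2 * \<sigma>) * (1 / T)
         + c32s \<sigma> * (1 / T powr (2 * \<sigma> + 1))"
proof -
  define a k P where "a = 25 powr \<sigma>" and "k = kappa powr \<sigma>" and "P = T powr (-2 * \<sigma>)"
  have P: "P > 0" "1 / T powr (2 * \<sigma>) = P"
    using T by (simp_all add: P_def powr_minus_divide)
  have a: "a > 0" and ak: "a * (1 + 0.1 * \<sigma>) \<le> k"
    using kappa_powr_bounds(1)[of \<sigma>] sg unfolding a_def k_def by simp_all
  have ak': "a \<le> k"
    using kappa_powr_bounds(2)[of \<sigma>] sg unfolding a_def k_def by simp
  with a have "k > 0" by linarith
  note ak' = ak' this
  have z: "real_zeta (2 * \<sigma>) < 0" using sg by (intro real_zeta_neg) auto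
  have 1: "Q_bound T N \<sigma> \<le> 0.59 * real_zeta (2 * \<sigma>) / T + a * P * (0.118 / (1 - 2 * \<sigma>) + 0.0059 + 0.1475 / \<sigma>)"
    unfolding a_def P_def using sg by (intro Q_bound_le_zeta T N) auto
  have 2: "a * P * (0.118 / (1 - 2 * \<sigma>) + 0.0059 + 0.1475 / \<sigma>) = (a * 0.118 / (1 - 2 * \<sigma>) + a * 0.0059 + a * 0.1475 / \<sigma>) * P"
    by (simp add: algebra_simps)
  have 3: "(a * 0.118 / (1 - 2 * \<sigma>) + a * 0.0059 + a * 0.1475 / \<sigma>) * P \<le> (c311 \<sigma> / \<sigma> + c312 \<sigma> / (2 * \<sigma> + 1) + c313 \<sigma> / (\<sigma> + 1) + c314 \<sigma> / (1 - 2 * \<sigma>)) * P"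
  proof (rule mult_right_mono)
    have "a * 0.1475 / \<sigma> \<le> c311 \<sigma> / \<sigma>"
      using sg ak' by (intro divide_right_mono) (auto simp: c311_def c111_def kappa111_def simp flip: k_def)
    \<comment> \<open>Half of \<open>k * 0.15655\<close> is set aside for 0.0059 and for the deficit
      0.00439 of the term in 1 / (1 - 2\<sigma>).\<close>
    moreover have "k * 0.15655 / 2 \<le> c312 \<sigma> / (2 * \<sigma> + 1)"
    proof -
      have "k * 0.15655 / 2 \<le> k * 0.15655 / (2 * \<sigma> + 1)"
        using sg ak' by (intro divide_left_mono) auto
      then show ?thesis by (simp add: c312_def c112_def kappa112_def flip: k_def)
    qed
    moreover have "0 \<le> c313 \<sigma> / (\<sigma> + 1)"
      using sg by (simp add: c313_def c113_def kappa113_def)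
    moreover have "a * 0.118 / (1 - 2 * \<sigma>) \<le> c314 \<sigma> / (1 - 2 * \<sigma>) + a * 0.00439"
    proof -
      \<comment> \<open>At \<sigma> = 0 this is the equality 0.118 = 0.11361 + 0.00439. The deficit
        may carry the factor 1 - 2\<sigma>, which cancels the denominator, because towards \<sigma>
        = 1/2 the growth of \<open>kappa powr \<sigma>\<close> relative to 25 powr \<sigma> makes up
        for it.\<close>
      have "a * 0.118 \<le> a * (1 + 0.1 * \<sigma>) * 0.11361 + a * 0.00439 * (1 - 2 * \<sigma>)"
      proof -
        have "a * 0.118 \<le> a * ((1 + 0.1 * \<sigma>) * 0.11361 + 0.00439 * (1 - 2 * \<sigma>))"
        proof (rule mult_left_mono)
          show "0.118 \<le> (1 + 0.1 * \<sigma>) * 0.11361 + 0.00439 * (1 - 2 * \<sigma>)"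
            using sg by (simp add: field_simps)
        qed (use a in simp)
        then show ?thesis by (simp add: algebra_simps)
      qed
      also have "\<dots> \<le> c314 \<sigma> + a * 0.00439 * (1 - 2 * \<sigma>)"
        using ak by (simp add: c314_def kappa314_def flip: k_def)
      finally have "a * 0.118 / (1 - 2 * \<sigma>) \<le> (c314 \<sigma> + a * 0.00439 * (1 - 2 * \<sigma>)) / (1 - 2 * \<sigma>)"
        using sg by (intro divide_right_mono) auto
      also have "\<dots> = c314 \<sigma> / (1 - 2 * \<sigma>) + a * 0.00439"
        unfolding add_divide_distrib using sg by (subst nonzero_mult_div_cancel_right) auto
      finally show ?thesis .
    qed
    moreover have "a * 0.0059 + a * 0.00439 \<le> k * 0.15655 / 2"
      using ak' a by simp
    ultimately show "a * 0.118 / (1 - 2 * \<sigma>) + a * 0.0059 + a * 0.1475 / \<sigma> \<le>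
        c311 \<sigma> / \<sigma> + c312 \<sigma> / (2 * \<sigma> + 1) + c313 \<sigma> / (\<sigma> + 1) + c314 \<sigma> / (1 - 2 * \<sigma>)"
      by linarith
  qed (use P in simp)
  have 4: "0.59 * real_zeta (2 * \<sigma>) / T < c30s * real_zeta (2 * \<sigma>) * (1 / T)"
    using z T by (simp add: c30s_def field_simps)
  have 5: "0 \<le> c32s \<sigma> * (1 / T powr (2 * \<sigma> + 1))"
    by (simp add: c32s_def c12s_def kappa12s_def)
  show ?thesis unfolding P(2) using 1 2 3 4 5 by linarith
qed

theorem theorem3p1:
  fixes \<sigma> T :: real
  assumes "0 < \<sigma>" and "\<sigma> \<le> 1" and "200 \<le> T"
  shows "Q_converges \<sigma> T \<and>
    (1 / 2 < \<sigma> \<longrightarrow>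
       Q \<sigma> T < 3 * real_zeta (2 * \<sigma>) / 5 * (1 / T)
         + (c111 \<sigma> / \<sigma> + c112 \<sigma> / (2 * \<sigma> + 1) + c113 \<sigma> / (\<sigma> + 1) - c114 \<sigma> / (2 * \<sigma> - 1))
             * (1 / T powr (2 * \<sigma>))
         + c12s \<sigma> * (1 / T powr (2 * \<sigma> + 1))) \<and>
    (\<sigma> = 1 / 2 \<longrightarrow>
       Q \<sigma> T < 3 / 5 * (ln T / T) + c21s * (1 / T) + c22s * (1 / T ^ 2)) \<and>
    (\<sigma> < 1 / 2 \<longrightarrow>
       Q \<sigma> T < (c311 \<sigma> / \<sigma> + c312 \<sigma> / (2 * \<sigma> + 1) + c313 \<sigma> / (\<sigma> + 1) + c314 \<sigma> / (1 - 2 * \<sigma>))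
             * (1 / T powr (2 * \<sigma>))
         + c30s * real_zeta (2 * \<sigma>) * (1 / T)
         + c32s \<sigma> * (1 / T powr (2 * \<sigma> + 1)))"
proof -
  \<comment> \<open>The least integer beyond T / 5: the right neighbour of every x < T / 5 is at
    most \<open>N\<close>, while \<open>N\<close> exceeds T / 5 by at most 1.\<close>
  define N where "N = nat \<lfloor>T / 5\<rfloor> + 1"
  have "\<lfloor>T / 5\<rfloor> \<ge> 0" using assms(3) by simp
  then have N: "of_int \<lfloor>T / 5\<rfloor> + 1 = real N"
    by (simp add: N_def)
  then have N': "T / 5 \<le> real N" "real N \<le> T / 5 + 1"
    by linarith+
  have conv: "Q_converges \<sigma> T" and le: "Q \<sigma> T \<le> Q_bound T N \<sigma>"
    using Q_le_Q_bound[OF assms(3,1,2), of N] N by simp_all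
  show ?thesis
  proof (intro conjI impI conv)
    assume "1 / 2 < \<sigma>"
    then show "Q \<sigma> T < 3 * real_zeta (2 * \<sigma>) / 5 * (1 / T)
         + (c111 \<sigma> / \<sigma> + c112 \<sigma> / (2 * \<sigma> + 1) + c113 \<sigma> / (\<sigma> + 1) - c114 \<sigma> / (2 * \<sigma> - 1))
             * (1 / T powr (2 * \<sigma>))
         + c12s \<sigma> * (1 / T powr (2 * \<sigma> + 1))"
      by (rule order_le_less_trans[OF le Q_bound_gt_half[OF assms(3) _ assms(2) N']])
  next
    assume half: "\<sigma> = 1 / 2"
    have "Q \<sigma> T \<le> Q_bound T N (1 / 2)"
      using le by (simp only: half)
    also have "\<dots> < 3 / 5 * (ln T / T) + c21s * (1 / T) + c22s * (1 / T ^ 2)"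
      by (rule Q_bound_half[OF assms(3) N'])
    finally show "Q \<sigma> T < 3 / 5 * (ln T / T) + c21s * (1 / T) + c22s * (1 / T ^ 2)" .
  next
    assume "\<sigma> < 1 / 2"
    then show "Q \<sigma> T < (c311 \<sigma> / \<sigma> + c312 \<sigma> / (2 * \<sigma> + 1) + c313 \<sigma> / (\<sigma> + 1) + c314 \<sigma> / (1 - 2 * \<sigma>))
             * (1 / T powr (2 * \<sigma>))
         + c30s * real_zeta (2 * \<sigma>) * (1 / T)
         + c32s \<sigma> * (1 / T powr (2 * \<sigma> + 1))"
      by (rule order_le_less_trans[OF le Q_bound_lt_half[OF assms(3) assms(1) _ N']])
  qed
qed

end
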